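(* Let $\lambda>0$ and $\nu\in(0,1)$. Let $N=(N_t)_{t\ge 0}$ be a unit-rate homogeneous Poisson process and let $W$ be a non-negative random variable, independent of $N$, with probability density function $$f_W(w)=\frac{1}{\Gamma(1+\nu)}\,\phi\!\left(-\nu,1-\nu;\frac{-w}{\Gamma(1+\nu)}\right),\qquad w\in\mathbb{R}_+ .$$ Put $q(t)=\lambda t^\nu/\Gamma(1+\nu)$ and $M_t=N_{Wq(t)}$, $t\ge 0$. Let $\mathcal{N}=(\mathcal{N}_t)_{t\ge 0}$ be the time-fractional Poisson process of parameters $\lambda$ and $\nu$. Then for every $t>0$ and every integer $k\ge 0$, $$\mathbb{P}(M_t=k)=\mathbb{P}(\mathcal{N}_t=k),$$ that is, the processes $M$ and $\mathcal{N}$ have the same one-dimensional marginal distributions. Consequently the functions $p_k(t)=\mathbb{P}(M_t=k)$, $k\ge 0$, satisfy, for $t>0$, $${}^C D^{\nu}_{0^+}p_k(t)=-\lambda p_k(t)+\lambda p_{k-1}(t),\qquad k\ge 0,$$ with the convention $p_{-1}(t)=0$.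
   Context: Wright function: $\phi(\alpha,\beta;z)=\sum_{r=0}^\infty \frac{z^r}{r!\,\Gamma(\alpha r+\beta)}$ for $\alpha,\beta,z\in\mathbb{C}$, $\Re(\alpha)>-1$ (with $1/\Gamma$ equal to $0$ at the poles of $\Gamma$). Time-fractional Poisson process of parameters $\lambda>0$ and $\nu\in(0,1)$: let $(\widetilde N_t)_{t\ge0}$ be a homogeneous Poisson process of rate $\lambda$ and let $(D_t)_{t\ge 0}$ be an independent $\nu$-stable subordinator with Lévy measure $\frac{\nu}{\Gamma(1-\nu)}x^{-1-\nu}\,dx$ on $(0,\infty)$ (and no drift). Let $E_t=\inf\{s: D_s>t\}$, $t\ge 0$, be its inverse. Then $\mathcal{N}_t=\widetilde N_{E_t}$. Caputo--Dzhrbashyan derivative of order $\nu\in(0,1)$ of an absolutely continuous function $f$: ${}^C D^{\nu}_{0^+}f(t)=\frac{1}{\Gamma(1-\nu)}\int_0^t (t-s)^{-\nu}f'(s)\,ds$. *)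

theory Defs
  imports "HOL-Probability.Probability"
begin

section \<open>The Wright function\<close>

text \<open>\<open>rGamma\<close> is the entire function \<open>1/Gamma\<close>; it vanishes at the poles of \<open>Gamma\<close>.\<close>

definition wright :: "complex \<Rightarrow> complex \<Rightarrow> complex \<Rightarrow> complex" where
  "wright \<alpha> \<beta> z = (\<Sum>r. z ^ r * rGamma (\<alpha> * of_nat r + \<beta>) / fact r)"

text \<open>For real arguments all terms of the series are real, so \<open>Re\<close> only changes the type.\<close>

definition wright_density :: "real \<Rightarrow> real \<Rightarrow> real" where
  "wright_density \<nu> w =
     1 / Gamma (1 + \<nu>) *
     Re (wright (of_real (- \<nu>)) (of_real (1 - \<nu>)) (of_real (- w / Gamma (1 + \<nu>))))"


section \<open>Processes indexed by the non-negative reals\<close>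

text \<open>Only times \<open>t \<ge> 0\<close> are relevant. Path properties are required for every sample point, so that
  the random time changes below are measurable without completing the probability space.\<close>

definition path_var :: "(real \<Rightarrow> 'a \<Rightarrow> 'b) \<Rightarrow> 'a \<Rightarrow> real \<Rightarrow> 'b" where
  "path_var X \<omega> = (\<lambda>t\<in>{0..}. X t \<omega>)"

text \<open>The library's \<open>indep_var\<close> requires both random variables to have the same codomain type.\<close>

definition indep_random_vars ::
    "'a measure \<Rightarrow> 'b measure \<Rightarrow> ('a \<Rightarrow> 'b) \<Rightarrow> 'c measure \<Rightarrow> ('a \<Rightarrow> 'c) \<Rightarrow> bool" where
  "indep_random_vars M S X T Y \<longleftrightarrow>
     X \<in> measurable M S \<and> Y \<in> measurable M T \<and>
     prob_space.indep_set M {X -` A \<inter> space M | A. A \<in> sets S} {Y -` B \<inter> space M | B. B \<in> sets T}"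

definition independent_increments ::
    "'a measure \<Rightarrow> 'b measure \<Rightarrow> (real \<Rightarrow> 'a \<Rightarrow> 'b::minus) \<Rightarrow> bool" where
  "independent_increments M S X \<longleftrightarrow>
     (\<forall>(n::nat) t. 0 \<le> t 0 \<and> (\<forall>i<n. t i < t (Suc i)) \<longrightarrow>
        prob_space.indep_vars M (\<lambda>_. S) (\<lambda>i \<omega>. X (t (Suc i)) \<omega> - X (t i) \<omega>) {..<n})"

definition increasing_rcont_paths ::
    "'a measure \<Rightarrow> (real \<Rightarrow> 'a \<Rightarrow> 'b::linorder_topology) \<Rightarrow> bool" where
  "increasing_rcont_paths M X \<longleftrightarrow>
     (\<forall>\<omega>\<in>space M. mono_on {0..} (\<lambda>t. X t \<omega>) \<and>
        (\<forall>t\<ge>0. continuous (at_right t) (\<lambda>s. X s \<omega>)))"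

definition poisson_process :: "'a measure \<Rightarrow> real \<Rightarrow> (real \<Rightarrow> 'a \<Rightarrow> nat) \<Rightarrow> bool" where
  "poisson_process M rate N \<longleftrightarrow>
     prob_space M \<and>
     (\<forall>t\<ge>0. N t \<in> measurable M (count_space UNIV)) \<and>
     (\<forall>\<omega>\<in>space M. N 0 \<omega> = 0) \<and>
     increasing_rcont_paths M N \<and>
     independent_increments M (count_space UNIV) N \<and>
     (\<forall>s t. 0 \<le> s \<and> s < t \<longrightarrow>
        distr M (count_space UNIV) (\<lambda>\<omega>. N t \<omega> - N s \<omega>)
          = measure_pmf (poisson_pmf (rate * (t - s))))"

text \<open>The drift \<open>d\<close> and the Levy measure \<open>\<mu>\<close> of a subordinator are its characteristics in the
  Levy--Khintchine formula for the Laplace transform.\<close>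

definition subordinator ::
    "'a measure \<Rightarrow> real \<Rightarrow> real measure \<Rightarrow> (real \<Rightarrow> 'a \<Rightarrow> real) \<Rightarrow> bool" where
  "subordinator M d \<mu> D \<longleftrightarrow>
     prob_space M \<and>
     (\<forall>t\<ge>0. D t \<in> borel_measurable M) \<and>
     (\<forall>\<omega>\<in>space M. D 0 \<omega> = 0) \<and>
     increasing_rcont_paths M D \<and>
     independent_increments M borel D \<and>
     (\<forall>s\<ge>0. \<forall>h\<ge>0. distr M borel (\<lambda>\<omega>. D (s + h) \<omega> - D s \<omega>) = distr M borel (D h)) \<and>
     d \<ge> 0 \<and> sets \<mu> = sets borel \<and> emeasure \<mu> {..0} = 0 \<and> integrable \<mu> (\<lambda>x. min 1 x) \<and>
     (\<forall>t\<ge>0. \<forall>u\<ge>0. (\<integral>\<omega>. exp (- u * D t \<omega>) \<partial>M)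
        = exp (- t * (d * u + (\<integral>x. 1 - exp (- u * x) \<partial>\<mu>))))"

definition stable_levy_measure :: "real \<Rightarrow> real measure" where
  "stable_levy_measure \<nu> =
     density lborel (\<lambda>x. ennreal (indicator {0<..} x * (\<nu> / Gamma (1 - \<nu>) * x powr (- 1 - \<nu>))))"

definition stable_subordinator :: "'a measure \<Rightarrow> real \<Rightarrow> (real \<Rightarrow> 'a \<Rightarrow> real) \<Rightarrow> bool" where
  "stable_subordinator M \<nu> D \<longleftrightarrow> subordinator M 0 (stable_levy_measure \<nu>) D"

definition inverse_subordinator :: "(real \<Rightarrow> 'a \<Rightarrow> real) \<Rightarrow> real \<Rightarrow> 'a \<Rightarrow> ennreal" where
  "inverse_subordinator D t \<omega> = (INF s\<in>{s. 0 \<le> s \<and> t < D s \<omega>}. ennreal s)"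

text \<open>The infimum is infinite only if the path of \<open>D\<close> is bounded by \<open>t\<close>, an event of probability
  zero on which \<open>enn2real\<close> replaces it by 0.\<close>

definition time_fractional_poisson_process ::
    "'a measure \<Rightarrow> real \<Rightarrow> real \<Rightarrow> (real \<Rightarrow> 'a \<Rightarrow> nat) \<Rightarrow> bool" where
  "time_fractional_poisson_process M rate \<nu> X \<longleftrightarrow>
     (\<exists>N D. poisson_process M rate N \<and> stable_subordinator M \<nu> D \<and>
        indep_random_vars M
          (PiM {0..} (\<lambda>_. count_space UNIV)) (path_var N)
          (PiM {0..} (\<lambda>_. borel)) (path_var D) \<and>
        (\<forall>t\<ge>0. \<forall>\<omega>\<in>space M. X t \<omega> = N (enn2real (inverse_subordinator D t \<omega>)) \<omega>))"


section \<open>The Caputo--Dzhrbashyan derivative\<close>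

definition absolutely_continuous_fun :: "real \<Rightarrow> real \<Rightarrow> (real \<Rightarrow> real) \<Rightarrow> bool" where
  "absolutely_continuous_fun a b f \<longleftrightarrow>
     (\<forall>\<epsilon>>0. \<exists>\<delta>>0. \<forall>(n::nat) x y.
        (\<forall>i<n. a \<le> x i \<and> x i \<le> y i \<and> y i \<le> b) \<and>
        disjoint_family_on (\<lambda>i. {x i<..<y i}) {..<n} \<and>
        (\<Sum>i<n. y i - x i) < \<delta> \<longrightarrow>
        (\<Sum>i<n. \<bar>f (y i) - f (x i)\<bar>) < \<epsilon>)"

text \<open>\<open>deriv f\<close> is arbitrary at points where \<open>f\<close> is not differentiable; for absolutely continuous
  \<open>f\<close> these form a Lebesgue null set.\<close>

definition caputo_derivative :: "real \<Rightarrow> (real \<Rightarrow> real) \<Rightarrow> real \<Rightarrow> real" where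
  "caputo_derivative \<nu> f t =
     1 / Gamma (1 - \<nu>) * (LINT s:{0<..<t}|lebesgue. (t - s) powr (- \<nu>) * deriv f s)"

definition caputo_differentiable :: "real \<Rightarrow> (real \<Rightarrow> real) \<Rightarrow> real \<Rightarrow> bool" where
  "caputo_differentiable \<nu> f t \<longleftrightarrow>
     absolutely_continuous_fun 0 t f \<and>
     set_integrable lebesgue {0<..<t} (\<lambda>s. (t - s) powr (- \<nu>) * deriv f s)"

end

theory Submission
  imports Defs "HOL-Complex_Analysis.Cauchy_Integral_Theorem"
begin

text \<open>
  With \<open>Y = W / Gamma (1 + \<nu>)\<close>, both \<open>W * q t\<close> and \<open>lam\<close> times the inverse subordinator at time \<open>t\<close> are
  independent of the Poisson process and have the same moments as \<open>lam * t powr \<nu> * Y\<close>, where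
  \<open>Y\<close> has \<open>n\<close>-th moment \<open>n! / Gamma (1 + \<nu> n)\<close>. These moments grow so slowly that the mixed Poisson
  probabilities are convergent power series in the moments, so both one-dimensional laws are given by the
  same series in \<open>t powr \<nu>\<close>, of Mittag-Leffler type, whose Caputo derivative is computed termwise with Beta
  integrals.

  The moments of the Wright density come from a Hankel-type contour integral for \<open>1/Gamma\<close>: on a contour
  bent into the left half-plane and avoiding 0 the density becomes a superposition of
  exponentials \<open>exp (- y * s powr \<nu>)\<close> that decay uniformly in \<open>s\<close>, and Fubini's theorem applies. Those of the
  inverse subordinator come from self-similarity, which identifies its law at time \<open>t\<close> with that
  of \<open>(t / D 1) powr \<nu>\<close>; the negative moments of \<open>D 1\<close> are Mellin transforms of its Laplace transform.
\<close>

section \<open>A Hankel-type integral for the reciprocal Gamma function\<close>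

text \<open>The Wright series cannot be integrated term by term against a power of \<open>y\<close>
  over the half-line, since every nonzero term diverges on its own; hence the detour through a
  contour. Its angle is squeezed from two sides: \<open>exp s\<close> must decay along the ray,
  which asks for \<open>\<theta> > pi / 2\<close>, and \<open>s powr \<nu>\<close> must keep a
  positive real part, so that \<open>exp (- y * s powr \<nu>)\<close> decays in \<open>y\<close>,
  which asks for \<open>\<nu> * \<theta> < pi / 2\<close>. A vertical line fails the first condition
  and, for \<open>\<nu> \<ge> 1 / 2\<close>, the negative axis fails the second. The angle
  \<open>pi / (1 + \<nu>)\<close> meets both. By contrast, the identification of the contour
  integral with \<open>1 / Gamma\<close> is done by collapsing onto the negative axis, which needs
  integrability at 0; it is therefore carried out for negative exponents only and then transported
  by the functional equation.\<close>

definition ray :: "real \<Rightarrow> real \<Rightarrow> complex" where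
  "ray \<theta> \<rho> = 1 + of_real \<rho> * cis \<theta>"

lemma Re_ray: "Re (ray \<theta> \<rho>) = 1 + \<rho> * cos \<theta>"
  and Im_ray: "Im (ray \<theta> \<rho>) = \<rho> * sin \<theta>"
  by (simp_all add: ray_def)

lemma ray_has_derivative: "(ray \<theta> has_vector_derivative cis \<theta>) (at \<rho> within S)"
  unfolding ray_def by (auto intro!: derivative_eq_intros simp: has_vector_derivative_def scaleR_conv_of_real)

lemma continuous_on_ray [continuous_intros]: "continuous_on S (ray \<theta>)"
  unfolding ray_def by (intro continuous_intros)

lemma ray_measurable [measurable]: "ray \<theta> \<in> borel_measurable borel"
  by (intro borel_measurable_continuous_onI continuous_intros)

section \<open>Growth estimates and integrals over the half-line\<close>

lemma set_integrable_exp_Ici: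
  fixes \<kappa> :: real
  assumes "\<kappa> > 0"
  shows "set_integrable lborel {0..} (\<lambda>x. exp (- \<kappa> * x))"
proof -
  have "set_integrable lborel {0<..} (\<lambda>x. exp (- \<kappa> * x))"
    using integrable_I0i_exp_mscale[OF assms] by (simp add: mult.commute)
  also have "?this \<longleftrightarrow> ?thesis"
    unfolding set_integrable_def
    by (intro integrable_cong_AE) (auto intro!: AE_I[of _ _ "{0}"] simp: indicator_def)
  finally show ?thesis .
qed

lemma powr_le_exp:
  fixes B c \<kappa> :: real
  assumes "B > 0" "\<kappa> > 0" "c \<ge> 0"
  obtains C where "C > 0" "\<And>x. x \<ge> 0 \<Longrightarrow> (c + x) powr B \<le> C * exp (\<kappa> * x)"
proof
  \<comment> \<open>The inequality \<open>z \<le> exp z\<close> at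
    \<open>z = \<kappa> * (c + x) / B\<close>, raised to the power \<open>B\<close>, leaves exactly
    this constant.\<close>
  define C where "C = (B / \<kappa>) powr B * exp (\<kappa> * c)"
  show "C > 0" using assms by (auto simp: C_def)
  show "(c + x) powr B \<le> C * exp (\<kappa> * x)" if "x \<ge> 0" for x
  proof -
    have "\<kappa> * (c + x) / B \<le> exp (\<kappa> * (c + x) / B)"
      using exp_ge_add_one_self[of "\<kappa> * (c + x) / B"] by linarith
    then have "c + x \<le> (B / \<kappa>) * exp (\<kappa> * (c + x) / B)"
      using assms by (simp add: field_simps)
    then have "(c + x) powr B \<le> ((B / \<kappa>) * exp (\<kappa> * (c + x) / B)) powr B"
      using assms that by (intro powr_mono2) auto
    also have "\<dots> = (B / \<kappa>) powr B * exp (\<kappa> * (c + x))"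
      using assms by (subst powr_mult) (auto simp: exp_powr_real)
    also have "\<dots> = C * exp (\<kappa> * x)"
      by (simp add: C_def exp_add algebra_simps)
    finally show ?thesis .
  qed
qed

lemma sublinear_powr:
  fixes y \<nu> \<epsilon> :: real
  assumes "y \<ge> 0" "0 < \<nu>" "\<nu> < 1" "\<epsilon> > 0"
  obtains C where "\<And>x. x \<ge> 0 \<Longrightarrow> y * x powr \<nu> \<le> C + \<epsilon> * x"
proof
  \<comment> \<open>Beyond \<open>X\<close> the factor \<open>x powr (1 - \<nu>)\<close> exceeds
    \<open>(y + 1) / \<epsilon>\<close>, so the linear term wins; below \<open>X\<close> a constant
    suffices. The \<open>+ 1\<close> keeps \<open>X\<close> positive when
    \<open>y = 0\<close>.\<close>
  define X where "X = ((y + 1) / \<epsilon>) powr (1 / (1 - \<nu>))"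
  show "y * x powr \<nu> \<le> y * X powr \<nu> + \<epsilon> * x" if "x \<ge> 0" for x
  proof (cases "x \<le> X")
    case True
    then have "y * x powr \<nu> \<le> y * X powr \<nu>"
      using assms that by (intro mult_left_mono powr_mono2) auto
    then show ?thesis using assms that by (simp add: add_increasing2)
  next
    case False
    have "X > 0" using assms by (auto simp: X_def)
    then have "x > 0" using False by auto
    have "(y + 1) / \<epsilon> = X powr (1 - \<nu>)"
      using assms by (simp add: X_def powr_powr)
    also have "\<dots> \<le> x powr (1 - \<nu>)"
      using False assms \<open>X > 0\<close> by (intro powr_mono2) auto
    finally have "y \<le> \<epsilon> * x powr (1 - \<nu>)"
      using assms by (simp add: field_simps)
    then have "y * x powr \<nu> \<le> \<epsilon> * x powr (1 - \<nu>) * x powr \<nu>"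
      by (intro mult_right_mono) auto
    also have "\<dots> = \<epsilon> * x"
      using \<open>x > 0\<close> by (simp add: mult.assoc flip: powr_add)
    finally show ?thesis using assms by (simp add: add_increasing)
  qed
qed

lemma set_integral_FTC_Ici:
  fixes E g :: "real \<Rightarrow> 'a::euclidean_space"
  assumes der: "\<And>x. x \<ge> 0 \<Longrightarrow> (E has_vector_derivative g x) (at x within {0..})"
    and cont: "continuous_on {0..} g"
    and int: "set_integrable lborel {0..} g"
    and lim: "(E \<longlongrightarrow> L) at_top"
  shows "(LBINT x:{0..}. g x) = L - E 0"
proof -
  have FTC: "(LBINT x:{0..R}. g x) = E R - E 0" if "R \<ge> 0" for R
    unfolding set_lebesgue_integral_def
  proof (rule integral_FTC_atLeastAtMost[OF that])
    show "(E has_vector_derivative g x) (at x within {0..R})" if "0 \<le> x" "x \<le> R" for x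
      using der[OF that(1)] by (rule has_vector_derivative_within_subset) auto
    show "continuous_on {0..R} g" using cont by (rule continuous_on_subset) auto
  qed
  have "((\<lambda>R. LBINT x:{0..R}. g x) \<longlongrightarrow> (LBINT x:{0..}. g x)) at_top"
    by (intro tendsto_set_lebesgue_integral_at_top int) auto
  moreover have "((\<lambda>R. LBINT x:{0..R}. g x) \<longlongrightarrow> L - E 0) at_top"
  proof (rule Lim_transform_eventually)
    show "((\<lambda>R. E R - E 0) \<longlongrightarrow> L - E 0) at_top" by (intro tendsto_diff lim tendsto_const)
    show "\<forall>\<^sub>F R in at_top. E R - E 0 = (LBINT x:{0..R}. g x)"
      using eventually_ge_at_top[of 0] by eventually_elim (simp add: FTC)
  qed
  ultimately show ?thesis by (rule tendsto_unique[OF trivial_limit_at_top_linorder])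
qed

text \<open>If \<open>f\<close> is real on the positive half-line, its integral over the Hankel-type contour formed by the
  ray from 1 in direction \<open>\<theta>\<close> and the conjugate ray is \<open>2 * \<i>\<close> times the imaginary part of the integral
  over the ray alone. Since \<open>\<theta> > pi / 2\<close>, \<open>exp\<close> decays along the ray.\<close>

locale bent_ray =
  fixes \<theta> :: real
  assumes theta_gt: "pi / 2 < \<theta>" and theta_less: "\<theta> < pi"
begin

text \<open>The decay rate of \<open>norm (exp (ray \<theta> \<rho>))\<close> in
  \<open>\<rho>\<close>; the sign makes it positive for an obtuse angle.\<close>

definition \<kappa> :: real where "\<kappa> = - cos \<theta>"

lemma kappa_pos: "\<kappa> > 0"
proof -
  have "cos \<theta> < cos (pi / 2)" using theta_gt theta_less by (intro cos_monotone_0_pi) auto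
  then show ?thesis by (simp add: \<kappa>_def)
qed

lemma kappa_le_1: "\<kappa> \<le> 1" 
  unfolding \<kappa>_def using cos_ge_minus_one[of \<theta>] by linarith

lemma sin_pos: "sin \<theta> > 0"
  using theta_gt theta_less by (intro sin_gt_zero) auto

lemma Re_ray_kappa: "Re (ray \<theta> \<rho>) = 1 - \<kappa> * \<rho>"
  by (simp add: \<kappa>_def Re_ray)

text \<open>Rotation by \<open>- \<theta>\<close> makes the ray horizontal. Its constant height
  \<open>- sin \<theta>\<close> gives both the distance of the ray from 0 and the fact that its
  points never pass the direction \<open>\<theta>\<close>.\<close>

lemma Im_ray_cis: "Im (ray \<theta> \<rho> * cis (-\<theta>)) = - sin \<theta>"
proof -
  have "ray \<theta> \<rho> * cis (-\<theta>) = cis (-\<theta>) + of_real \<rho>"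
    by (simp add: ray_def algebra_simps cis_mult flip: cis_divide)
  then show ?thesis by simp
qed

lemma norm_ray_ge: "norm (ray \<theta> \<rho>) \<ge> sin \<theta>"
proof -
  have "sin \<theta> \<le> \<bar>Im (ray \<theta> \<rho> * cis (-\<theta>))\<bar>" using Im_ray_cis by simp
  also have "\<dots> \<le> norm (ray \<theta> \<rho> * cis (-\<theta>))" by (rule abs_Im_le_cmod)
  finally show ?thesis by (simp add: norm_mult)
qed

lemma norm_ray_le: "\<rho> \<ge> 0 \<Longrightarrow> norm (ray \<theta> \<rho>) \<le> 1 + \<rho>"
  unfolding ray_def by (rule order.trans[OF norm_triangle_ineq]) (simp add: norm_mult)

lemma ray_nonzero [simp]: "ray \<theta> \<rho> \<noteq> 0"
  using norm_ray_ge[of \<rho>] sin_pos by auto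

lemma ray_not_nonpos: "\<rho> \<ge> 0 \<Longrightarrow> ray \<theta> \<rho> \<notin> \<real>\<^sub>\<le>\<^sub>0"
  using sin_pos by (cases "\<rho> = 0") (auto simp: complex_nonpos_Reals_iff Im_ray Re_ray)

text \<open>If the argument exceeded \<open>\<theta>\<close>, rotation by \<open>- \<theta>\<close>
  would lead into the closed upper half-plane, against \<open>Im_ray_cis\<close>.\<close>

lemma Arg_ray:
  assumes "\<rho> \<ge> 0"
  shows "0 \<le> Arg (ray \<theta> \<rho>)" "Arg (ray \<theta> \<rho>) \<le> \<theta>"
proof -
  let ?s = "ray \<theta> \<rho>"
  have "Im ?s \<ge> 0" using assms sin_pos by (simp add: Im_ray)
  then show "0 \<le> Arg ?s" by (metis Arg_less_0 not_less)
  show "Arg ?s \<le> \<theta>"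
  proof (rule ccontr)
    assume *: "\<not> Arg ?s \<le> \<theta>"
    have "?s * cis (-\<theta>) = rcis (norm ?s) (Arg ?s) * rcis 1 (-\<theta>)"
      by (subst rcis_cmod_Arg) (simp add: rcis_def)
    also have "\<dots> = rcis (norm ?s) (Arg ?s - \<theta>)"
      by (simp add: rcis_mult)
    finally have "Im (?s * cis (-\<theta>)) = norm ?s * sin (Arg ?s - \<theta>)" by simp
    moreover have "sin (Arg ?s - \<theta>) \<ge> 0"
      using * Arg_le_pi[of ?s] theta_gt by (intro sin_ge_zero) (auto intro: order.trans)
    ultimately show False using Im_ray_cis[of \<rho>] sin_pos
      by (metis mult_nonneg_nonneg neg_0_le_iff_le norm_ge_zero not_less)
  qed
qed

lemma norm_ray_powr: "norm (ray \<theta> \<rho> powr of_real a) = norm (ray \<theta> \<rho>) powr a"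
  by (subst norm_powr_real_powr') auto

lemma continuous_on_ray_powr [continuous_intros]:
  "S \<subseteq> {0..} \<Longrightarrow> continuous_on S (\<lambda>\<rho>. ray \<theta> \<rho> powr b)"
  using ray_not_nonpos by (intro continuous_intros) (auto simp: subset_eq complex_nonpos_Reals_iff  order_less_le)

text \<open>One constant serves all exponents in \<open>[-B, B]\<close>. This uniformity is what
  later allows dominated convergence in the exponent \<open>b\<close>. Negative exponents cause no
  blow-up because the ray stays away from 0.\<close>

lemma norm_ray_powr_bound:
  assumes "B > 0" "\<epsilon> > 0"
  obtains C where "C > 0"
    "\<And>a \<rho>. \<bar>a\<bar> \<le> B \<Longrightarrow> \<rho> \<ge> 0 \<Longrightarrow> norm (ray \<theta> \<rho>) powr a \<le> C * exp (\<epsilon> * \<rho>)"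
proof -
  \<comment> \<open>The summand \<open>1 / sin \<theta>\<close> dominates the inverse of the norm,
    and the summand 1 makes the base at least 1, so that the power increases with the
    exponent.\<close>
  define c where "c = 1 + 1 / sin \<theta>"
  have c: "c \<ge> 1" using sin_pos by (simp add: c_def)
  obtain C where C: "C > 0" "\<And>x. x \<ge> 0 \<Longrightarrow> (c + x) powr B \<le> C * exp (\<epsilon> * x)"
    by (rule powr_le_exp[OF assms, of c]) (use c in auto)
  have "norm (ray \<theta> \<rho>) powr a \<le> C * exp (\<epsilon> * \<rho>)" if "\<bar>a\<bar> \<le> B" "\<rho> \<ge> 0" for a \<rho>
  proof -
    have r: "norm (ray \<theta> \<rho>) > 0" by simp
    have "norm (ray \<theta> \<rho>) powr a \<le> (c + \<rho>) powr \<bar>a\<bar>"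
    proof (cases "a \<ge> 0")
      case True
      have "norm (ray \<theta> \<rho>) \<le> c + \<rho>" using norm_ray_le[OF that(2)] c by linarith
      then show ?thesis using True by (auto intro!: powr_mono2)
    next
      case False
      have "inverse (norm (ray \<theta> \<rho>)) \<le> inverse (sin \<theta>)"
        using norm_ray_ge sin_pos by (intro le_imp_inverse_le) auto
      also have "\<dots> \<le> c + \<rho>" using that by (simp add: c_def inverse_eq_divide)
      finally have "inverse (norm (ray \<theta> \<rho>)) powr \<bar>a\<bar> \<le> (c + \<rho>) powr \<bar>a\<bar>"
        by (intro powr_mono2) auto
      also have "inverse (norm (ray \<theta> \<rho>)) powr \<bar>a\<bar> = norm (ray \<theta> \<rho>) powr a"
        using False r by (simp add: powr_def ln_inverse)
      finally show ?thesis .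
    qed
    also have "\<dots> \<le> (c + \<rho>) powr B"
      using that c by (intro powr_mono) auto
    also have "\<dots> \<le> C * exp (\<epsilon> * \<rho>)" using that by (intro C)
    finally show ?thesis .
  qed
  then show thesis by (intro that[OF C(1)])
qed

text \<open>The integrand \<open>exp s * s powr (- b) ds\<close> of Hankel's integral for
  \<open>rGamma b\<close>, pulled back to the ray; \<open>cis \<theta>\<close> is the derivative of
  the parametrisation.\<close>

definition hankel :: "real \<Rightarrow> real \<Rightarrow> complex" where
  "hankel b \<rho> = exp (ray \<theta> \<rho>) * ray \<theta> \<rho> powr of_real (- b) * cis \<theta>"

lemma norm_hankel: "norm (hankel b \<rho>) = exp (1 - \<kappa> * \<rho>) * norm (ray \<theta> \<rho>) powr (- b)"
  by (simp only: hankel_def norm_mult norm_exp_eq_Re Re_ray_kappa norm_ray_powr norm_cis mult_1_right)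

lemma hankel_measurable [measurable]: "hankel b \<in> borel_measurable borel"
  unfolding hankel_def powr_def by simp

lemma continuous_on_hankel: "S \<subseteq> {0..} \<Longrightarrow> continuous_on S (hankel b)"
  unfolding hankel_def by (intro continuous_intros)

lemma hankel_bound:
  assumes "B > 0" "0 < \<epsilon>"
  obtains C where "C > 0"
    "\<And>b \<rho>. \<bar>b\<bar> \<le> B \<Longrightarrow> \<rho> \<ge> 0 \<Longrightarrow> norm (hankel b \<rho>) \<le> C * exp (- (\<kappa> - \<epsilon>) * \<rho>)"
proof -
  obtain C where C: "C > 0"
    "\<And>a \<rho>. \<bar>a\<bar> \<le> B \<Longrightarrow> \<rho> \<ge> 0 \<Longrightarrow> norm (ray \<theta> \<rho>) powr a \<le> C * exp (\<epsilon> * \<rho>)"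
    by (rule norm_ray_powr_bound[OF assms]) blast
  have "norm (hankel b \<rho>) \<le> (exp 1 * C) * exp (- (\<kappa> - \<epsilon>) * \<rho>)" if "\<bar>b\<bar> \<le> B" "\<rho> \<ge> 0" for b \<rho>
  proof -
    have "norm (hankel b \<rho>) \<le> exp (1 - \<kappa> * \<rho>) * (C * exp (\<epsilon> * \<rho>))"
      unfolding norm_hankel using that by (intro mult_left_mono C(2)) auto
    also have "\<dots> = (exp 1 * C) * exp (- (\<kappa> - \<epsilon>) * \<rho>)"
      by (simp add: algebra_simps flip: exp_add)
    finally show ?thesis .
  qed
  then show thesis by (intro that[of "exp 1 * C"]) (use C(1) in auto)
qed

lemma set_integrable_hankel: "set_integrable lborel {0..} (hankel b)"
proof -
  obtain C where C: "C > 0" "\<And>b' \<rho>. \<bar>b'\<bar> \<le> \<bar>b\<bar> + 1 \<Longrightarrow> \<rho> \<ge> 0 \<Longrightarrow>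
      norm (hankel b' \<rho>) \<le> C * exp (- (\<kappa> - \<kappa> / 2) * \<rho>)"
    by (rule hankel_bound[of "\<bar>b\<bar> + 1" "\<kappa> / 2"]) (use kappa_pos in auto)
  have *: "set_integrable lborel {0..} (\<lambda>x. C * exp (- (\<kappa> / 2) * x))"
    using kappa_pos by (intro set_integrable_mult_right set_integrable_exp_Ici) auto
  show ?thesis
    by (rule set_integrable_bound[OF *]) (use C in \<open>auto simp: set_borel_measurable_def\<close>)
qed


text \<open>By Cauchy's theorem the ray may be replaced by the upper side of the negative real axis, where the
  integral is Euler's integral for \<open>Gamma (1 - b)\<close>; the reflection formula does the rest.\<close>

lemma hankel_eq_rGamma_neg:
  assumes b: "b < 0"
  shows "Im (LBINT \<rho>:{0..}. hankel b \<rho>) = pi * rGamma b"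
proof -
  \<comment> \<open>For \<open>b < 0\<close> the integrand tends to 0 at the origin, so it is
    continuous on the closed half-plane and has a primitive up to the boundary. One primitive then
    serves the ray, the negative axis and the segment from 0 to 1.\<close>
  define S where "S = {s::complex. Im s \<ge> 0}"
  \<comment> \<open>writing the power in terms of \<open>- \<i> * s\<close> moves the branch cut to the lower half-plane\<close>
  define f :: "complex \<Rightarrow> complex" where
    "f = (\<lambda>s. exp s * (exp (of_real (- b) * (\<i> * pi / 2)) * (- \<i> * s) powr of_real (- b)))"
  have f_eq: "f s = exp s * s powr of_real (- b)" if "s \<in> S" for s
  proof (cases "s = 0")
    case False
    have "Ln (\<i> * (- \<i> * s)) = Ln (- \<i> * s) + \<i> * pi / 2"
      using that False by (subst Ln_times_ii) (auto simp: S_def)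
    then have "Ln s = Ln (- \<i> * s) + \<i> * pi / 2" by simp
    then show ?thesis using False
      by (simp add: f_def powr_def algebra_simps flip: exp_add)
  qed (simp add: f_def)
  have f_norm: "norm (f s) = exp (Re s) * norm s powr (- b)" if "s \<in> S" for s
    unfolding f_eq[OF that] norm_mult norm_exp_eq_Re by (subst norm_powr_real_powr') auto
  have cont: "continuous_on S f"
    unfolding f_def using b by (intro continuous_intros) (auto simp: S_def)
  have "convex S" unfolding S_def by (rule convex_halfspace_Im_ge)
  moreover have "f field_differentiable at s" if "s \<in> interior S - {}" for s
  proof -
    have "Im s > 0" using that interior_halfspace_ge[of \<i> 0] by (simp add: S_def)
    then have "- \<i> * s \<notin> \<real>\<^sub>\<le>\<^sub>0" by (auto simp: complex_nonpos_Reals_iff)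
    then show ?thesis unfolding f_def field_differentiable_def
      by (auto intro!: exI derivative_eq_intros)
  qed
  ultimately obtain F where F: "\<And>s. s \<in> S \<Longrightarrow> (F has_field_derivative f s) (at s within S)"
    by (rule holomorphic_convex_primitive[OF _ finite.emptyI cont]) blast+
  have FTC: "(LBINT x:{0..R}. f (\<gamma> x) * d) = F (\<gamma> R) - F (\<gamma> 0)"
    if "R \<ge> 0" and \<gamma>: "\<And>x. x \<ge> 0 \<Longrightarrow> \<gamma> x \<in> S"
      "\<And>x T. (\<gamma> has_vector_derivative d) (at x within T)" for R \<gamma> d
    unfolding set_lebesgue_integral_def
  proof (rule integral_FTC_atLeastAtMost[OF \<open>R \<ge> 0\<close>, where F = "F \<circ> \<gamma>", unfolded o_def])
    fix x assume x: "0 \<le> x" "x \<le> R"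
    have "((F \<circ> \<gamma>) has_vector_derivative d * f (\<gamma> x)) (at x within {0..R})"
      by (rule field_vector_diff_chain_within[OF \<gamma>(2)])
         (use F[OF \<gamma>(1)[OF x(1)]] \<gamma>(1) in \<open>auto intro: DERIV_subset\<close>)
    then show "((\<lambda>x. F (\<gamma> x)) has_vector_derivative f (\<gamma> x) * d) (at x within {0..R})"
      by (simp add: o_def mult.commute)
  next
    have "continuous_on {0..R} \<gamma>"
      using \<gamma>(2) by (auto intro!: continuous_on_vector_derivative)
    then show "continuous_on {0..R} (\<lambda>x. f (\<gamma> x) * d)"
      by (intro continuous_intros continuous_on_compose2[OF cont]) (use \<gamma>(1) in auto)
  qed
  have ray_S: "ray \<theta> \<rho> \<in> S" if "\<rho> \<ge> 0" for \<rho>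
    using that sin_pos by (simp add: S_def Im_ray)
  have neg_S: "- of_real \<rho> \<in> S" for \<rho> by (simp add: S_def)

  have A: "(LBINT \<rho>:{0..R}. hankel b \<rho>) = F (ray \<theta> R) - F 1" if "R \<ge> 0" for R
  proof -
    have "(LBINT \<rho>:{0..R}. hankel b \<rho>) = (LBINT \<rho>:{0..R}. f (ray \<theta> \<rho>) * cis \<theta>)"
      by (intro set_lebesgue_integral_cong) (auto simp: hankel_def f_eq ray_S)
    also have "\<dots> = F (ray \<theta> R) - F (ray \<theta> 0)"
      using that by (intro FTC ray_S ray_has_derivative)
    finally show ?thesis by (simp add: ray_def)
  qed
  define G where "G = (\<lambda>x::real. x powr (- b) / exp x)"
  have f_neg: "f (- of_real x) * (- 1) = - cis (- b * pi) * of_real (G x)" if "x \<ge> 0" for x :: real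
  proof (cases "x = 0")
    case False
    then have "x > 0" using that by simp
    then have "(- of_real x) powr of_real (- b) = (- 1) powr of_real (- b) * (of_real x powr of_real (- b) :: complex)"
      using powr_neg_real_complex[of x "of_real (-b)"] by simp
    also have "(- 1) powr of_real (- b) = cis (- b * pi)"
      by (simp add: powr_def cis_conv_exp algebra_simps)
    also have "of_real x powr of_real (- b) = (of_real (x powr (- b)) :: complex)"
      using that by (subst powr_of_real) auto
    finally show ?thesis
      unfolding f_eq[OF neg_S] G_def by (simp add: exp_minus exp_of_real field_simps)
  qed (use b in \<open>simp add: f_def G_def\<close>)
  have B: "sin (b * pi) * (LBINT x:{0..R}. G x) = Im (F (- of_real R)) - Im (F 0)" if "R \<ge> 0" for R
  proof -
    have "F (- of_real R) - F 0 = (LBINT x:{0..R}. f (- of_real x) * (- 1))"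
      using that by (subst FTC[where \<gamma> = "\<lambda>x. - of_real x"])
         (auto simp: S_def has_vector_derivative_def scaleR_conv_of_real intro!: derivative_eq_intros)
    also have "\<dots> = (LBINT x:{0..R}. - cis (- b * pi) * of_real (G x))"
      using f_neg by (intro set_lebesgue_integral_cong) auto
    also have "\<dots> = - cis (- b * pi) * of_real (LBINT x:{0..R}. G x)"
      by (subst set_integral_mult_right) (simp only: set_integral_complex_of_real)
    finally have "Im (F (- of_real R) - F 0) = Im (- cis (- b * pi) * of_real (LBINT x:{0..R}. G x))"
      by (rule arg_cong)
    then show ?thesis by (simp add: mult.commute)
  qed
  \<comment> \<open>The ray starts at 1 but the negative axis at 0. The integrand is real on the
    segment between them, so the gap does not affect imaginary parts.\<close>
  have "Im (F 1 - F 0) = 0"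
  proof -
    have "F (of_real 1) - F (of_real 0) = (LBINT x:{0..1}. f (of_real x) * 1)"
      by (subst FTC[where \<gamma> = of_real])
         (auto simp: S_def has_vector_derivative_def scaleR_conv_of_real intro!: derivative_eq_intros)
    also have "\<dots> = (LBINT x:{0..1}. of_real (exp x * x powr (- b)))"
      by (intro set_lebesgue_integral_cong)
         (auto simp: f_eq S_def exp_of_real powr_of_real simp flip: of_real_minus)
    also have "\<dots> = of_real (LBINT x:{0..1}. exp x * x powr (- b))"
      by (rule set_integral_complex_of_real)
    finally show ?thesis by simp
  qed
  \<comment> \<open>A chord closes the contour at infinity. By convexity it stays in the half-plane
    \<open>Re z \<le> 1 - \<kappa> * R\<close> and in a ball of radius \<open>1 + R\<close>, so the
    integrand is exponentially small on it while its length grows linearly.\<close>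
  have "((\<lambda>R. norm (F (ray \<theta> R) - F (- of_real R))) \<longlongrightarrow> 0) at_top"
  proof (rule tendsto_sandwich[OF _ _ tendsto_const])
    show "\<forall>\<^sub>F R in at_top. norm (F (ray \<theta> R) - F (- of_real R)) \<le>
        exp (1 - \<kappa> * R) * (1 + R) powr (- b) * (1 + 2 * R)"
      using eventually_ge_at_top[of 0]
    proof eventually_elim
      case (elim R)
      let ?L = "closed_segment (ray \<theta> R) (- of_real R)"
      have "?L \<subseteq> S" using \<open>convex S\<close> ray_S[OF elim] neg_S by (simp add: closed_segment_subset)
      have "norm (F (ray \<theta> R) - F (- of_real R)) \<le>
          (exp (1 - \<kappa> * R) * (1 + R) powr (- b)) * norm (ray \<theta> R - (- of_real R))"
      proof (rule field_differentiable_bound[where S = ?L])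
        fix z assume z: "z \<in> ?L"
        then show "(F has_field_derivative f z) (at z within ?L)"
          using F \<open>?L \<subseteq> S\<close> by (meson DERIV_subset subsetD)
        have "z \<in> {z. Re z \<le> 1 - \<kappa> * R}"
        proof -
          have "\<kappa> * R \<le> 1 * R" using kappa_le_1 elim by (intro mult_right_mono)
          then have "?L \<subseteq> {z. Re z \<le> 1 - \<kappa> * R}"
            by (intro closed_segment_subset convex_halfspace_Re_le) (auto simp: Re_ray_kappa)
          then show ?thesis using z by blast
        qed
        moreover have "z \<in> cball 0 (1 + R)"
        proof -
          have "?L \<subseteq> cball 0 (1 + R)"
            using norm_ray_le[OF elim] elim by (intro closed_segment_subset) (auto simp: dist_norm)
          then show ?thesis using z by blast
        qed
        ultimately show "norm (f z) \<le> exp (1 - \<kappa> * R) * (1 + R) powr (- b)"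
          using z \<open>?L \<subseteq> S\<close> b by (subst f_norm) (auto intro!: mult_mono powr_mono2)
      qed auto
      also have "norm (ray \<theta> R - (- of_real R)) \<le> 1 + 2 * R"
        using norm_triangle_ineq[of "ray \<theta> R" "of_real R"] norm_ray_le[OF elim] elim by simp
      finally show ?case by (simp add: mult_left_mono)
    qed
    show "((\<lambda>R. exp (1 - \<kappa> * R) * (1 + R) powr (- b) * (1 + 2 * R)) \<longlongrightarrow> 0) at_top"
      using kappa_pos b by real_asymp
  qed simp
  then have lim1: "((\<lambda>R. Im (F (ray \<theta> R)) - Im (F (- of_real R))) \<longlongrightarrow> 0) at_top"
    by (auto dest!: tendsto_norm_zero_cancel tendsto_Im)
  have intG: "set_integrable lborel {0..} G" and valG: "(LBINT x:{0..}. G x) = Gamma (1 - b)"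
  proof -
    have hi: "(G has_integral Gamma (1 - b)) {0..}"
      using Gamma_integral_real[of "1 - b"] b by (simp add: G_def)
    moreover have "integrable lborel (\<lambda>x. indicator {0..} x * G x)"
    proof (rule integrableI_nonneg)
      show "(\<integral>\<^sup>+x. ennreal (indicator {0..} x * G x) \<partial>lborel) < \<infinity>"
        using Gamma_conv_nn_integral_real[of "1 - b"] b
        by (simp add: G_def flip: less_top) (metis ennreal_neq_top infinity_ennreal_def)
    qed (auto simp: G_def)
    ultimately show int: "set_integrable lborel {0..} G" by (simp add: set_integrable_def)
    then show "(LBINT x:{0..}. G x) = Gamma (1 - b)"
      using hi by (simp add: set_borel_integral_eq_integral integral_unique)
  qed
  have "((\<lambda>R. Im (LBINT \<rho>:{0..R}. hankel b \<rho>)) \<longlongrightarrow> Im (LBINT \<rho>:{0..}. hankel b \<rho>)) at_top"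
    by (intro tendsto_Im tendsto_set_lebesgue_integral_at_top set_integrable_hankel) auto
  moreover have "((\<lambda>R. sin (b * pi) * (LBINT x:{0..R}. G x)) \<longlongrightarrow> sin (b * pi) * Gamma (1 - b)) at_top"
    unfolding valG[symmetric]
    by (intro tendsto_intros tendsto_set_lebesgue_integral_at_top intG) auto
  ultimately have "((\<lambda>R. Im (LBINT \<rho>:{0..R}. hankel b \<rho>) - sin (b * pi) * (LBINT x:{0..R}. G x)) \<longlongrightarrow>
      Im (LBINT \<rho>:{0..}. hankel b \<rho>) - sin (b * pi) * Gamma (1 - b)) at_top"
    by (rule tendsto_diff)
  moreover have "((\<lambda>R. Im (LBINT \<rho>:{0..R}. hankel b \<rho>) - sin (b * pi) * (LBINT x:{0..R}. G x)) \<longlongrightarrow> 0) at_top"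
  proof (rule Lim_transform_eventually[OF lim1])
    show "\<forall>\<^sub>F R in at_top. Im (F (ray \<theta> R)) - Im (F (- of_real R)) =
       Im (LBINT \<rho>:{0..R}. hankel b \<rho>) - sin (b * pi) * (LBINT x:{0..R}. G x)"
      using eventually_ge_at_top[of 0]
      by eventually_elim (use \<open>Im (F 1 - F 0) = 0\<close> in \<open>simp add: A B\<close>)
  qed
  ultimately have "Im (LBINT \<rho>:{0..}. hankel b \<rho>) - sin (b * pi) * Gamma (1 - b) = 0"
    by (rule tendsto_unique[rotated]) auto
  moreover have "rGamma b * rGamma (1 - b) = sin (pi * b) / pi"
  proof -
    have "complex_of_real (rGamma b * rGamma (1 - b)) = rGamma (of_real b) * rGamma (1 - of_real b)"
      by (simp only: of_real_mult rGamma_complex_of_real[symmetric] of_real_diff of_real_1)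
    also have "\<dots> = of_real (sin (pi * b) / pi)"
      unfolding rGamma_reflection_complex by (simp only: of_real_mult[symmetric] sin_of_real of_real_divide)
    finally have "complex_of_real (rGamma b * rGamma (1 - b)) = of_real (sin (pi * b) / pi)" .
    then show ?thesis by (rule of_real_eq_iff[THEN iffD1])
  qed
  moreover have "Gamma (1 - b) > 0" using b by (intro Gamma_real_pos) auto
  ultimately have "Im (LBINT \<rho>:{0..}. hankel b \<rho>) = sin (pi * b) * Gamma (1 - b)"
      and r: "Gamma (1 - b) \<noteq> 0" "sin (pi * b) = pi * rGamma b * rGamma (1 - b)"
    by (simp_all add: mult.commute[of b] mult.assoc)
  moreover have "rGamma (1 - b) * Gamma (1 - b) = 1"
    using r(1) by (simp add: Gamma_def)
  ultimately show ?thesis by (simp add: mult.assoc)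
qed


text \<open>Integration by parts along the ray. The boundary term at \<open>\<rho> = 0\<close> is
  \<open>exp 1\<close>, which is real and drops out of the imaginary part; what remains mirrors
  \<open>rGamma b = b * rGamma (b + 1)\<close>.\<close>

lemma hankel_recurrence:
  "Im (LBINT \<rho>:{0..}. hankel b \<rho>) = b * Im (LBINT \<rho>:{0..}. hankel (b + 1) \<rho>)"
proof -
  define E where "E = (\<lambda>\<rho>. exp (ray \<theta> \<rho>) * ray \<theta> \<rho> powr of_real (- b))"
  have int: "set_integrable lborel {0..} (\<lambda>\<rho>. hankel b \<rho> - of_real b * hankel (b + 1) \<rho>)"
    by (intro set_integral_diff set_integrable_mult_right set_integrable_hankel)
  obtain C where C: "C > 0" "\<And>b' \<rho>. \<bar>b'\<bar> \<le> \<bar>b\<bar> + 1 \<Longrightarrow> \<rho> \<ge> 0 \<Longrightarrow>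
      norm (hankel b' \<rho>) \<le> C * exp (- (\<kappa> - \<kappa> / 2) * \<rho>)"
    by (rule hankel_bound[of "\<bar>b\<bar> + 1" "\<kappa> / 2"]) (use kappa_pos in auto)
  have E_lim: "(E \<longlongrightarrow> 0) at_top"
  proof (rule Lim_null_comparison)
    show "\<forall>\<^sub>F R in at_top. norm (E R) \<le> C * exp (- (\<kappa> / 2) * R)"
      using eventually_ge_at_top[of 0]
    proof eventually_elim
      case (elim R)
      have "norm (E R) = norm (hankel b R)" by (simp add: E_def hankel_def norm_mult)
      then show ?case using C(2)[of b R] elim by simp
    qed
    show "((\<lambda>R. C * exp (- (\<kappa> / 2) * R)) \<longlongrightarrow> 0) at_top"
      using kappa_pos by real_asymp
  qed
  have "(LBINT \<rho>:{0..}. hankel b \<rho> - of_real b * hankel (b + 1) \<rho>) = 0 - E 0"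
  proof (rule set_integral_FTC_Ici[OF _ _ int E_lim])
    fix \<rho> :: real assume \<rho>: "0 \<le> \<rho>"
    define r :: complex where "r = of_real (- b)"
    define P where "P = ray \<theta> \<rho> powr (r - 1)"
    define Q where "Q = ray \<theta> \<rho> powr r"
    have "((\<lambda>s. exp s * s powr r) has_field_derivative
        exp (ray \<theta> \<rho>) * Q + r * P * exp (ray \<theta> \<rho>)) (at (ray \<theta> \<rho>))"
    proof -
      have d1: "((\<lambda>s. s powr r) has_field_derivative r * P) (at (ray \<theta> \<rho>))"
        unfolding P_def by (rule has_field_derivative_powr) (rule ray_not_nonpos, rule \<rho>)
      have d2: "(exp has_field_derivative exp (ray \<theta> \<rho>)) (at (ray \<theta> \<rho>))"
        by (rule DERIV_exp)
      show ?thesis using DERIV_mult[OF d2 d1] by (simp only: Q_def)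
    qed
    then have "(((\<lambda>s. exp s * s powr r) \<circ> ray \<theta>) has_vector_derivative
        cis \<theta> * (exp (ray \<theta> \<rho>) * Q + r * P * exp (ray \<theta> \<rho>))) (at \<rho> within {0..})"
      by (rule field_vector_diff_chain_within[OF ray_has_derivative has_field_derivative_at_within])
    moreover have "hankel b \<rho> = exp (ray \<theta> \<rho>) * Q * cis \<theta>" by (simp add: hankel_def Q_def r_def)
    moreover have "hankel (b + 1) \<rho> = exp (ray \<theta> \<rho>) * P * cis \<theta>"
    proof -
      have "of_real (- (b + 1)) = r - 1" by (simp add: r_def)
      then show ?thesis by (simp only: hankel_def P_def)
    qed
    moreover have "of_real b = - r" by (simp add: r_def)
    moreover have "E = (\<lambda>s. exp s * s powr r) \<circ> ray \<theta>" by (simp add: E_def o_def r_def)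
    ultimately show "(E has_vector_derivative hankel b \<rho> - of_real b * hankel (b + 1) \<rho>) (at \<rho> within {0..})"
      by (simp add: algebra_simps)
  qed (auto intro!: continuous_intros continuous_on_hankel)
  moreover have "(LBINT \<rho>:{0..}. hankel b \<rho> - of_real b * hankel (b + 1) \<rho>) =
      (LBINT \<rho>:{0..}. hankel b \<rho>) - of_real b * (LBINT \<rho>:{0..}. hankel (b + 1) \<rho>)"
    by (subst set_integral_diff) (auto intro!: set_integrable_mult_right set_integrable_hankel)
  ultimately have "Im ((LBINT \<rho>:{0..}. hankel b \<rho>) - of_real b * (LBINT \<rho>:{0..}. hankel (b + 1) \<rho>)) = Im (- E 0)"
    by simp
  also have "Im (- E 0) = 0"
    by (simp add: E_def ray_def Im_exp)
  finally show ?thesis by simp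
qed

text \<open>The recurrence lowers \<open>b\<close> by 1 until it is negative. Each step divides by
  \<open>b - 1\<close>, which is why integers are excluded here.\<close>

lemma hankel_eq_rGamma_nonint:
  assumes "b \<notin> \<int>"
  shows "Im (LBINT \<rho>:{0..}. hankel b \<rho>) = pi * rGamma b"
proof -
  have "Im (LBINT \<rho>:{0..}. hankel b \<rho>) = pi * rGamma b" if "b \<notin> \<int>" "b < real n" for n b
    using that
  proof (induction n arbitrary: b)
    case (Suc n)
    have "b - 1 \<notin> \<int>" using Suc.prems(1) by (metis Ints_1 Ints_add diff_add_cancel)
    then have "pi * rGamma (b - 1) = (b - 1) * Im (LBINT \<rho>:{0..}. hankel b \<rho>)"
      using hankel_recurrence[of "b - 1"] Suc by simp
    moreover have "rGamma (b - 1) = (b - 1) * rGamma b"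
      using rGamma_plus1[of "b - 1"] by simp
    moreover have "b - 1 \<noteq> 0" using Suc.prems(1) by auto
    ultimately show ?case by (simp add: mult.left_commute)
  qed (use hankel_eq_rGamma_neg in auto)
  with assms show ?thesis using reals_Archimedean2 by blast
qed

text \<open>The recurrence is void at \<open>b = 0\<close>, so the integers are reached by continuity in \<open>b\<close>.\<close>

lemma hankel_eq_rGamma: "Im (LBINT \<rho>:{0..}. hankel b \<rho>) = pi * rGamma b"
proof (cases "b \<in> \<int>")
  case True
  \<comment> \<open>The offset \<open>1 / (n + 2)\<close> lies strictly between 0 and 1, so these
    points approaching the integer \<open>b\<close> are never integers.\<close>
  define c where "c = (\<lambda>n. b - 1 / (real n + 2))"
  have c_lim: "c \<longlonglongrightarrow> b" unfolding c_def by real_asymp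
  have c_le: "\<bar>c n\<bar> \<le> \<bar>b\<bar> + 1" for n
  proof -
    have "0 \<le> 1 / (real n + 2)" "1 / (real n + 2) \<le> 1" by auto
    then show ?thesis unfolding c_def by linarith
  qed
  have c_nonint: "c n \<notin> \<int>" for n
  proof
    assume "c n \<in> \<int>"
    then have "b - c n \<in> \<int>" using True by (rule Ints_diff[rotated])
    then obtain k where k: "1 / (real n + 2) = of_int k" by (auto simp: c_def elim!: Ints_cases)
    have "0 < 1 / (real n + 2)" "1 / (real n + 2) < 1" by auto
    with k have "0 < k" "k < 1" by (simp_all del: zero_less_divide_iff)
    then show False by simp
  qed
  obtain C where C: "C > 0" "\<And>b' \<rho>. \<bar>b'\<bar> \<le> \<bar>b\<bar> + 1 \<Longrightarrow> \<rho> \<ge> 0 \<Longrightarrow>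
      norm (hankel b' \<rho>) \<le> C * exp (- (\<kappa> - \<kappa> / 2) * \<rho>)"
    by (rule hankel_bound[of "\<bar>b\<bar> + 1" "\<kappa> / 2"]) (use kappa_pos in auto)
  have "(\<lambda>n. LBINT \<rho>:{0..}. hankel (c n) \<rho>) \<longlonglongrightarrow> (LBINT \<rho>:{0..}. hankel b \<rho>)"
    unfolding set_lebesgue_integral_def
  proof (rule integral_dominated_convergence)
    show "integrable lborel (\<lambda>\<rho>. indicator {0..} \<rho> *\<^sub>R (C * exp (- (\<kappa> / 2) * \<rho>)))"
      using kappa_pos
      by (fold set_integrable_def) (intro set_integrable_mult_right set_integrable_exp_Ici, auto)
    show "AE \<rho> in lborel. (\<lambda>n. indicat_real {0..} \<rho> *\<^sub>R hankel (c n) \<rho>) \<longlonglongrightarrow> indicat_real {0..} \<rho> *\<^sub>R hankel b \<rho>"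
    proof (rule AE_I2)
      fix \<rho>
      have "(\<lambda>n. hankel (c n) \<rho>) \<longlonglongrightarrow> hankel b \<rho>" if "\<rho> \<ge> 0"
        unfolding hankel_def using ray_not_nonpos[OF that]
        by (intro tendsto_mult tendsto_const tendsto_powr_complex tendsto_of_real tendsto_minus c_lim)
      then show "(\<lambda>n. indicat_real {0..} \<rho> *\<^sub>R hankel (c n) \<rho>) \<longlonglongrightarrow> indicat_real {0..} \<rho> *\<^sub>R hankel b \<rho>"
        by (cases "\<rho> \<ge> 0") simp_all
    qed
    show "AE \<rho> in lborel. norm (indicat_real {0..} \<rho> *\<^sub>R hankel (c n) \<rho>) \<le>
        indicator {0..} \<rho> *\<^sub>R (C * exp (- (\<kappa> / 2) * \<rho>))" for n
      using C(2)[OF c_le[of n]] by (auto intro!: AE_I2 simp: indicator_def)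
  qed auto
  then have "(\<lambda>n. Im (LBINT \<rho>:{0..}. hankel (c n) \<rho>)) \<longlonglongrightarrow> Im (LBINT \<rho>:{0..}. hankel b \<rho>)"
    by (rule tendsto_Im)
  moreover have "(\<lambda>n. Im (LBINT \<rho>:{0..}. hankel (c n) \<rho>)) \<longlonglongrightarrow> pi * rGamma b"
    unfolding hankel_eq_rGamma_nonint[OF c_nonint]
    by (rule tendsto_mult[OF tendsto_const
          isCont_tendsto_compose[OF DERIV_isCont[OF has_field_derivative_rGamma] c_lim]])
  ultimately show ?thesis by (rule LIMSEQ_unique)
qed (rule hankel_eq_rGamma_nonint)

end

section \<open>Moments of the Wright density\<close>

lemma power_exp_bound:
  fixes a :: real
  assumes "a > 0"
  obtains C where "C > 0" "\<And>y. y \<ge> 0 \<Longrightarrow> y ^ n * exp (- a * y) \<le> C * exp (- (a / 2) * y)"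
proof -
  obtain C where C: "C > 0" "\<And>y. y \<ge> 0 \<Longrightarrow> (1 + y) powr (real n + 1) \<le> C * exp ((a / 2) * y)"
    by (rule powr_le_exp[of "real n + 1" "a / 2" 1]) (use assms in auto)
  show ?thesis
  proof (rule that[OF C(1)])
    fix y :: real assume y: "y \<ge> 0"
    have "y ^ n \<le> (1 + y) ^ n" using y by (intro power_mono) auto
    also have "\<dots> = (1 + y) powr real n" using y by (simp add: powr_realpow)
    also have "\<dots> \<le> (1 + y) powr (real n + 1)" using y by (intro powr_mono) auto
    also have "\<dots> \<le> C * exp ((a / 2) * y)" by (rule C(2)[OF y])
    finally have "y ^ n * exp (- a * y) \<le> C * exp ((a / 2) * y) * exp (- a * y)"
      by (intro mult_right_mono) auto
    also have "\<dots> = C * exp (- (a / 2) * y)"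
      by (simp add: mult.assoc flip: exp_add)
    finally show "y ^ n * exp (- a * y) \<le> C * exp (- (a / 2) * y)" .
  qed
qed

text \<open>Integration by parts, by induction on \<open>n\<close>; the boundary term at 0
  contributes only for \<open>n = 0\<close>. The argument is complex because it will be
  \<open>s powr \<nu>\<close> for \<open>s\<close> on the contour.\<close>

lemma set_integral_power_exp_complex:
  fixes w :: complex
  assumes w: "Re w > 0"
  shows "(LBINT y:{0..}. of_real y ^ n * exp (- of_real y * w)) = fact n / w ^ Suc n"
proof -
  let ?g = "\<lambda>n y. of_real y ^ n * exp (- of_real y * w)"
  have bound: "\<exists>C>0. \<forall>y\<ge>0. norm (?g n y) \<le> C * exp (- (Re w / 2) * y)" for n
  proof -
    obtain C where C: "C > 0" "\<And>y. y \<ge> 0 \<Longrightarrow> y ^ n * exp (- Re w * y) \<le> C * exp (- (Re w / 2) * y)"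
      by (rule power_exp_bound[OF w]) blast
    then show ?thesis
      by (intro exI[of _ C]) (auto simp: norm_mult norm_power mult.commute)
  qed
  have int: "set_integrable lborel {0..} (?g n)" for n
  proof -
    from bound[of n] obtain C where C: "C > 0" "\<And>y. y \<ge> 0 \<Longrightarrow> norm (?g n y) \<le> C * exp (- (Re w / 2) * y)"
      by blast
    have *: "set_integrable lborel {0..} (\<lambda>x. C * exp (- (Re w / 2) * x))"
      using w by (intro set_integrable_mult_right set_integrable_exp_Ici) auto
    show ?thesis
      by (rule set_integrable_bound[OF *]) (use C in \<open>auto simp: set_borel_measurable_def abs_mult\<close>)
  qed
  have lim: "(?g n \<longlongrightarrow> 0) at_top" for n
  proof -
    from bound[of n] obtain C where C: "C > 0" "\<And>y. y \<ge> 0 \<Longrightarrow> norm (?g n y) \<le> C * exp (- (Re w / 2) * y)"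
      by blast
    show ?thesis
    proof (rule Lim_null_comparison)
      show "\<forall>\<^sub>F y in at_top. norm (?g n y) \<le> C * exp (- (Re w / 2) * y)"
        using eventually_ge_at_top[of 0] by eventually_elim (rule C(2))
      show "((\<lambda>y. C * exp (- (Re w / 2) * y)) \<longlongrightarrow> 0) at_top" using w by real_asymp
    qed
  qed
  have exp_der: "((\<lambda>y. exp (- of_real y * w)) has_vector_derivative - w * exp (- of_real y * w)) (at y within S)" for y S
    by (auto intro!: derivative_eq_intros has_vector_derivative_real_field simp: has_real_derivative_iff_has_vector_derivative)
  show "(LBINT y:{0..}. ?g n y) = fact n / w ^ Suc n"
  proof (induction n)
    case 0
    have "(LBINT y:{0..}. - w * ?g 0 y) = 0 - ?g 0 0"
    proof (rule set_integral_FTC_Ici[where E = "?g 0"])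
      show "(?g 0 has_vector_derivative - w * ?g 0 y) (at y within {0..})" for y
        using exp_der[of y] by simp
    qed (intro continuous_intros set_integrable_mult_right int lim)+
    then have "- w * (LBINT y:{0..}. ?g 0 y) = - 1" by (subst (asm) set_integral_mult_right) simp
    moreover have "w \<noteq> 0" using w by auto
    ultimately show ?case by (simp add: field_simps)
  next
    case (Suc n)
    have "(LBINT y:{0..}. of_nat (Suc n) * ?g n y - w * ?g (Suc n) y) = 0 - ?g (Suc n) 0"
    proof (rule set_integral_FTC_Ici[where E = "?g (Suc n)"])
      fix y :: real
      have "((\<lambda>z. z ^ Suc n * exp (- z * w)) has_field_derivative
          of_nat (Suc n) * (z ^ n * exp (- z * w)) - w * (z ^ Suc n * exp (- z * w))) (at z)" for z
      proof -
        have p: "((\<lambda>z. z ^ Suc n) has_field_derivative of_nat (Suc n) * z ^ n) (at z)"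
          using DERIV_power[OF DERIV_ident, of "Suc n" z] by (simp del: power_Suc)
        have e: "((\<lambda>z. exp (- z * w)) has_field_derivative - w * exp (- z * w)) (at z)"
          by (auto intro!: derivative_eq_intros)
        show ?thesis using DERIV_mult[OF p e] by (simp only: mult_ac diff_conv_add_uminus mult_minus_left mult_minus_right)
      qed
      then show "(?g (Suc n) has_vector_derivative of_nat (Suc n) * ?g n y - w * ?g (Suc n) y) (at y within {0..})"
        by (rule has_vector_derivative_real_field)
    qed (intro continuous_intros set_integral_diff set_integrable_mult_right int lim)+
    then have "of_nat (Suc n) * (LBINT y:{0..}. ?g n y) = w * (LBINT y:{0..}. ?g (Suc n) y)"
      using set_integral_diff(2)[OF set_integrable_mult_right[OF int[of n], of "of_nat (Suc n)"]
          set_integrable_mult_right[OF int[of "Suc n"], of w]]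
      by (simp only: set_integral_mult_right) simp
    then have "w * (LBINT y:{0..}. ?g (Suc n) y) = of_nat (Suc n) * (fact n / w ^ Suc n)"
      unfolding Suc.IH by (rule sym)
    moreover have "w \<noteq> 0" using w by auto
    ultimately have "(LBINT y:{0..}. ?g (Suc n) y) = of_nat (Suc n) * (fact n / w ^ Suc n) / w"
      by (metis nonzero_mult_div_cancel_left)
    then show ?case by (simp add: fact_Suc)
  qed
qed


section \<open>The rescaled Wright density (the M-Wright or Mainardi function) as a contour
  integral\<close>

definition mainardi :: "real \<Rightarrow> real \<Rightarrow> real" where
  "mainardi \<nu> y = Re (wright (of_real (- \<nu>)) (of_real (1 - \<nu>)) (of_real (- y)))"

locale mainardi_ray = bent_ray +
  fixes \<nu> :: real
  assumes nu: "0 < \<nu>" "\<nu> < 1" and nu_theta: "\<nu> * \<theta> < pi / 2"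
begin

lemma ray_powr_power: "(ray \<theta> \<rho> powr a) ^ r = ray \<theta> \<rho> powr (of_nat r * a)"
  by (simp add: powr_def mult.assoc flip: exp_of_nat_mult)

lemma nu_theta_pos: "\<nu> * \<theta> > 0"
  using nu theta_gt pi_gt_zero by (intro mult_pos_pos) linarith+

text \<open>The modulus of a point of the ray is at least \<open>sin \<theta>\<close> and its
  argument lies in \<open>[0, \<theta>]\<close>, where \<open>cos (\<nu> * x)\<close> decreases. As
  the bound does not depend on \<open>\<rho>\<close>, it yields decay in \<open>y\<close> uniformly
  along the ray.\<close>

lemma Re_ray_powr_ge:
  assumes "\<rho> \<ge> 0"
  shows "cos (\<nu> * \<theta>) * sin \<theta> powr \<nu> \<le> Re (ray \<theta> \<rho> powr of_real \<nu>)"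
proof -
  let ?s = "ray \<theta> \<rho>"
  have eq: "Re (?s powr of_real \<nu>) = norm ?s powr \<nu> * cos (\<nu> * Arg ?s)"
    by (simp add: powr_def Re_exp Arg_eq_Im_Ln)
  have le: "\<nu> * Arg ?s \<le> \<nu> * \<theta>" using nu Arg_ray[OF assms] by (intro mult_left_mono) auto
  have "cos (\<nu> * \<theta>) \<le> cos (\<nu> * Arg ?s)"
  proof (rule cos_monotone_0_pi_le)
    show "\<nu> * \<theta> \<le> pi" using nu_theta pi_gt_zero by linarith
  qed (use nu Arg_ray[OF assms] le in auto)
  moreover have "sin \<theta> powr \<nu> \<le> norm ?s powr \<nu>"
    using sin_pos norm_ray_ge nu by (intro powr_mono2) auto
  moreover have "cos (\<nu> * \<theta>) > 0"
    using nu_theta nu_theta_pos pi_gt_zero by (intro cos_gt_zero_pi) linarith+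
  ultimately show ?thesis unfolding eq by (subst mult.commute) (intro mult_mono, auto)
qed

lemma Re_ray_powr_bound_pos: "cos (\<nu> * \<theta>) * sin \<theta> powr \<nu> > 0"
proof (intro mult_pos_pos cos_gt_zero_pi)
  show "- (pi / 2) < \<nu> * \<theta>" using nu_theta_pos pi_gt_zero by linarith
qed (use nu_theta sin_pos in auto)

text \<open>This is \<open>exp s * s powr (\<nu> - 1) * exp (- y * s powr \<nu>)\<close> on the ray:
  the integrand of the inverse Laplace transform, at time 1, of
  \<open>s powr (\<nu> - 1) * exp (- y * s powr \<nu>)\<close>.\<close>

definition mainardi_kernel :: "real \<Rightarrow> real \<Rightarrow> complex" where
  "mainardi_kernel y \<rho> = hankel (1 - \<nu>) \<rho> * exp (- of_real y * ray \<theta> \<rho> powr of_real \<nu>)"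

lemma hankel_mult_power: "hankel (1 - \<nu>) \<rho> * (ray \<theta> \<rho> powr of_real \<nu>) ^ r = hankel (1 - \<nu> - \<nu> * real r) \<rho>"
proof -
  have "ray \<theta> \<rho> powr of_real (- (1 - \<nu>)) * (ray \<theta> \<rho> powr of_real \<nu>) ^ r
      = ray \<theta> \<rho> powr of_real (- (1 - \<nu> - \<nu> * real r))"
    unfolding ray_powr_power by (simp add: algebra_simps flip: powr_add)
  moreover have "hankel (1 - \<nu>) \<rho> * W = exp (ray \<theta> \<rho>) * (ray \<theta> \<rho> powr of_real (- (1 - \<nu>)) * W) * cis \<theta>" for W
    by (simp only: hankel_def mult_ac)
  ultimately show ?thesis by (simp only: hankel_def)
qed

lemma mainardi_kernel_series:
  "(\<lambda>r. of_real ((- y) ^ r / fact r) * hankel (1 - \<nu> - \<nu> * real r) \<rho>) sums mainardi_kernel y \<rho>"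
proof -
  have "(\<lambda>r. hankel (1 - \<nu>) \<rho> * ((- of_real y * ray \<theta> \<rho> powr of_real \<nu>) ^ r /\<^sub>R fact r)) sums mainardi_kernel y \<rho>"
    unfolding mainardi_kernel_def by (intro sums_mult exp_converges)
  moreover have "hankel (1 - \<nu>) \<rho> * ((- of_real y * ray \<theta> \<rho> powr of_real \<nu>) ^ r /\<^sub>R fact r) =
      of_real ((- y) ^ r / fact r) * hankel (1 - \<nu> - \<nu> * real r) \<rho>" for r
    unfolding hankel_mult_power[symmetric] power_mult_distrib
    by (simp add: scaleR_conv_of_real field_simps)
  ultimately show ?thesis by simp
qed

lemma norm_partial_sum_le:
  "norm (\<Sum>r<n. of_real ((- y) ^ r / fact r) * hankel (1 - \<nu> - \<nu> * real r) \<rho>) \<le>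
    norm (hankel (1 - \<nu>) \<rho>) * exp (\<bar>y\<bar> * norm (ray \<theta> \<rho>) powr \<nu>)"
proof -
  let ?x = "\<bar>y\<bar> * norm (ray \<theta> \<rho>) powr \<nu>"
  have "norm (\<Sum>r<n. of_real ((- y) ^ r / fact r) * hankel (1 - \<nu> - \<nu> * real r) \<rho>) \<le>
     (\<Sum>r<n. norm (of_real ((- y) ^ r / fact r) * hankel (1 - \<nu> - \<nu> * real r) \<rho>))"
    by (rule norm_sum)
  also have "\<dots> = (\<Sum>r<n. norm (hankel (1 - \<nu>) \<rho>) * (?x ^ r / fact r))"
  proof (rule sum.cong[OF refl])
    fix r
    have "norm (of_real ((- y) ^ r / fact r) :: complex) = \<bar>y\<bar> ^ r / fact r"
      by (simp add: norm_power norm_divide)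
    then show "norm (of_real ((- y) ^ r / fact r) * hankel (1 - \<nu> - \<nu> * real r) \<rho>) =
       norm (hankel (1 - \<nu>) \<rho>) * (?x ^ r / fact r)"
      unfolding hankel_mult_power[symmetric] norm_mult norm_power norm_ray_powr power_mult_distrib
      by simp
  qed
  also have "\<dots> = norm (hankel (1 - \<nu>) \<rho>) * (\<Sum>r<n. ?x ^ r / fact r)"
    by (simp add: sum_distrib_left)
  also have "(\<Sum>r<n. ?x ^ r / fact r) \<le> exp ?x"
  proof -
    have s: "(\<lambda>r. ?x ^ r / fact r) sums exp ?x"
      using exp_converges[of ?x] by (simp add: divide_inverse mult.commute)
    have "(\<Sum>r<n. ?x ^ r / fact r) \<le> (\<Sum>r. ?x ^ r / fact r)"
      using s by (intro sum_le_suminf) (auto simp: sums_iff)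
    then show ?thesis using s by (simp add: sums_iff)
  qed
  finally show ?thesis by (simp add: mult_left_mono)
qed

text \<open>Since \<open>\<nu> < 1\<close>, the factor
  \<open>exp (\<bar>y\<bar> * norm s powr \<nu>)\<close> costs an arbitrarily small part of the
  decay rate. One quarter of \<open>\<kappa>\<close> pays for it, another quarter for the power of
  \<open>s\<close>, and half of \<open>\<kappa>\<close> is left.\<close>

lemma mainardi_kernel_dominated:
  obtains C where "\<And>\<rho>. \<rho> \<ge> 0 \<Longrightarrow>
    norm (hankel (1 - \<nu>) \<rho>) * exp (\<bar>y\<bar> * norm (ray \<theta> \<rho>) powr \<nu>) \<le> C * exp (- (\<kappa> / 2) * \<rho>)"
proof -
  obtain C where C: "C > 0" "\<And>b' \<rho>. \<bar>b'\<bar> \<le> 1 \<Longrightarrow> \<rho> \<ge> 0 \<Longrightarrow>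
      norm (hankel b' \<rho>) \<le> C * exp (- (\<kappa> - \<kappa> / 4) * \<rho>)"
    by (rule hankel_bound[of 1 "\<kappa> / 4"]) (use kappa_pos in auto)
  obtain D where D: "\<And>x. x \<ge> 0 \<Longrightarrow> \<bar>y\<bar> * x powr \<nu> \<le> D + \<kappa> / 4 * x"
    by (rule sublinear_powr[of "\<bar>y\<bar>" \<nu> "\<kappa> / 4"]) (use kappa_pos nu in auto)
  show ?thesis
  proof (rule that)
    fix \<rho> :: real assume \<rho>: "\<rho> \<ge> 0"
    have "\<bar>y\<bar> * norm (ray \<theta> \<rho>) powr \<nu> \<le> \<bar>y\<bar> * (1 + \<rho>) powr \<nu>"
      using norm_ray_le[OF \<rho>] nu by (intro mult_left_mono powr_mono2) auto
    also have "\<dots> \<le> D + \<kappa> / 4 * (1 + \<rho>)" using \<rho> by (intro D) auto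
    finally have "norm (hankel (1 - \<nu>) \<rho>) * exp (\<bar>y\<bar> * norm (ray \<theta> \<rho>) powr \<nu>) \<le>
        (C * exp (- (\<kappa> - \<kappa> / 4) * \<rho>)) * exp (D + \<kappa> / 4 * (1 + \<rho>))"
      using C(2)[of "1 - \<nu>" \<rho>] nu \<rho> by (intro mult_mono) (auto intro: mult_nonneg_nonneg less_imp_le[OF C(1)])
    also have "\<dots> = (C * exp (D + \<kappa> / 4)) * exp (- (\<kappa> / 2) * \<rho>)"
    proof -
      have "- (\<kappa> - \<kappa> / 4) * \<rho> + (D + \<kappa> / 4 * (1 + \<rho>)) = (D + \<kappa> / 4) + - (\<kappa> / 2) * \<rho>"
        by (simp add: field_simps)
      then show ?thesis by (simp only: mult.assoc exp_add[symmetric])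
    qed
    finally show "norm (hankel (1 - \<nu>) \<rho>) * exp (\<bar>y\<bar> * norm (ray \<theta> \<rho>) powr \<nu>) \<le>
        (C * exp (D + \<kappa> / 4)) * exp (- (\<kappa> / 2) * \<rho>)" .
  qed
qed

lemma Im_of_real_mult: "Im (of_real a * z) = a * Im z"
  by simp

text \<open>Expanding the exponential in the kernel, the term of index \<open>r\<close> integrates
  to \<open>pi * rGamma (1 - \<nu> - \<nu> * r)\<close> by Hankel's formula, which reproduces the
  Wright series. Its convergence comes out of the same dominated convergence argument.\<close>

lemma mainardi_eq_integral: "mainardi \<nu> y = Im (LBINT \<rho>:{0..}. mainardi_kernel y \<rho>) / pi"
proof -
  let ?t = "\<lambda>r \<rho>. of_real ((- y) ^ r / fact r) * hankel (1 - \<nu> - \<nu> * real r) \<rho>"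
  obtain C where C: "\<And>\<rho>. \<rho> \<ge> 0 \<Longrightarrow>
    norm (hankel (1 - \<nu>) \<rho>) * exp (\<bar>y\<bar> * norm (ray \<theta> \<rho>) powr \<nu>) \<le> C * exp (- (\<kappa> / 2) * \<rho>)"
    by (rule mainardi_kernel_dominated) blast
  have "(\<lambda>n. LBINT \<rho>:{0..}. (\<Sum>r<n. ?t r \<rho>)) \<longlonglongrightarrow> (LBINT \<rho>:{0..}. mainardi_kernel y \<rho>)"
    unfolding set_lebesgue_integral_def
  proof (rule integral_dominated_convergence)
    show "integrable lborel (\<lambda>\<rho>. indicator {0..} \<rho> *\<^sub>R (C * exp (- (\<kappa> / 2) * \<rho>)))"
      using kappa_pos
      by (fold set_integrable_def) (intro set_integrable_mult_right set_integrable_exp_Ici, auto)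
    show "AE \<rho> in lborel. (\<lambda>n. indicat_real {0..} \<rho> *\<^sub>R (\<Sum>r<n. ?t r \<rho>)) \<longlonglongrightarrow> indicat_real {0..} \<rho> *\<^sub>R mainardi_kernel y \<rho>"
      using mainardi_kernel_series[unfolded sums_def] by (intro AE_I2 tendsto_scaleR tendsto_const)
    show "AE \<rho> in lborel. norm (indicat_real {0..} \<rho> *\<^sub>R (\<Sum>r<n. ?t r \<rho>)) \<le>
        indicator {0..} \<rho> *\<^sub>R (C * exp (- (\<kappa> / 2) * \<rho>))" for n
      using order.trans[OF norm_partial_sum_le C] by (auto intro!: AE_I2 simp: indicator_def)
    show "(\<lambda>\<rho>. indicat_real {0..} \<rho> *\<^sub>R mainardi_kernel y \<rho>) \<in> borel_measurable lborel"
      unfolding mainardi_kernel_def powr_def by measurable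
  qed measurable
  then have "(\<lambda>n. Im (LBINT \<rho>:{0..}. (\<Sum>r<n. ?t r \<rho>))) \<longlonglongrightarrow> Im (LBINT \<rho>:{0..}. mainardi_kernel y \<rho>)"
    by (rule tendsto_Im)
  moreover have "Im (LBINT \<rho>:{0..}. (\<Sum>r<n. ?t r \<rho>)) =
      (\<Sum>r<n. pi * ((- y) ^ r * rGamma (1 - \<nu> - \<nu> * real r) / fact r))" for n
  proof -
    have "(LBINT \<rho>:{0..}. (\<Sum>r<n. ?t r \<rho>)) = (\<Sum>r<n. LBINT \<rho>:{0..}. ?t r \<rho>)"
      unfolding set_lebesgue_integral_def scaleR_sum_right
      by (rule Bochner_Integration.integral_sum)
         (fold set_integrable_def, intro set_integrable_mult_right set_integrable_hankel)
    also have "\<dots> = (\<Sum>r<n. of_real ((- y) ^ r / fact r) * (LBINT \<rho>:{0..}. hankel (1 - \<nu> - \<nu> * real r) \<rho>))"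
      by (intro sum.cong refl set_integral_mult_right)
    finally show ?thesis
      by (simp only: Im_sum Im_of_real_mult hankel_eq_rGamma) (simp add: mult_ac)
  qed
  ultimately have "(\<lambda>r. pi * ((- y) ^ r * rGamma (1 - \<nu> - \<nu> * real r) / fact r)) sums Im (LBINT \<rho>:{0..}. mainardi_kernel y \<rho>)"
    by (simp add: sums_def)
  then have "(\<lambda>r. (- y) ^ r * rGamma (1 - \<nu> - \<nu> * real r) / fact r) sums (Im (LBINT \<rho>:{0..}. mainardi_kernel y \<rho>) / pi)"
    by (auto dest: sums_divide[where c = pi])
  then have "(\<lambda>r. complex_of_real ((- y) ^ r * rGamma (1 - \<nu> - \<nu> * real r) / fact r)) sums
      of_real (Im (LBINT \<rho>:{0..}. mainardi_kernel y \<rho>) / pi)"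
    by (rule sums_of_real)
  moreover have "complex_of_real ((- y) ^ r * rGamma (1 - \<nu> - \<nu> * real r) / fact r) =
      of_real (- y) ^ r * rGamma (of_real (- \<nu>) * of_nat r + of_real (1 - \<nu>)) / fact r" for r
  proof -
    have "of_real (- \<nu>) * of_nat r + of_real (1 - \<nu>) = complex_of_real (1 - \<nu> - \<nu> * real r)"
      by simp
    then show ?thesis by (simp only: rGamma_complex_of_real) simp
  qed
  ultimately have "wright (of_real (- \<nu>)) (of_real (1 - \<nu>)) (of_real (- y)) =
      of_real (Im (LBINT \<rho>:{0..}. mainardi_kernel y \<rho>) / pi)"
    unfolding wright_def by (simp only: sums_iff)
  then show ?thesis by (simp add: mainardi_def)
qed

lemma norm_mainardi_kernel_le:
  assumes "y \<ge> 0" "\<rho> \<ge> 0"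
  shows "norm (mainardi_kernel y \<rho>) \<le> norm (hankel (1 - \<nu>) \<rho>) * exp (- (cos (\<nu> * \<theta>) * sin \<theta> powr \<nu>) * y)"
proof -
  have "y * (cos (\<nu> * \<theta>) * sin \<theta> powr \<nu>) \<le> y * Re (ray \<theta> \<rho> powr of_real \<nu>)"
    using assms by (intro mult_left_mono Re_ray_powr_ge)
  then show ?thesis
    unfolding mainardi_kernel_def norm_mult norm_exp_eq_Re by (intro mult_left_mono) (auto simp: mult.commute)
qed

text \<open>Fubini's theorem with \<open>y\<close> integrated first: the inner integral is
  \<open>fact n / (s powr \<nu>) ^ Suc n\<close>, which turns \<open>hankel (1 - \<nu>)\<close> into
  \<open>hankel (1 + \<nu> * real n)\<close>. Absolute integrability follows from a majorant that is
  a product of a function of \<open>\<rho>\<close> and a function of \<open>y\<close>.\<close>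

lemma mainardi_moments:
  "set_integrable lborel {0..} (\<lambda>y. y ^ n * mainardi \<nu> y)"
  "(LBINT y:{0..}. y ^ n * mainardi \<nu> y) = fact n * rGamma (1 + \<nu> * real n)"
proof -
  define c where "c = cos (\<nu> * \<theta>) * sin \<theta> powr \<nu>"
  have c: "c > 0" unfolding c_def by (rule Re_ray_powr_bound_pos)
  define f where "f = (\<lambda>\<rho> y. indicat_real {0..} \<rho> *\<^sub>R indicat_real {0..} y *\<^sub>R (of_real y ^ n * mainardi_kernel y \<rho>))"
  obtain C where C: "C > 0" "\<And>y. y \<ge> 0 \<Longrightarrow> y ^ n * exp (- c * y) \<le> C * exp (- (c / 2) * y)"
    by (rule power_exp_bound[OF c]) blast
  have f_meas: "case_prod f \<in> borel_measurable (lborel \<Otimes>\<^sub>M lborel)"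
    unfolding f_def mainardi_kernel_def powr_def by measurable
  have norm_f: "norm (f \<rho> y) \<le> norm (indicat_real {0..} \<rho> *\<^sub>R hankel (1 - \<nu>) \<rho>) *
      (indicat_real {0..} y *\<^sub>R (C * exp (- (c / 2) * y)))" for \<rho> y
  proof (cases "\<rho> \<ge> 0 \<and> y \<ge> 0")
    case True
    then have "norm (f \<rho> y) = y ^ n * norm (mainardi_kernel y \<rho>)" by (simp add: f_def norm_mult norm_power)
    also have "\<dots> \<le> y ^ n * (norm (hankel (1 - \<nu>) \<rho>) * exp (- c * y))"
      using True norm_mainardi_kernel_le[of y \<rho>] by (intro mult_left_mono) (auto simp: c_def)
    also have "\<dots> = norm (hankel (1 - \<nu>) \<rho>) * (y ^ n * exp (- c * y))" by simp
    also have "\<dots> \<le> norm (hankel (1 - \<nu>) \<rho>) * (C * exp (- (c / 2) * y))"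
      using True by (intro mult_left_mono C(2)) auto
    finally show ?thesis using True by simp
  qed (auto simp: f_def)
  have int1: "integrable lborel (\<lambda>y. indicat_real {0..} y *\<^sub>R (C * exp (- (c / 2) * y)))"
    using c by (fold set_integrable_def) (intro set_integrable_mult_right set_integrable_exp_Ici, auto)
  have int2: "integrable lborel (\<lambda>\<rho>. norm (indicat_real {0..} \<rho> *\<^sub>R hankel (1 - \<nu>) \<rho>))"
    using set_integrable_hankel unfolding set_integrable_def by (rule integrable_norm)
  have "integrable (lborel \<Otimes>\<^sub>M lborel) (\<lambda>(\<rho>, y). norm (indicat_real {0..} \<rho> *\<^sub>R hankel (1 - \<nu>) \<rho>) *
      (indicat_real {0..} y *\<^sub>R (C * exp (- (c / 2) * y))))"
  proof (rule lborel_pair.Fubini_integrable)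
    show "AE \<rho> in lborel. integrable lborel (\<lambda>y. case (\<rho>, y) of (\<rho>, y) \<Rightarrow>
        norm (indicat_real {0..} \<rho> *\<^sub>R hankel (1 - \<nu>) \<rho>) * (indicat_real {0..} y *\<^sub>R (C * exp (- (c / 2) * y))))"
      unfolding prod.case by (intro AE_I2 integrable_mult_right int1)
    show "integrable lborel (\<lambda>\<rho>. LBINT y. norm (case (\<rho>, y) of (\<rho>, y) \<Rightarrow>
        norm (indicat_real {0..} \<rho> *\<^sub>R hankel (1 - \<nu>) \<rho>) * (indicat_real {0..} y *\<^sub>R (C * exp (- (c / 2) * y)))))"
      unfolding prod.case real_norm_def abs_mult abs_norm_cancel
      by (subst integral_mult_right_zero) (intro integrable_mult_left int2)
  qed measurable
  then have int_f: "integrable (lborel \<Otimes>\<^sub>M lborel) (case_prod f)"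
  proof (rule Bochner_Integration.integrable_bound[OF _ f_meas], intro AE_I2)
    show "norm (case_prod f p) \<le> norm (case p of (\<rho>, y) \<Rightarrow> norm (indicat_real {0..} \<rho> *\<^sub>R hankel (1 - \<nu>) \<rho>) *
      (indicat_real {0..} y *\<^sub>R (C * exp (- (c / 2) * y))))" for p
      using order.trans[OF norm_f abs_ge_self, of "fst p" "snd p"]
      by (simp only: prod.case_eq_if real_norm_def)
  qed
  have inner1: "Im (LBINT \<rho>. f \<rho> y) = pi * (indicat_real {0..} y * (y ^ n * mainardi \<nu> y))" for y
  proof -
    have "(LBINT \<rho>. f \<rho> y) = (LBINT \<rho>:{0..}. (indicat_real {0..} y * of_real y ^ n) * mainardi_kernel y \<rho>)"
      unfolding set_lebesgue_integral_def
      by (intro Bochner_Integration.integral_cong refl) (simp add: f_def scaleR_conv_of_real)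
    also have "\<dots> = of_real (indicat_real {0..} y * y ^ n) * (LBINT \<rho>:{0..}. mainardi_kernel y \<rho>)"
      by (subst set_integral_mult_right) simp
    finally show ?thesis by (simp add: mainardi_eq_integral)
  qed
  have inner2: "(LBINT y. f \<rho> y) = indicat_real {0..} \<rho> *\<^sub>R (fact n * hankel (1 + \<nu> * real n) \<rho>)" for \<rho>
  proof (cases "\<rho> \<ge> 0")
    case True
    let ?w = "ray \<theta> \<rho> powr of_real \<nu>"
    have w: "Re ?w > 0" using Re_ray_powr_ge[OF True] Re_ray_powr_bound_pos by linarith
    have "(LBINT y. f \<rho> y) = (LBINT y:{0..}. hankel (1 - \<nu>) \<rho> * (of_real y ^ n * exp (- of_real y * ?w)))"
      using True by (simp add: f_def set_lebesgue_integral_def mainardi_kernel_def mult_ac)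
    also have "\<dots> = hankel (1 - \<nu>) \<rho> * (fact n / ?w ^ Suc n)"
      by (subst set_integral_mult_right) (simp only: set_integral_power_exp_complex[OF w])
    also have "hankel (1 - \<nu>) \<rho> = hankel (1 + \<nu> * real n) \<rho> * ?w ^ Suc n"
    proof -
      have "ray \<theta> \<rho> powr of_real (- (1 + \<nu> * real n)) * ?w ^ Suc n = ray \<theta> \<rho> powr of_real (- (1 - \<nu>))"
        unfolding ray_powr_power by (simp add: algebra_simps flip: powr_add)
      moreover have "hankel b \<rho> * W = exp (ray \<theta> \<rho>) * (ray \<theta> \<rho> powr of_real (- b) * W) * cis \<theta>" for W b
        by (simp only: hankel_def mult_ac)
      ultimately show ?thesis by (simp only: hankel_def)
    qed
    also have "hankel (1 + \<nu> * real n) \<rho> * ?w ^ Suc n * (fact n / ?w ^ Suc n) = fact n * hankel (1 + \<nu> * real n) \<rho>"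
      by simp
    finally show ?thesis using True by simp
  qed (simp add: f_def)
  have "integrable lborel (\<lambda>y. Im (LBINT \<rho>. f \<rho> y))"
    by (intro integrable_Im lborel_pair.integrable_snd int_f)
  then have i: "integrable lborel (\<lambda>y. indicat_real {0..} y * (y ^ n * mainardi \<nu> y))"
    unfolding inner1 by (auto simp: integrable_mult_right_iff)
  then show "set_integrable lborel {0..} (\<lambda>y. y ^ n * mainardi \<nu> y)"
    by (simp add: set_integrable_def)
  have "pi * (LBINT y:{0..}. y ^ n * mainardi \<nu> y) = (LBINT y. Im (LBINT \<rho>. f \<rho> y))"
    unfolding inner1 by (simp add: set_lebesgue_integral_def)
  also have "\<dots> = Im (LBINT y. LBINT \<rho>. f \<rho> y)"
    by (intro integral_Im lborel_pair.integrable_snd int_f)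
  also have "(LBINT y. LBINT \<rho>. f \<rho> y) = (LBINT \<rho>. LBINT y. f \<rho> y)"
    by (rule lborel_pair.Fubini_integral[OF int_f])
  also have "\<dots> = fact n * (LBINT \<rho>:{0..}. hankel (1 + \<nu> * real n) \<rho>)"
    unfolding inner2 by (fold set_lebesgue_integral_def) (rule set_integral_mult_right)
  also have "Im \<dots> = pi * (fact n * rGamma (1 + \<nu> * real n))"
    by (simp add: hankel_eq_rGamma)
  finally show "(LBINT y:{0..}. y ^ n * mainardi \<nu> y) = fact n * rGamma (1 + \<nu> * real n)"
    by simp
qed

end

lemma
  assumes nu: "0 < \<nu>" "\<nu> < 1"
  shows set_integrable_mainardi: "set_integrable lborel {0..} (\<lambda>y. y ^ n * mainardi \<nu> y)"
    and mainardi_moment: "(LBINT y:{0..}. y ^ n * mainardi \<nu> y) = fact n * rGamma (1 + \<nu> * real n)"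
proof -
  \<comment> \<open>The angle exceeds \<open>pi / 2\<close> because \<open>\<nu> < 1\<close>, and
    \<open>\<nu> * \<theta> = pi - \<theta>\<close> is then below \<open>pi / 2\<close>.\<close>
  interpret mainardi_ray "pi / (1 + \<nu>)" \<nu>
    using nu by unfold_locales (auto simp: field_simps)
  show "set_integrable lborel {0..} (\<lambda>y. y ^ n * mainardi \<nu> y)"
    "(LBINT y:{0..}. y ^ n * mainardi \<nu> y) = fact n * rGamma (1 + \<nu> * real n)"
    by (rule mainardi_moments)+
qed

section \<open>Moments of the mixing variable\<close>

lemma wright_density_eq_mainardi: "wright_density \<nu> w = mainardi \<nu> (w / Gamma (1 + \<nu>)) / Gamma (1 + \<nu>)"
  by (simp add: wright_density_def mainardi_def)

lemma
  assumes nu: "0 < \<nu>" "\<nu> < 1"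
  shows integrable_wright_density_power:
      "integrable lborel (\<lambda>w. indicator {0..} w * wright_density \<nu> w * w ^ n)"
    and integral_wright_density_power:
      "(LBINT w. indicator {0..} w * wright_density \<nu> w * w ^ n) =
        Gamma (1 + \<nu>) ^ n * (fact n / Gamma (1 + \<nu> * real n))"
proof -
  define g where "g = Gamma (1 + \<nu>)"
  have g: "g > 0" using nu by (auto simp: g_def intro!: Gamma_real_pos)
  let ?f = "\<lambda>w. indicator {0..} w * wright_density \<nu> w * w ^ n"
  have eq: "?f (0 + g * y) = (g ^ n / g) * (indicator {0..} y *\<^sub>R (y ^ n * mainardi \<nu> y))" for y
    using g by (simp add: wright_density_eq_mainardi g_def[symmetric] indicator_def zero_le_mult_iff power_mult_distrib)
  have "integrable lborel (\<lambda>y. ?f (0 + g * y))"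
    unfolding eq using set_integrable_mainardi[OF nu, of n]
    by (intro integrable_mult_right) (simp add: set_integrable_def)
  then show "integrable lborel ?f"
    using g by (subst (asm) lborel_integrable_real_affine_iff) auto
  have "(LBINT w. ?f w) = \<bar>g\<bar> *\<^sub>R (LBINT y. ?f (0 + g * y))"
    using g by (intro lborel_integral_real_affine) auto
  also have "(LBINT y. ?f (0 + g * y)) = (g ^ n / g) * (LBINT y:{0..}. y ^ n * mainardi \<nu> y)"
    unfolding eq set_lebesgue_integral_def by (rule integral_mult_right_zero)
  also have "\<bar>g\<bar> *\<^sub>R ((g ^ n / g) * (LBINT y:{0..}. y ^ n * mainardi \<nu> y)) =
      g ^ n * (fact n / Gamma (1 + \<nu> * real n))"
    using g by (simp add: mainardi_moment[OF nu] Gamma_def divide_inverse)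
  finally show "(LBINT w. ?f w) = Gamma (1 + \<nu>) ^ n * (fact n / Gamma (1 + \<nu> * real n))"
    by (simp add: g_def)
qed

lemma
  assumes nu: "0 < \<nu>" "\<nu> < 1" and P: "prob_space P"
    and W: "distributed P lborel W (\<lambda>w. ennreal (indicator {0..} w * wright_density \<nu> w))"
  shows wright_variable_integrable_power: "integrable P (\<lambda>\<omega>. W \<omega> ^ n)"
    and wright_variable_moment:
      "(\<integral>\<omega>. W \<omega> ^ n \<partial>P) = Gamma (1 + \<nu>) ^ n * (fact n / Gamma (1 + \<nu> * real n))"
proof -
  interpret prob_space P by fact
  \<comment> \<open>\<open>ennreal\<close> truncates negative values to 0, so a priori the density of \<open>W\<close> is only the positive part \<open>f'\<close>
    of \<open>f\<close>; both have integral 1, hence they agree almost everywhere.\<close>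
  define f where "f w = indicator {0..} w * wright_density \<nu> w" for w
  define f' where "f' w = max 0 (f w)" for w
  have f_int: "integrable lborel f" and f_one: "(LBINT w. f w) = 1"
    using integrable_wright_density_power[OF nu, of 0] integral_wright_density_power[OF nu, of 0]
    by (simp_all add: f_def[abs_def])
  have f'_meas [measurable]: "f' \<in> borel_measurable borel"
    using f_int unfolding f'_def[abs_def] by (intro borel_measurable_max) auto
  have W': "distributed P lborel W (\<lambda>w. ennreal (f' w))"
  proof -
    have "ennreal (f w) = ennreal (f' w)" for w
      by (cases "f w \<ge> 0") (auto simp: f'_def ennreal_neg)
    then show ?thesis using W by (simp only: f_def)
  qed
  have f'_nonneg: "f' w \<ge> 0" for w by (simp add: f'_def)
  have f'_int: "integrable lborel (\<lambda>w. f' w * h w) \<longleftrightarrow> integrable P (\<lambda>\<omega>. h (W \<omega>))"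
    and f'_val: "(LBINT w. f' w * h w) = (\<integral>\<omega>. h (W \<omega>) \<partial>P)"
    if "h \<in> borel_measurable borel" for h :: "real \<Rightarrow> real"
    using that f'_nonneg by (auto intro!: distributed_integrable[OF W'] distributed_integral[OF W'])
  have f'_one: "integrable lborel f'" "(LBINT w. f' w) = 1"
    using f'_int[of "\<lambda>_. 1"] f'_val[of "\<lambda>_. 1"] by (simp_all add: prob_space)
  have "(LBINT w. f' w - f w) = 0"
    using f'_one f_int f_one by simp
  moreover have "integrable lborel (\<lambda>w. f' w - f w)" using f'_one f_int by simp
  ultimately have "AE w in lborel. f' w - f w = 0"
    by (subst (asm) integral_nonneg_eq_0_iff_AE) (auto simp: f'_def)
  then have ae: "AE w in lborel. f w * w ^ n = f' w * w ^ n" by eventually_elim simp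
  have [measurable]: "f \<in> borel_measurable borel" using f_int by auto
  have "integrable lborel (\<lambda>w. f' w * w ^ n)"
    using integrable_wright_density_power[OF nu, of n]
    by (subst integrable_cong_AE[OF _ _ ae, symmetric]) (auto simp: f_def)
  then show "integrable P (\<lambda>\<omega>. W \<omega> ^ n)" by (subst (asm) f'_int) auto
  have "(\<integral>\<omega>. W \<omega> ^ n \<partial>P) = (LBINT w. f' w * w ^ n)" by (rule f'_val[symmetric]) auto
  also have "\<dots> = (LBINT w. f w * w ^ n)"
    by (rule integral_cong_AE[symmetric, OF _ _ ae]) auto
  finally show "(\<integral>\<omega>. W \<omega> ^ n \<partial>P) = Gamma (1 + \<nu>) ^ n * (fact n / Gamma (1 + \<nu> * real n))"
    using integral_wright_density_power[OF nu, of n] by (simp add: f_def[abs_def])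
qed

section \<open>A Poisson process at an independent random time\<close>

lemma indep_random_varsD:
  assumes "prob_space M" "indep_random_vars M S X T Y" "A \<in> sets S" "B \<in> sets T"
  shows "measure M ((X -` A \<inter> space M) \<inter> (Y -` B \<inter> space M)) =
    measure M (X -` A \<inter> space M) * measure M (Y -` B \<inter> space M)"
  using assms unfolding indep_random_vars_def by (intro prob_space.indep_setD) auto

lemma poisson_process_marginal:
  assumes N: "poisson_process M r N" and r: "r > 0" and t: "t > 0"
  shows "measure M {\<omega> \<in> space M. N t \<omega> = k} = exp (- (r * t)) * (r * t) ^ k / fact k"
proof -
  have meas: "N t \<in> measurable M (count_space UNIV)" "N 0 \<in> measurable M (count_space UNIV)"
    using N t by (auto simp: poisson_process_def)
  have "measure M {\<omega> \<in> space M. N t \<omega> = k} = measure (distr M (count_space UNIV) (\<lambda>\<omega>. N t \<omega> - N 0 \<omega>)) {k}"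
    using N meas(1) by (subst measure_distr)
      (auto simp: poisson_process_def intro!: arg_cong[where f = "measure M"] cong: measurable_cong)
  also have "\<dots> = pmf (poisson_pmf (r * t)) k"
    using N t by (simp add: poisson_process_def pmf.rep_eq)
  also have "\<dots> = exp (- (r * t)) * (r * t) ^ k / fact k"
    using r t by (simp add: mult.commute)
  finally show ?thesis .
qed

lemma poisson_weight_le_1:
  fixes x :: real
  assumes "x > 0"
  shows "exp (- x) * x ^ k / fact k \<le> 1"
  using pmf_le_1[of "poisson_pmf x" k] pmf_poisson[OF assms, of k] by (simp add: mult.commute)

text \<open>The random time is approximated from the right by dyadic times, which take countably many values;
  right continuity of the paths then passes to the limit.\<close>

lemma poisson_random_time:
  fixes N :: "real \<Rightarrow> 'a \<Rightarrow> nat"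
  assumes N: "poisson_process M r N" and r: "r > 0"
    and T [measurable]: "T \<in> borel_measurable M" and T_nonneg: "\<And>\<omega>. \<omega> \<in> space M \<Longrightarrow> 0 \<le> T \<omega>"
    and indep: "\<And>s k B. s \<ge> 0 \<Longrightarrow> B \<in> sets borel \<Longrightarrow>
      measure M ((T -` B \<inter> space M) \<inter> {\<omega> \<in> space M. N s \<omega> = k}) =
      measure M (T -` B \<inter> space M) * measure M {\<omega> \<in> space M. N s \<omega> = k}"
  shows "measure M {\<omega> \<in> space M. N (T \<omega>) \<omega> = k} =
      (\<integral>\<omega>. exp (- (r * T \<omega>)) * (r * T \<omega>) ^ k / fact k \<partial>M)"
proof -
  interpret prob_space M using N by (simp add: poisson_process_def)
  have N_meas [measurable]: "N s \<in> measurable M (count_space UNIV)" if "s \<ge> 0" for s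
    using N that by (auto simp: poisson_process_def)
  define J where "J m \<omega> = nat \<lfloor>2 ^ m * T \<omega>\<rfloor>" for m :: nat and \<omega>
  \<comment> \<open>Adding 1 to the floor makes the approximating time strictly larger than
    \<open>T\<close>, even at dyadic values, so the limit is taken from the right; it also makes
    every \<open>\<tau> m j\<close> positive.\<close>
  define \<tau> where "\<tau> m j = (real j + 1) / 2 ^ m" for m j :: nat
  define g where "g x = exp (- (r * x)) * (r * x) ^ k / fact k" for x
  have J_meas [measurable]: "J m \<in> measurable M (count_space UNIV)" for m
    unfolding J_def by measurable
  have \<tau>_pos: "\<tau> m j > 0" for m j by (simp add: \<tau>_def)
  have T_less: "T \<omega> < \<tau> m (J m \<omega>)" and \<tau>_le: "\<tau> m (J m \<omega>) \<le> T \<omega> + 1 / 2 ^ m"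
    if "\<omega> \<in> space M" for m \<omega>
  proof -
    have "real (J m \<omega>) = of_int \<lfloor>2 ^ m * T \<omega>\<rfloor>"
      using T_nonneg[OF that] by (simp add: J_def)
    then have "2 ^ m * T \<omega> < real (J m \<omega>) + 1" "real (J m \<omega>) \<le> 2 ^ m * T \<omega>" by linarith+
    then show "T \<omega> < \<tau> m (J m \<omega>)" "\<tau> m (J m \<omega>) \<le> T \<omega> + 1 / 2 ^ m"
      by (simp_all add: \<tau>_def field_simps)
  qed
  have lim: "(\<lambda>m. \<tau> m (J m \<omega>)) \<longlonglongrightarrow> T \<omega>" if "\<omega> \<in> space M" for \<omega>
  proof (rule tendsto_sandwich)
    show "\<forall>\<^sub>F m in sequentially. T \<omega> \<le> \<tau> m (J m \<omega>)"
      using T_less[OF that] by (simp add: less_imp_le)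
    show "\<forall>\<^sub>F m in sequentially. \<tau> m (J m \<omega>) \<le> T \<omega> + 1 / 2 ^ m"
      using \<tau>_le[OF that] by simp
    show "(\<lambda>m. T \<omega> + 1 / 2 ^ m) \<longlonglongrightarrow> T \<omega>" by real_asymp
  qed simp
  define A where "A m j = J m -` {j} \<inter> space M" for m j
  have A_eq: "A m j = T -` {x. nat \<lfloor>2 ^ m * x\<rfloor> = j} \<inter> space M" for m j
    by (auto simp: A_def J_def)
  have A_sets [measurable]: "A m j \<in> sets M" for m j
    unfolding A_def by measurable
  have B_sets: "{\<omega> \<in> space M. N s \<omega> = i} \<in> sets M" if "s \<ge> 0" for s i
    using measurable_sets[OF N_meas[OF that], of "{i}"]
    by (simp add: vimage_def Int_def conj_commute)
  have g_nonneg: "g x \<ge> 0" if "x \<ge> 0" for x using that r by (simp add: g_def)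
  define S where "S m = {\<omega> \<in> space M. N (\<tau> m (J m \<omega>)) \<omega> = k}" for m
  have S_eq: "S m = (\<Union>j. A m j \<inter> {\<omega> \<in> space M. N (\<tau> m j) \<omega> = k})" for m
    by (auto simp: S_def A_def)
  have AB_sets: "A m j \<inter> {\<omega> \<in> space M. N (\<tau> m j) \<omega> = k} \<in> sets M" for m j
    by (intro sets.Int A_sets B_sets less_imp_le[OF \<tau>_pos])
  then have S_sets [measurable]: "S m \<in> sets M" for m
    unfolding S_eq by (intro sets.countable_UN) (rule image_subsetI)
  \<comment> \<open>On \<open>A m j\<close> the random time is the constant
    \<open>\<tau> m j\<close>, so independence factors each piece into a Poisson weight and a
    probability. Summing over \<open>j\<close> reassembles an expectation.\<close>
  have prob_S: "emeasure M (S m) = (\<integral>\<^sup>+\<omega>. ennreal (g (\<tau> m (J m \<omega>))) \<partial>M)" for m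
  proof -
    have "emeasure M (S m) = (\<Sum>j. emeasure M (A m j \<inter> {\<omega> \<in> space M. N (\<tau> m j) \<omega> = k}))"
      unfolding S_eq
    proof (rule suminf_emeasure[symmetric])
      show "range (\<lambda>j. A m j \<inter> {\<omega> \<in> space M. N (\<tau> m j) \<omega> = k}) \<subseteq> sets M"
        using AB_sets by (rule image_subsetI)
    qed (auto simp: disjoint_family_on_def A_def)
    also have "\<dots> = (\<Sum>j. \<integral>\<^sup>+\<omega>. ennreal (g (\<tau> m j)) * indicator (A m j) \<omega> \<partial>M)"
    proof (rule suminf_cong)
      fix j
      have "measure M (A m j \<inter> {\<omega> \<in> space M. N (\<tau> m j) \<omega> = k}) = measure M (A m j) * g (\<tau> m j)"
        unfolding A_eq g_def poisson_process_marginal[OF N r \<tau>_pos, symmetric]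
        using \<tau>_pos[of m j] by (intro indep) auto
      then have "emeasure M (A m j \<inter> {\<omega> \<in> space M. N (\<tau> m j) \<omega> = k}) = ennreal (g (\<tau> m j)) * emeasure M (A m j)"
        using g_nonneg[OF less_imp_le[OF \<tau>_pos]]
        by (simp add: emeasure_eq_measure ennreal_mult mult.commute)
      then show "emeasure M (A m j \<inter> {\<omega> \<in> space M. N (\<tau> m j) \<omega> = k}) =
          (\<integral>\<^sup>+\<omega>. ennreal (g (\<tau> m j)) * indicator (A m j) \<omega> \<partial>M)"
        by (simp add: nn_integral_cmult_indicator)
    qed
    also have "\<dots> = (\<integral>\<^sup>+\<omega>. (\<Sum>j. ennreal (g (\<tau> m j)) * indicator (A m j) \<omega>) \<partial>M)"
      by (rule nn_integral_suminf[symmetric]) measurable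
    also have "\<dots> = (\<integral>\<^sup>+\<omega>. ennreal (g (\<tau> m (J m \<omega>))) \<partial>M)"
    proof (rule nn_integral_cong)
      fix \<omega> assume \<omega>: "\<omega> \<in> space M"
      have "(\<Sum>j. ennreal (g (\<tau> m j)) * indicator (A m j) \<omega>) =
          (\<Sum>j\<in>{J m \<omega>}. ennreal (g (\<tau> m j)) * indicator (A m j) \<omega>)"
        by (rule suminf_finite) (auto simp: A_def indicator_def)
      then show "(\<Sum>j. ennreal (g (\<tau> m j)) * indicator (A m j) \<omega>) = ennreal (g (\<tau> m (J m \<omega>)))"
        using \<omega> by (simp add: A_def)
    qed
    finally show ?thesis .
  qed
  have g_le: "g x \<le> 1" if "x > 0" for x
    unfolding g_def using that r by (intro poisson_weight_le_1) auto
  have \<tau>J_meas [measurable]: "(\<lambda>\<omega>. \<tau> m (J m \<omega>)) \<in> borel_measurable M" for m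
    unfolding \<tau>_def by measurable
  have g_meas [measurable]: "g \<in> borel_measurable borel" unfolding g_def by measurable
  have measure_S: "measure M (S m) = (\<integral>\<omega>. g (\<tau> m (J m \<omega>)) \<partial>M)" for m
    using prob_S[of m] \<tau>_pos g_nonneg
    by (subst integral_eq_nn_integral) (auto simp: measure_def less_imp_le)
  define S' where "S' = {\<omega> \<in> space M. N (T \<omega>) \<omega> = k}"
  have ind_lim: "(\<lambda>m. indicat_real (S m) \<omega>) \<longlonglongrightarrow> indicat_real S' \<omega>" if \<omega>: "\<omega> \<in> space M" for \<omega>
  proof -
    have "continuous (at_right (T \<omega>)) (\<lambda>s. N s \<omega>)"
      using N \<omega> T_nonneg[OF \<omega>] by (simp add: poisson_process_def increasing_rcont_paths_def)
    then have "((\<lambda>s. N s \<omega>) \<longlongrightarrow> N (T \<omega>) \<omega>) (at_right (T \<omega>))"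
      by (simp add: continuous_within)
    moreover have "filterlim (\<lambda>m. \<tau> m (J m \<omega>)) (at_right (T \<omega>)) sequentially"
      using lim[OF \<omega>] T_less[OF \<omega>] by (intro tendsto_imp_filterlim_at_right) auto
    ultimately have "(\<lambda>m. N (\<tau> m (J m \<omega>)) \<omega>) \<longlonglongrightarrow> N (T \<omega>) \<omega>"
      by (rule filterlim_compose)
    then have "\<forall>\<^sub>F m in sequentially. N (\<tau> m (J m \<omega>)) \<omega> \<in> {N (T \<omega>) \<omega>}"
      by (rule topological_tendstoD) (rule discrete_topology_class.open_discrete, simp)
    then have "\<forall>\<^sub>F m in sequentially. indicat_real (S m) \<omega> = indicat_real S' \<omega>"
      by eventually_elim (auto simp: S_def S'_def indicator_def)
    then show ?thesis by (rule tendsto_eventually)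
  qed
  \<comment> \<open>The event at the random time is measurable because its indicator is a pointwise
    limit of the indicators of \<open>S m\<close>.\<close>
  have ind_meas: "indicat_real S' \<in> borel_measurable M"
    by (rule borel_measurable_LIMSEQ_real[OF ind_lim]) measurable
  then have S'_sets: "{\<omega> \<in> space M. N (T \<omega>) \<omega> = k} \<in> sets M"
  proof -
    have "S' \<inter> space M \<in> sets M"
      using ind_meas by (simp only: borel_measurable_indicator_iff)
    moreover have "S' \<inter> space M = S'" by (auto simp: S'_def)
    ultimately show ?thesis by (simp add: S'_def)
  qed
  have "(\<lambda>m. \<integral>\<omega>. indicat_real (S m) \<omega> \<partial>M) \<longlonglongrightarrow> (\<integral>\<omega>. indicat_real S' \<omega> \<partial>M)"
  proof (rule integral_dominated_convergence[where w = "\<lambda>_. 1"])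
    show "AE \<omega> in M. (\<lambda>m. indicat_real (S m) \<omega>) \<longlonglongrightarrow> indicat_real S' \<omega>"
      by (intro AE_I2 ind_lim)
    show "AE \<omega> in M. norm (indicat_real (S m) \<omega>) \<le> 1" for m
      by (simp add: indicator_def)
  qed (use ind_meas in simp_all)
  then have "(\<lambda>m. measure M (S m)) \<longlonglongrightarrow> measure M S'"
    using S'_sets by (simp add: S'_def)
  moreover have "(\<lambda>m. measure M (S m)) \<longlonglongrightarrow> (\<integral>\<omega>. g (T \<omega>) \<partial>M)"
    unfolding measure_S
  proof (rule integral_dominated_convergence[where w = "\<lambda>_. 1"])
    show "AE \<omega> in M. (\<lambda>m. g (\<tau> m (J m \<omega>))) \<longlonglongrightarrow> g (T \<omega>)"
      unfolding g_def by (intro AE_I2 tendsto_intros lim) auto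
    show "AE \<omega> in M. norm (g (\<tau> m (J m \<omega>))) \<le> 1" for m
      using g_le[OF \<tau>_pos] g_nonneg[OF less_imp_le[OF \<tau>_pos]] by (intro AE_I2) simp
  qed (auto simp: g_def)
  ultimately have "measure M S' = (\<integral>\<omega>. g (T \<omega>) \<partial>M)" by (rule LIMSEQ_unique)
  then show ?thesis
    by (simp add: S'_def g_def)
qed

text \<open>Carries independence of the whole path over to events at a single time.\<close>

lemma path_var_event:
  assumes "s \<ge> 0"
  shows "\<exists>B\<in>sets (PiM {0..} (\<lambda>_. count_space UNIV)).
    path_var N -` B \<inter> space M = {\<omega> \<in> space M. N s \<omega> = k}"
proof
  let ?P = "PiM {0..} (\<lambda>_. count_space UNIV)"
  let ?B = "(\<lambda>f. f s) -` {k} \<inter> space ?P"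
  show "?B \<in> sets ?P" using assms by (intro measurable_sets[OF measurable_component_singleton]) auto
  show "path_var N -` ?B \<inter> space M = {\<omega> \<in> space M. N s \<omega> = k}"
    using assms by (auto simp: path_var_def space_PiM)
qed

lemma poisson_random_time_indep:
  assumes M: "prob_space M" and N: "poisson_process M r N" and r: "r > 0"
    and indep: "indep_random_vars M S Y (PiM {0..} (\<lambda>_. count_space UNIV)) (path_var N) \<or>
      indep_random_vars M (PiM {0..} (\<lambda>_. count_space UNIV)) (path_var N) S Y"
    and h: "h \<in> borel_measurable S" and T: "\<And>\<omega>. \<omega> \<in> space M \<Longrightarrow> T \<omega> = h (Y \<omega>)"
    and T_nonneg: "\<And>\<omega>. \<omega> \<in> space M \<Longrightarrow> 0 \<le> T \<omega>"
  shows "measure M {\<omega> \<in> space M. N (T \<omega>) \<omega> = k} =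
      (\<integral>\<omega>. exp (- (r * T \<omega>)) * (r * T \<omega>) ^ k / fact k \<partial>M)"
proof -
  have Y: "Y \<in> measurable M S" using indep by (auto simp: indep_random_vars_def)
  then have "(\<lambda>\<omega>. h (Y \<omega>)) \<in> borel_measurable M" using h by measurable
  then have T_meas: "T \<in> borel_measurable M"
    by (subst measurable_cong[OF T])
  show "measure M {\<omega> \<in> space M. N (T \<omega>) \<omega> = k} =
      (\<integral>\<omega>. exp (- (r * T \<omega>)) * (r * T \<omega>) ^ k / fact k \<partial>M)"
  proof (rule poisson_random_time[OF N r T_meas T_nonneg])
    fix s :: real and k :: nat and B :: "real set"
    assume s: "s \<ge> 0" and B: "B \<in> sets borel"
    obtain C where C: "C \<in> sets (PiM {0..} (\<lambda>_. count_space UNIV))"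
      "path_var N -` C \<inter> space M = {\<omega> \<in> space M. N s \<omega> = k}"
      using path_var_event[OF s, of N M k] by blast
    have hB: "h -` B \<inter> space S \<in> sets S" using h B by (rule measurable_sets)
    have eq: "T -` B \<inter> space M = Y -` (h -` B \<inter> space S) \<inter> space M"
      using T measurable_space[OF Y] by auto
    show "measure M ((T -` B \<inter> space M) \<inter> {\<omega> \<in> space M. N s \<omega> = k}) =
      measure M (T -` B \<inter> space M) * measure M {\<omega> \<in> space M. N s \<omega> = k}"
      unfolding eq C(2)[symmetric]
      using indep indep_random_varsD[OF M _ hB C(1)] indep_random_varsD[OF M _ C(1) hB]
      by (elim disjE) (simp_all only: Int_commute mult.commute)
  qed
qed

section \<open>The inverse of a stable subordinator\<close>

lemma nn_integral_Gamma_scaled: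
  fixes a u :: real
  assumes "a > 0" "u > 0"
  shows "(\<integral>\<^sup>+y. ennreal (indicator {0..} y * (y powr (a - 1) * exp (- u * y))) \<partial>lborel) =
    ennreal (Gamma a * u powr (- a))"
proof -
  let ?I = "\<integral>\<^sup>+y. ennreal (indicator {0..} y * (y powr (a - 1) * exp (- u * y))) \<partial>lborel"
  have "ennreal (Gamma a) = (\<integral>\<^sup>+t. ennreal (indicator {0..} t * t powr (a - 1) / exp t) \<partial>lborel)"
    using assms by (intro Gamma_conv_nn_integral_real)
  also have "\<dots> = ennreal \<bar>u\<bar> * (\<integral>\<^sup>+y. ennreal (indicator {0..} (0 + u * y) * (0 + u * y) powr (a - 1) / exp (0 + u * y)) \<partial>lborel)"
    using assms by (intro nn_integral_real_affine) auto
  also have "(\<integral>\<^sup>+y. ennreal (indicator {0..} (0 + u * y) * (0 + u * y) powr (a - 1) / exp (0 + u * y)) \<partial>lborel) =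
      (\<integral>\<^sup>+y. ennreal (u powr (a - 1)) * ennreal (indicator {0..} y * (y powr (a - 1) * exp (- u * y))) \<partial>lborel)"
    using assms
    by (intro nn_integral_cong)
       (auto simp: indicator_def zero_le_mult_iff powr_mult exp_minus divide_inverse mult.assoc simp flip: ennreal_mult)
  also have "\<dots> = ennreal (u powr (a - 1)) * ?I" by (rule nn_integral_cmult) measurable
  finally have "ennreal (Gamma a) = ennreal (u * u powr (a - 1)) * ?I"
    using assms by (simp add: ennreal_mult mult.assoc)
  also have "u * u powr (a - 1) = u powr a" using assms by (simp add: powr_diff)
  finally have "ennreal (u powr (- a)) * ennreal (Gamma a) = ennreal (u powr (- a)) * (ennreal (u powr a) * ?I)"
    by simp
  also have "\<dots> = ennreal (u powr (- a) * u powr a) * ?I" by (simp add: ennreal_mult mult.assoc)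
  also have "u powr (- a) * u powr a = 1" using assms by (simp flip: powr_add)
  finally have "?I = ennreal (u powr (- a)) * ennreal (Gamma a)" by (simp only: ennreal_1 mult_1)
  also have "\<dots> = ennreal (u powr (- a) * Gamma a)" by (rule ennreal_mult'[symmetric]) simp
  finally show ?thesis by (simp only: mult.commute)
qed

text \<open>Write \<open>1 - exp (- u * x)\<close> as the integral of
  \<open>u * exp (- u * y)\<close> over \<open>0 \<le> y \<le> x\<close> and exchange the integrals.
  The Levy measure of \<open>[y, \<infinity>)\<close> is
  \<open>y powr (- \<nu>) / Gamma (1 - \<nu>)\<close>, and the remaining Gamma integral cancels the
  normalising constant.\<close>

lemma stable_laplace_exponent:
  assumes nu: "0 < \<nu>" "\<nu> < 1" and "u \<ge> 0"
  shows "(\<integral>x. 1 - exp (- u * x) \<partial>stable_levy_measure \<nu>) = u powr \<nu>"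
proof (cases "u = 0")
  case False
  then have u: "u > 0" using assms by simp
  define c where "c = \<nu> / Gamma (1 - \<nu>)"
  have G: "Gamma (1 - \<nu>) > 0" using nu by (intro Gamma_real_pos) auto
  then have c: "c > 0" using nu by (simp add: c_def)
  define k :: "real \<Rightarrow> real" where "k = (\<lambda>x. indicator {0<..} x * (c * x powr (- 1 - \<nu>)))"
  have k_meas [measurable]: "k \<in> borel_measurable borel" unfolding k_def by measurable
  have k_nonneg: "k x \<ge> 0" for x using c by (simp add: k_def)
  have "(\<integral>\<^sup>+x. ennreal (k x * (1 - exp (- u * x))) \<partial>lborel) =
      (\<integral>\<^sup>+x. \<integral>\<^sup>+y. ennreal (k x) * (ennreal (u * exp (- u * y)) * indicator {0..x} y) \<partial>lborel \<partial>lborel)"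
  proof (rule nn_integral_cong)
    fix x :: real
    show "ennreal (k x * (1 - exp (- u * x))) =
       (\<integral>\<^sup>+y. ennreal (k x) * (ennreal (u * exp (- u * y)) * indicator {0..x} y) \<partial>lborel)"
    proof (cases "x > 0")
      case True
      have "(\<integral>\<^sup>+y. ennreal (u * exp (- u * y)) * indicator {0..x} y \<partial>lborel) = - exp (- u * x) - (- exp (- u * 0))"
        using True u by (intro nn_integral_FTC_Icc) (auto intro!: derivative_eq_intros)
      then show ?thesis using k_nonneg[of x] True u
        by (subst nn_integral_cmult) (auto simp: ennreal_mult')
    qed (auto simp: k_def)
  qed
  also have "\<dots> = (\<integral>\<^sup>+y. \<integral>\<^sup>+x. ennreal (k x) * (ennreal (u * exp (- u * y)) * indicator {0..x} y) \<partial>lborel \<partial>lborel)"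
  proof (rule lborel_pair.Fubini'[symmetric])
    have "(\<lambda>(x, y). ennreal (k x) * (ennreal (u * exp (- u * y)) * indicator {0..x} y)) =
        (\<lambda>(x, y). ennreal (k x) * (ennreal (u * exp (- u * y)) * (indicator {0..} y * (if y \<le> x then 1 else 0))))"
      by (auto simp: fun_eq_iff indicator_def)
    also have "\<dots> \<in> borel_measurable (lborel \<Otimes>\<^sub>M lborel)" by measurable
    finally show "(\<lambda>(x, y). ennreal (k x) * (ennreal (u * exp (- u * y)) * indicator {0..x} y))
        \<in> borel_measurable (lborel \<Otimes>\<^sub>M lborel)" .
  qed
  also have "\<dots> = (\<integral>\<^sup>+y. ennreal (u * c / \<nu>) * ennreal (indicator {0..} y * (y powr ((1 - \<nu>) - 1) * exp (- u * y))) \<partial>lborel)"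
  proof (rule nn_integral_cong_AE)
    \<comment> \<open>At \<open>y = 0\<close> the tail of the Levy measure is infinite whereas
      \<open>0 powr\<close> is 0, so the two sides agree only almost everywhere.\<close>
    have "AE y in lborel. y \<noteq> (0::real)" by (rule AE_lborel_singleton)
    then show "AE y in lborel. (\<integral>\<^sup>+x. ennreal (k x) * (ennreal (u * exp (- u * y)) * indicator {0..x} y) \<partial>lborel) =
        ennreal (u * c / \<nu>) * ennreal (indicator {0..} y * (y powr ((1 - \<nu>) - 1) * exp (- u * y)))"
    proof eventually_elim
      case (elim y)
      show ?case
      proof (cases "y > 0")
        case True
        have "(\<integral>\<^sup>+x. ennreal (k x) * (ennreal (u * exp (- u * y)) * indicator {0..x} y) \<partial>lborel) =
          (\<integral>\<^sup>+x. ennreal (u * exp (- u * y)) * (ennreal (c * x powr (- 1 - \<nu>)) * indicator {y..} x) \<partial>lborel)"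
          using True by (intro nn_integral_cong) (auto simp: k_def indicator_def mult.commute)
        also have "\<dots> = ennreal (u * exp (- u * y)) * (\<integral>\<^sup>+x. ennreal (c * x powr (- 1 - \<nu>)) * indicator {y..} x \<partial>lborel)"
          by (rule nn_integral_cmult) measurable
        also have "(\<integral>\<^sup>+x. ennreal (c * x powr (- 1 - \<nu>)) * indicator {y..} x \<partial>lborel) =
            ennreal (0 - (- (c / \<nu>) * y powr (- \<nu>)))"
        proof (rule nn_integral_FTC_atLeast)
          show "((\<lambda>x. - (c / \<nu>) * x powr (- \<nu>)) has_real_derivative c * x powr (- 1 - \<nu>)) (at x)" if "y \<le> x" for x
          proof -
            have "((\<lambda>x. - (c / \<nu>) * x powr (- \<nu>)) has_real_derivative - (c / \<nu>) * (- \<nu> * x powr (- \<nu> - 1))) (at x)"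
              using True that by (intro DERIV_cmult has_real_derivative_powr) auto
            moreover have "- (c / \<nu>) * (- \<nu> * x powr (- \<nu> - 1)) = c * x powr (- 1 - \<nu>)"
              using nu by (simp add: minus_diff_commute)
            ultimately show ?thesis by simp
          qed
          show "((\<lambda>x. - (c / \<nu>) * x powr (- \<nu>)) \<longlongrightarrow> 0) at_top" using nu by real_asymp
        qed (use c in auto)
        finally show ?thesis using True u c nu
          by (simp add: mult_ac flip: ennreal_mult)
      qed (use elim in \<open>auto simp: indicator_def\<close>)
    qed
  qed
  also have "\<dots> = ennreal (u * c / \<nu>) * ennreal (Gamma (1 - \<nu>) * u powr (- (1 - \<nu>)))"
    using nn_integral_Gamma_scaled[of "1 - \<nu>" u] nu u by (subst nn_integral_cmult) auto
  also have "\<dots> = ennreal (u powr \<nu>)"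
  proof -
    have "u * c / \<nu> * (Gamma (1 - \<nu>) * u powr (- (1 - \<nu>))) = u powr \<nu>"
      using nu u less_imp_neq[OF G] by (simp add: c_def powr_diff)
    then show ?thesis using nu u c G by (subst ennreal_mult[symmetric]) auto
  qed
  finally have *: "(\<integral>\<^sup>+x. ennreal (k x * (1 - exp (- u * x))) \<partial>lborel) = ennreal (u powr \<nu>)" .
  have "(\<integral>x. 1 - exp (- u * x) \<partial>stable_levy_measure \<nu>) = (\<integral>x. k x *\<^sub>R (1 - exp (- u * x)) \<partial>lborel)"
    unfolding stable_levy_measure_def c_def[symmetric] k_def[symmetric]
    using k_nonneg k_def c_def by (subst integral_density[symmetric]) (auto simp: mult.assoc k_def)
  also have "\<dots> = u powr \<nu>"
  proof (subst integral_eq_nn_integral)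
    show "AE x in lborel. 0 \<le> k x *\<^sub>R (1 - exp (- u * x))"
      using c u by (intro AE_I2) (auto simp: k_def indicator_def)
  qed (use * in auto)
  finally show ?thesis .
qed simp

text \<open>The values of the Laplace transform of \<open>X\<close> at the naturals are the moments of the bounded variable
  \<open>exp (- X)\<close>, and these determine its characteristic function.\<close>

lemma char_exp_neg_sums:
  assumes "prob_space M" and X [measurable]: "X \<in> borel_measurable M"
    and X_nonneg: "\<And>\<omega>. \<omega> \<in> space M \<Longrightarrow> 0 \<le> X \<omega>"
  shows "(\<lambda>n. (\<i> * of_real t) ^ n / fact n * of_real (\<integral>\<omega>. exp (- real n * X \<omega>) \<partial>M)) sums
    char (distr M borel (\<lambda>\<omega>. exp (- X \<omega>))) t"
proof -
  interpret prob_space M by fact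
  define z where "z \<omega> = exp (- X \<omega>)" for \<omega>
  have z_meas [measurable]: "z \<in> borel_measurable M" unfolding z_def by measurable
  have z: "0 < z \<omega>" "z \<omega> \<le> 1" if "\<omega> \<in> space M" for \<omega> using X_nonneg[OF that] by (auto simp: z_def)
  have z_pow: "z \<omega> ^ n = exp (- real n * X \<omega>)" for n \<omega>
    by (simp add: z_def flip: exp_of_nat_mult)
  let ?t = "\<lambda>n \<omega>. (\<i> * of_real t) ^ n / fact n * of_real (z \<omega> ^ n)"
  have norm_t: "norm (?t n \<omega>) \<le> \<bar>t\<bar> ^ n / fact n" if "\<omega> \<in> space M" for n \<omega>
    using z[OF that] power_le_one[of "z \<omega>" n]
    by (auto simp: norm_mult norm_divide norm_power power_mult_distrib intro!: divide_right_mono mult_left_le)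
  have "integrable M (?t n)" for n
    by (rule integrable_const_bound[of _ "\<bar>t\<bar> ^ n / fact n"])
       (use norm_t in \<open>auto intro!: AE_I2\<close>)
  note int = this
  have "(\<lambda>n. \<integral>\<omega>. (\<Sum>i<n. ?t i \<omega>) \<partial>M) \<longlonglongrightarrow> (\<integral>\<omega>. iexp (t * z \<omega>) \<partial>M)"
  proof (rule integral_dominated_convergence[where w = "\<lambda>_. exp \<bar>t\<bar>"])
    show "AE \<omega> in M. (\<lambda>n. \<Sum>i<n. ?t i \<omega>) \<longlonglongrightarrow> iexp (t * z \<omega>)"
    proof (intro AE_I2)
      fix \<omega>
      have "(\<lambda>n. (\<i> * of_real (t * z \<omega>)) ^ n /\<^sub>R fact n) sums iexp (t * z \<omega>)"
        by (rule exp_converges)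
      moreover have "(\<i> * of_real (t * z \<omega>)) ^ n /\<^sub>R fact n = ?t n \<omega>" for n
        by (simp add: power_mult_distrib scaleR_conv_of_real field_simps)
      ultimately show "(\<lambda>n. \<Sum>i<n. ?t i \<omega>) \<longlonglongrightarrow> iexp (t * z \<omega>)" by (simp add: sums_def)
    qed
    show "AE \<omega> in M. norm (\<Sum>i<n. ?t i \<omega>) \<le> exp \<bar>t\<bar>" for n
    proof (intro AE_I2)
      fix \<omega> assume \<omega>: "\<omega> \<in> space M"
      have s: "(\<lambda>r. \<bar>t\<bar> ^ r / fact r) sums exp \<bar>t\<bar>"
        using exp_converges[of "\<bar>t\<bar>"] by (simp add: divide_inverse mult.commute)
      have "norm (\<Sum>i<n. ?t i \<omega>) \<le> (\<Sum>i<n. \<bar>t\<bar> ^ i / fact i)"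
        by (rule order.trans[OF norm_sum sum_mono[OF norm_t[OF \<omega>]]])
      also have "\<dots> \<le> (\<Sum>i. \<bar>t\<bar> ^ i / fact i)"
        using s by (intro sum_le_suminf) (auto simp: sums_iff)
      finally show "norm (\<Sum>i<n. ?t i \<omega>) \<le> exp \<bar>t\<bar>" using s by (simp add: sums_iff)
    qed
  qed auto
  moreover have "(\<integral>\<omega>. (\<Sum>i<n. ?t i \<omega>) \<partial>M) =
      (\<Sum>i<n. (\<i> * of_real t) ^ i / fact i * of_real (\<integral>\<omega>. exp (- real i * X \<omega>) \<partial>M))" for n
  proof -
    have "(\<integral>\<omega>. (\<Sum>i<n. ?t i \<omega>) \<partial>M) = (\<Sum>i<n. \<integral>\<omega>. ?t i \<omega> \<partial>M)"
      by (rule Bochner_Integration.integral_sum[OF int])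
    also have "\<dots> = (\<Sum>i<n. (\<i> * of_real t) ^ i / fact i * of_real (\<integral>\<omega>. z \<omega> ^ i \<partial>M))"
      by (simp only: integral_mult_right_zero integral_complex_of_real)
    finally show ?thesis by (simp only: z_pow)
  qed
  moreover have "char (distr M borel (\<lambda>\<omega>. exp (- X \<omega>))) t = (\<integral>\<omega>. iexp (t * z \<omega>) \<partial>M)"
    unfolding char_def z_def by (subst integral_distr) auto
  ultimately show ?thesis by (simp add: sums_def)
qed

text \<open>Levy's uniqueness theorem is applied to the bounded variables \<open>exp (- X)\<close>
  and \<open>exp (- Y)\<close>; the Borel map \<open>- ln\<close> then recovers the laws of
  \<open>X\<close> and \<open>Y\<close>.\<close>

lemma laplace_transform_determines_distr:
  assumes M: "prob_space M" and X [measurable]: "X \<in> borel_measurable M"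
    and X_nonneg: "\<And>\<omega>. \<omega> \<in> space M \<Longrightarrow> 0 \<le> X \<omega>"
    and N: "prob_space N" and Y [measurable]: "Y \<in> borel_measurable N"
    and Y_nonneg: "\<And>\<omega>. \<omega> \<in> space N \<Longrightarrow> 0 \<le> Y \<omega>"
    and eq: "\<And>n::nat. (\<integral>\<omega>. exp (- real n * X \<omega>) \<partial>M) = (\<integral>\<omega>. exp (- real n * Y \<omega>) \<partial>N)"
  shows "distr M borel X = distr N borel Y"
proof -
  have "distr M borel (\<lambda>\<omega>. exp (- X \<omega>)) = distr N borel (\<lambda>\<omega>. exp (- Y \<omega>))"
  proof (rule Levy_uniqueness)
    show "real_distribution (distr M borel (\<lambda>\<omega>. exp (- X \<omega>)))"
      by (intro prob_space.real_distribution_distr M) auto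
    show "real_distribution (distr N borel (\<lambda>\<omega>. exp (- Y \<omega>)))"
      by (intro prob_space.real_distribution_distr N) auto
    show "char (distr M borel (\<lambda>\<omega>. exp (- X \<omega>))) = char (distr N borel (\<lambda>\<omega>. exp (- Y \<omega>)))"
      using char_exp_neg_sums[OF M X X_nonneg, unfolded eq] char_exp_neg_sums[OF N Y Y_nonneg]
      by (intro ext sums_unique2)
  qed
  then have "distr (distr M borel (\<lambda>\<omega>. exp (- X \<omega>))) borel (\<lambda>x. - ln x) =
      distr (distr N borel (\<lambda>\<omega>. exp (- Y \<omega>))) borel (\<lambda>x. - ln x)"
    by simp
  then show ?thesis by (simp add: distr_distr o_def)
qed


text \<open>The substitution \<open>v = u powr \<nu>\<close> reduces this to Euler's integral. It is
  the Mellin transform of the Laplace transform of \<open>D 1\<close>.\<close>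

lemma has_integral_powr_exp_powr:
  fixes \<nu> a :: real
  assumes "0 < \<nu>" "0 < a"
  shows "((\<lambda>u. u powr (\<nu> * a - 1) * exp (- (u powr \<nu>))) has_integral Gamma a / \<nu>) {0<..}"
proof -
  define f where "f = (\<lambda>v::real. v powr (a - 1) / exp v / \<nu>)"
  have img: "(\<lambda>u::real. u powr \<nu>) ` {0<..} = {0<..}"
  proof (intro subset_antisym subsetI)
    fix v :: real assume "v \<in> {0<..}"
    then show "v \<in> (\<lambda>u::real. u powr \<nu>) ` {0<..}"
      using assms by (intro image_eqI[of _ _ "v powr (1 / \<nu>)"]) (auto simp: powr_powr)
  qed auto
  have Gamma_Ioi: "((\<lambda>v. v powr (a - 1) / exp v) has_integral Gamma a) {0<..}"
    by (subst has_integral_spike_set_eq[where T = "{0..}"])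
       (auto intro!: negligible_subset[OF negligible_sing[of 0]] Gamma_integral_real[OF assms(2)])
  have "(\<lambda>v. v powr (a - 1) / exp v) absolutely_integrable_on {0<..}"
  proof (rule nonnegative_absolutely_integrable_1)
    show "(\<lambda>v. v powr (a - 1) / exp v) integrable_on {0<..}"
      using Gamma_Ioi by (rule has_integral_integrable)
  qed auto
  then have 1: "f absolutely_integrable_on {0<..}"
    unfolding f_def by (rule set_integrable_divide)
  have 2: "integral {0<..} f = Gamma a / \<nu>"
    using Gamma_Ioi unfolding f_def by (intro integral_unique has_integral_divide)
  have "(\<lambda>u. \<bar>\<nu> * u powr (\<nu> - 1)\<bar> * f (u powr \<nu>)) absolutely_integrable_on {0<..} \<and>
      integral {0<..} (\<lambda>u. \<bar>\<nu> * u powr (\<nu> - 1)\<bar> * f (u powr \<nu>)) = Gamma a / \<nu> \<longleftrightarrow>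
      f absolutely_integrable_on ((\<lambda>u. u powr \<nu>) ` {0<..}) \<and>
      integral ((\<lambda>u. u powr \<nu>) ` {0<..}) f = Gamma a / \<nu>"
  proof (rule has_absolute_integral_change_of_variables_1')
    show "((\<lambda>u. u powr \<nu>) has_real_derivative \<nu> * u powr (\<nu> - 1)) (at u within {0<..})" if "u \<in> {0<..}" for u
      using that by (intro has_field_derivative_at_within[OF has_real_derivative_powr]) auto
    show "inj_on (\<lambda>u. u powr \<nu>) {0<..}"
    proof (rule inj_on_inverseI)
      show "(u powr \<nu>) powr (1 / \<nu>) = u" if "u \<in> {0<..}" for u :: real
        using that assms by (simp add: powr_powr)
    qed
  qed auto
  then have "(\<lambda>u. \<bar>\<nu> * u powr (\<nu> - 1)\<bar> * f (u powr \<nu>)) absolutely_integrable_on {0<..} \<and>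
      integral {0<..} (\<lambda>u. \<bar>\<nu> * u powr (\<nu> - 1)\<bar> * f (u powr \<nu>)) = Gamma a / \<nu>"
    unfolding img using 1 2 by blast
  then have "((\<lambda>u. \<bar>\<nu> * u powr (\<nu> - 1)\<bar> * f (u powr \<nu>)) has_integral Gamma a / \<nu>) {0<..}"
    by (simp add: absolutely_integrable_on_def has_integral_iff)
  moreover have "\<bar>\<nu> * u powr (\<nu> - 1)\<bar> * f (u powr \<nu>) = u powr (\<nu> * a - 1) * exp (- (u powr \<nu>))"
    if "u \<in> {0<..}" for u
  proof -
    have "u powr (\<nu> - 1) * (u powr \<nu>) powr (a - 1) = u powr (\<nu> * a - 1)"
      using that by (simp add: powr_powr algebra_simps flip: powr_add)
    then show ?thesis
      using assms that by (simp add: f_def abs_mult exp_minus field_simps)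
  qed
  ultimately show ?thesis by (rule has_integral_eq[rotated])
qed

text \<open>Restricting the infimum to rational times makes it a measurable function of the path.\<close>

definition first_passage :: "real \<Rightarrow> (real \<Rightarrow> real) \<Rightarrow> real" where
  "first_passage t f = enn2real (INF s\<in>{s\<in>\<rat>. 0 \<le> s}. if t < f s then ennreal s else \<top>)"

lemma first_passage_measurable [measurable]:
  "first_passage t \<in> borel_measurable (PiM {0..} (\<lambda>_. borel))"
proof -
  have "(\<lambda>f. INF s\<in>{s\<in>\<rat>. 0 \<le> s}. if t < f s then ennreal s else \<top>)
      \<in> borel_measurable (PiM {0..} (\<lambda>_. borel))"
  proof (rule borel_measurable_INF)
    show "countable {s\<in>\<rat>. (0::real) \<le> s}" by (rule countable_subset[OF _ countable_rat]) auto
    fix s :: real assume "s \<in> {s\<in>\<rat>. 0 \<le> s}"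
    then have [measurable]: "(\<lambda>f. f s) \<in> borel_measurable (PiM {0..} (\<lambda>_. borel :: real measure))"
      by (intro measurable_component_singleton) auto
    show "(\<lambda>f. if t < f s then ennreal s else \<top>) \<in> borel_measurable (PiM {0..} (\<lambda>_. borel))"
      by measurable
  qed
  then show ?thesis unfolding first_passage_def[abs_def] by measurable
qed

text \<open>Along a monotone path, once \<open>s\<close> has been passed by the level
  \<open>t\<close>, so has every rational just above \<open>s\<close>; the infimum therefore does
  not change.\<close>

lemma inverse_subordinator_rational:
  assumes "mono_on {0..} (\<lambda>s. D s \<omega>)"
  shows "inverse_subordinator D t \<omega> = (INF s\<in>{s\<in>\<rat>. 0 \<le> s}. if t < D s \<omega> then ennreal s else \<top>)"
  unfolding inverse_subordinator_def
proof (rule antisym)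
  show "(INF s\<in>{s. 0 \<le> s \<and> t < D s \<omega>}. ennreal s) \<le> (INF s\<in>{s\<in>\<rat>. 0 \<le> s}. if t < D s \<omega> then ennreal s else \<top>)"
    by (rule INF_greatest) (auto intro!: INF_lower)
  show "(INF s\<in>{s\<in>\<rat>. 0 \<le> s}. if t < D s \<omega> then ennreal s else \<top>) \<le> (INF s\<in>{s. 0 \<le> s \<and> t < D s \<omega>}. ennreal s)"
  proof (rule INF_greatest)
    fix s assume s: "s \<in> {s. 0 \<le> s \<and> t < D s \<omega>}"
    show "(INF s\<in>{s\<in>\<rat>. 0 \<le> s}. if t < D s \<omega> then ennreal s else \<top>) \<le> ennreal s"
    proof (rule ennreal_le_epsilon)
      fix e :: real assume "e > 0"
      then obtain q where q: "q \<in> \<rat>" "s < q" "q < s + e" using Rats_dense_in_real[of s "s + e"] by auto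
      have "D s \<omega> \<le> D q \<omega>" using assms s q by (auto simp: mono_on_def)
      then have "(INF s\<in>{s\<in>\<rat>. 0 \<le> s}. if t < D s \<omega> then ennreal s else \<top>) \<le> ennreal q"
        using s q by (intro INF_lower2[of q]) auto
      also have "\<dots> \<le> ennreal (s + e)" using q by (intro ennreal_leI) auto
      also have "\<dots> = ennreal s + ennreal e" using s \<open>e > 0\<close> by (intro ennreal_plus) auto
      finally show "(INF s\<in>{s\<in>\<rat>. 0 \<le> s}. if t < D s \<omega> then ennreal s else \<top>) \<le> ennreal s + ennreal e" .
    qed
  qed
qed

lemma first_passage_path_var:
  assumes "mono_on {0..} (\<lambda>s. D s \<omega>)"
  shows "first_passage t (path_var D \<omega>) = enn2real (inverse_subordinator D t \<omega>)"
  unfolding first_passage_def inverse_subordinator_rational[of D \<omega> t, OF assms]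
  by (intro arg_cong[where f = enn2real] INF_cong) (auto simp: path_var_def)

section \<open>Law and moments of the inverse stable subordinator\<close>

locale stable_subordinator_on = prob_space M for M :: "'a measure" +
  fixes \<nu> :: real and D :: "real \<Rightarrow> 'a \<Rightarrow> real"
  assumes nu: "0 < \<nu>" "\<nu> < 1" and D: "stable_subordinator M \<nu> D"
begin

lemma D_meas: "s \<ge> 0 \<Longrightarrow> D s \<in> borel_measurable M"
  using D by (simp add: stable_subordinator_def subordinator_def)

lemma D_mono: "\<omega> \<in> space M \<Longrightarrow> mono_on {0..} (\<lambda>s. D s \<omega>)"
  using D by (simp add: stable_subordinator_def subordinator_def increasing_rcont_paths_def)

lemma D_nonneg: "\<omega> \<in> space M \<Longrightarrow> s \<ge> 0 \<Longrightarrow> D s \<omega> \<ge> 0"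
  using D mono_onD[OF D_mono, of \<omega> 0 s] by (simp add: stable_subordinator_def subordinator_def)

lemma laplace: "s \<ge> 0 \<Longrightarrow> u \<ge> 0 \<Longrightarrow> expectation (\<lambda>\<omega>. exp (- u * D s \<omega>)) = exp (- s * u powr \<nu>)"
  using D stable_laplace_exponent[OF nu, of u] by (simp add: stable_subordinator_def subordinator_def)

lemma integrable_exp_D: "s \<ge> 0 \<Longrightarrow> u \<ge> 0 \<Longrightarrow> integrable M (\<lambda>\<omega>. exp (- u * D s \<omega>))"
  by (rule integrable_const_bound[of _ 1]) (use D_meas[of s] D_nonneg[of _ s] in \<open>auto intro!: AE_I2\<close>)

text \<open>Self-similarity at one fixed time: both variables have Laplace transform
  \<open>exp (- s * u powr \<nu>)\<close>.\<close>

lemma prob_D_le_scaling: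
  assumes "s > 0"
  shows "prob {\<omega>\<in>space M. D s \<omega> \<le> t} = prob {\<omega>\<in>space M. s powr (1 / \<nu>) * D 1 \<omega> \<le> t}"
proof -
  have [measurable]: "D s \<in> borel_measurable M" "D 1 \<in> borel_measurable M" using assms by (auto intro: D_meas)
  have "distr M borel (D s) = distr M borel (\<lambda>\<omega>. s powr (1 / \<nu>) * D 1 \<omega>)"
  proof (rule laplace_transform_determines_distr[OF prob_space_axioms _ _ prob_space_axioms])
    fix n :: nat
    have "expectation (\<lambda>\<omega>. exp (- real n * (s powr (1 / \<nu>) * D 1 \<omega>))) =
        expectation (\<lambda>\<omega>. exp (- (real n * s powr (1 / \<nu>)) * D 1 \<omega>))"
      by (simp add: mult.assoc)
    also have "\<dots> = exp (- 1 * (real n * s powr (1 / \<nu>)) powr \<nu>)" by (rule laplace) auto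
    also have "(real n * s powr (1 / \<nu>)) powr \<nu> = real n powr \<nu> * s"
      using assms nu by (simp add: powr_mult powr_powr)
    finally have r: "expectation (\<lambda>\<omega>. exp (- real n * (s powr (1 / \<nu>) * D 1 \<omega>))) =
        exp (- 1 * (real n powr \<nu> * s))" .
    have l: "expectation (\<lambda>\<omega>. exp (- real n * D s \<omega>)) = exp (- s * real n powr \<nu>)"
      using assms by (intro laplace) auto
    show "expectation (\<lambda>\<omega>. exp (- real n * D s \<omega>)) =
        expectation (\<lambda>\<omega>. exp (- real n * (s powr (1 / \<nu>) * D 1 \<omega>)))"
      unfolding l r by (simp add: mult.commute)
  qed (use assms D_nonneg in auto)
  then have "measure (distr M borel (D s)) {..t} = measure (distr M borel (\<lambda>\<omega>. s powr (1 / \<nu>) * D 1 \<omega>)) {..t}"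
    by simp
  then show ?thesis by (simp add: measure_distr vimage_def Int_def conj_commute)
qed

text \<open>Chernoff's bound with the Laplace transform at \<open>u = 1\<close>. Letting
  \<open>s\<close> grow shows that almost no path stays below a level, hence that the inverse is
  almost surely finite.\<close>

lemma prob_D_le_bound:
  assumes "s \<ge> 0"
  shows "prob {\<omega>\<in>space M. D s \<omega> \<le> t} \<le> exp (t - s)"
proof -
  have [measurable]: "D s \<in> borel_measurable M" using assms by (rule D_meas)
  have "prob {\<omega>\<in>space M. D s \<omega> \<le> t} = expectation (indicator {\<omega>\<in>space M. D s \<omega> \<le> t})" by simp
  also have "\<dots> \<le> expectation (\<lambda>\<omega>. exp t * exp (- 1 * D s \<omega>))"
  proof (rule integral_mono)
    show "integrable M (\<lambda>\<omega>. exp t * exp (- 1 * D s \<omega>))"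
      using assms by (intro integrable_mult_right integrable_exp_D) auto
    show "indicator {\<omega>\<in>space M. D s \<omega> \<le> t} \<omega> \<le> exp t * exp (- 1 * D s \<omega>)" for \<omega>
      by (auto simp: indicator_def simp flip: exp_add)
  qed (auto simp: integrable_indicator_iff less_top[symmetric])
  also have "\<dots> = exp t * exp (- s * 1 powr \<nu>)"
    using laplace[OF assms, of 1] by (simp only: integral_mult_right_zero)
  also have "\<dots> = exp (t - s)" by (simp add: exp_diff exp_minus field_simps)
  finally show ?thesis .
qed

text \<open>On the event \<open>D 1 = 0\<close> the variable \<open>exp (- n * D 1)\<close> equals
  1, so its probability is at most the Laplace transform at every \<open>n\<close>, which tends to
  0.\<close>

lemma AE_D1_pos: "AE \<omega> in M. D 1 \<omega> > 0"
proof -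
  have [measurable]: "D 1 \<in> borel_measurable M" by (intro D_meas) auto
  have "prob {\<omega>\<in>space M. D 1 \<omega> = 0} \<le> exp (- (real n powr \<nu>))" for n
  proof -
    have "prob {\<omega>\<in>space M. D 1 \<omega> = 0} = expectation (indicator {\<omega>\<in>space M. D 1 \<omega> = 0})" by simp
    also have "\<dots> \<le> expectation (\<lambda>\<omega>. exp (- real n * D 1 \<omega>))"
      by (intro integral_mono integrable_exp_D) (auto simp: integrable_indicator_iff indicator_def less_top[symmetric])
    finally show ?thesis using laplace[of 1 "real n"] by simp
  qed
  moreover have "(\<lambda>n. exp (- (real n powr \<nu>))) \<longlonglongrightarrow> 0" using nu by real_asymp
  ultimately have "prob {\<omega>\<in>space M. D 1 \<omega> = 0} \<le> 0"
    by (intro LIMSEQ_le_const) auto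
  then have "prob {\<omega>\<in>space M. D 1 \<omega> = 0} = 0" by (simp add: measure_le_0_iff)
  then have "AE \<omega> in M. D 1 \<omega> \<noteq> 0"
    by (subst (asm) prob_eq_0) auto
  then show ?thesis using D_nonneg[of _ 1] by (auto intro: order.not_eq_order_implies_strict elim!: AE_mp intro!: AE_I2 simp: less_le)
qed

lemma inverse_measurable: "(\<lambda>\<omega>. enn2real (inverse_subordinator D t \<omega>)) \<in> borel_measurable M"
proof -
  have "path_var D \<in> measurable M (PiM {0..} (\<lambda>_. borel))"
    unfolding path_var_def by (rule measurable_restrict) (auto intro: D_meas)
  then have "(\<lambda>\<omega>. first_passage t (path_var D \<omega>)) \<in> borel_measurable M" by measurable
  then show ?thesis
    by (subst (asm) measurable_cong[OF first_passage_path_var[OF D_mono]])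
qed

text \<open>The infimum exceeds \<open>s\<close> exactly when the path is still at most
  \<open>t\<close> at some time strictly after \<open>s\<close>; the value at \<open>s\<close> alone
  does not decide. The times \<open>s + 1 / (m + 1)\<close> make this a countable union that
  increases with \<open>m\<close>.\<close>

lemma inverse_greater_iff:
  assumes "\<omega> \<in> space M" "s \<ge> 0"
  shows "ennreal s < inverse_subordinator D t \<omega> \<longleftrightarrow> (\<exists>m::nat. D (s + 1 / real (Suc m)) \<omega> \<le> t)"
proof
  assume "ennreal s < inverse_subordinator D t \<omega>"
  then obtain z where z: "ennreal s < z" "z < inverse_subordinator D t \<omega>" using dense by blast
  then obtain r where r: "z = ennreal r" "r \<ge> 0" by (cases z) auto
  then have "s < r" using z(1) assms by (simp add: ennreal_less_iff)
  then obtain m where m: "1 / real (Suc m) < r - s" using nat_approx_posE[of "r - s"] by auto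
  have "D (s + 1 / real (Suc m)) \<omega> \<le> t"
  proof (rule ccontr)
    assume "\<not> D (s + 1 / real (Suc m)) \<omega> \<le> t"
    then have "inverse_subordinator D t \<omega> \<le> ennreal (s + 1 / real (Suc m))"
      unfolding inverse_subordinator_def using assms by (intro INF_lower) auto
    also have "\<dots> \<le> ennreal r" using m by (intro ennreal_leI) auto
    finally show False using z r by auto
  qed
  then show "\<exists>m::nat. D (s + 1 / real (Suc m)) \<omega> \<le> t" ..
next
  assume "\<exists>m::nat. D (s + 1 / real (Suc m)) \<omega> \<le> t"
  then obtain m :: nat where m: "D (s + 1 / real (Suc m)) \<omega> \<le> t" ..
  have "ennreal s < ennreal (s + 1 / real (Suc m))" using assms by (simp add: ennreal_less_iff)
  also have "\<dots> \<le> inverse_subordinator D t \<omega>"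
    unfolding inverse_subordinator_def
  proof (rule INF_greatest)
    fix u assume u: "u \<in> {u. 0 \<le> u \<and> t < D u \<omega>}"
    have "s + 1 / real (Suc m) \<le> u"
    proof (rule ccontr)
      assume "\<not> s + 1 / real (Suc m) \<le> u"
      then have "D u \<omega> \<le> D (s + 1 / real (Suc m)) \<omega>"
        using u by (intro mono_onD[OF D_mono[OF assms(1)]]) auto
      then show False using u m by auto
    qed
    then show "ennreal (s + 1 / real (Suc m)) \<le> ennreal u" by (rule ennreal_leI)
  qed
  finally show "ennreal s < inverse_subordinator D t \<omega>" .
qed

lemma AE_inverse_finite: "AE \<omega> in M. inverse_subordinator D t \<omega> < \<top>"
proof -
  let ?N = "{\<omega>\<in>space M. \<forall>n::nat. D (real n) \<omega> \<le> t}"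
  have N_sets: "?N \<in> sets M"
    using D_meas by (intro sets.sets_Collect_countable_All) auto
  have "prob ?N \<le> exp (t - real n)" for n
  proof -
    have [measurable]: "D (real n) \<in> borel_measurable M" by (intro D_meas) auto
    have "prob ?N \<le> prob {\<omega>\<in>space M. D (real n) \<omega> \<le> t}"
      by (intro finite_measure_mono) auto
    then show ?thesis using prob_D_le_bound[of "real n" t] by simp
  qed
  moreover have "(\<lambda>n. exp (t - real n)) \<longlonglongrightarrow> 0" by real_asymp
  ultimately have "prob ?N \<le> 0" by (intro LIMSEQ_le_const) auto
  then have "prob ?N = 0" by (simp add: measure_le_0_iff)
  then have "?N \<in> null_sets M" using N_sets by (simp add: null_sets_def emeasure_eq_measure)
  then show ?thesis
  proof (rule AE_I', intro subsetI CollectI conjI allI)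
    fix \<omega> and n :: nat
    assume \<omega>: "\<omega> \<in> {\<omega> \<in> space M. \<not> inverse_subordinator D t \<omega> < \<top>}"
    then show "\<omega> \<in> space M" by simp
    show "D (real n) \<omega> \<le> t"
    proof (rule ccontr)
      assume "\<not> D (real n) \<omega> \<le> t"
      then have "inverse_subordinator D t \<omega> \<le> ennreal (real n)"
        unfolding inverse_subordinator_def by (intro INF_lower) auto
      then show False using order.strict_trans1[OF _ ennreal_less_top] \<omega> by blast
    qed
  qed
qed

text \<open>The tail events of both sides are, up to null sets, increasing unions of
  \<open>{D \<sigma> \<le> t}\<close> and of
  \<open>{\<sigma> powr (1 / \<nu>) * D 1 \<le> t}\<close>, where the latter condition reads
  \<open>\<sigma> \<le> (t / D 1) powr \<nu>\<close>. Self-similarity at each single time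
  \<open>\<sigma>\<close> thus suffices.\<close>

lemma distr_inverse:
  assumes t: "t > 0"
  shows "distr M borel (\<lambda>\<omega>. enn2real (inverse_subordinator D t \<omega>)) =
    distr M borel (\<lambda>\<omega>. t powr \<nu> * D 1 \<omega> powr (- \<nu>))"
proof -
  define E where "E \<omega> = enn2real (inverse_subordinator D t \<omega>)" for \<omega>
  define V where "V \<omega> = t powr \<nu> * D 1 \<omega> powr (- \<nu>)" for \<omega>
  have [measurable]: "D 1 \<in> borel_measurable M" by (intro D_meas) auto
  have E_meas [measurable]: "E \<in> borel_measurable M" unfolding E_def by (rule inverse_measurable)
  have V_meas [measurable]: "V \<in> borel_measurable M" unfolding V_def by measurable
  have E_nonneg: "E \<omega> \<ge> 0" and V_nonneg: "V \<omega> \<ge> 0" for \<omega> by (simp_all add: E_def V_def)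
  have eq: "prob {\<omega>\<in>space M. s < E \<omega>} = prob {\<omega>\<in>space M. s < V \<omega>}" if s: "s \<ge> 0" for s
  proof -
    define \<sigma> where "\<sigma> m = s + 1 / real (Suc m)" for m
    have \<sigma>: "\<sigma> m > 0" "s < \<sigma> m" "m \<le> n \<Longrightarrow> \<sigma> n \<le> \<sigma> m" for m n
      using s by (auto simp: \<sigma>_def add_nonneg_pos frac_le)
    define A where "A m = {\<omega>\<in>space M. D (\<sigma> m) \<omega> \<le> t}" for m
    define A' where "A' m = {\<omega>\<in>space M. \<sigma> m powr (1 / \<nu>) * D 1 \<omega> \<le> t}" for m
    have A_sets: "range A \<subseteq> sets M" using D_meas \<sigma>(1) by (auto simp: A_def less_imp_le)
    have A'_sets: "range A' \<subseteq> sets M" by (auto simp: A'_def)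
    have "incseq A"
    proof (unfold incseq_def, intro allI impI subsetI)
      fix m n :: nat and \<omega> assume mn: "m \<le> n" and \<omega>: "\<omega> \<in> A m"
      have "D (\<sigma> n) \<omega> \<le> D (\<sigma> m) \<omega>"
        using \<omega> \<sigma>(1)[of n] \<sigma>(1)[of m] \<sigma>(3)[OF mn]
        by (intro mono_onD[OF D_mono]) (auto simp: A_def)
      then show "\<omega> \<in> A n" using \<omega> by (auto simp: A_def)
    qed
    have "incseq A'"
    proof (unfold incseq_def, intro allI impI subsetI)
      fix m n :: nat and \<omega> assume mn: "m \<le> n" and \<omega>: "\<omega> \<in> A' m"
      have "\<sigma> n powr (1 / \<nu>) * D 1 \<omega> \<le> \<sigma> m powr (1 / \<nu>) * D 1 \<omega>"
        using \<omega> \<sigma>(1)[of n] \<sigma>(3)[OF mn] nu D_nonneg[of \<omega> 1]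
        by (intro mult_right_mono powr_mono2) (auto simp: A'_def)
      then show "\<omega> \<in> A' n" using \<omega> by (auto simp: A'_def)
    qed
    have "prob {\<omega>\<in>space M. s < E \<omega>} = prob (\<Union>m. A m)"
    proof (rule finite_measure_eq_AE)
      show "AE \<omega> in M. \<omega> \<in> {\<omega>\<in>space M. s < E \<omega>} \<longleftrightarrow> \<omega> \<in> (\<Union>m. A m)"
        using AE_inverse_finite[of t] AE_space
      proof eventually_elim
        case (elim \<omega>)
        then have "inverse_subordinator D t \<omega> = ennreal (E \<omega>)" by (simp add: E_def)
        then have "s < E \<omega> \<longleftrightarrow> ennreal s < inverse_subordinator D t \<omega>"
          using s E_nonneg[of \<omega>] by (simp add: ennreal_less_iff)
        then show ?case using inverse_greater_iff[OF elim(2) s] elim(2) by (simp add: A_def \<sigma>_def)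
      qed
    qed (use A_sets in auto)
    moreover have "prob {\<omega>\<in>space M. s < V \<omega>} = prob (\<Union>m. A' m)"
    proof (rule finite_measure_eq_AE)
      show "AE \<omega> in M. \<omega> \<in> {\<omega>\<in>space M. s < V \<omega>} \<longleftrightarrow> \<omega> \<in> (\<Union>m. A' m)"
        using AE_D1_pos AE_space
      proof eventually_elim
        case (elim \<omega>)
        have *: "x powr (1 / \<nu>) * D 1 \<omega> \<le> t \<longleftrightarrow> x \<le> V \<omega>" if "x > 0" for x
        proof -
          have "x powr (1 / \<nu>) * D 1 \<omega> \<le> t \<longleftrightarrow> x powr (1 / \<nu>) \<le> t / D 1 \<omega>"
            using elim by (simp add: pos_le_divide_eq)
          also have "t / D 1 \<omega> = V \<omega> powr (1 / \<nu>)"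
            using elim t nu by (simp add: V_def powr_mult powr_divide powr_powr powr_minus_divide)
          also have "x powr (1 / \<nu>) \<le> V \<omega> powr (1 / \<nu>) \<longleftrightarrow> x \<le> V \<omega>"
          proof
            assume le: "x powr (1 / \<nu>) \<le> V \<omega> powr (1 / \<nu>)"
            show "x \<le> V \<omega>"
            proof (rule ccontr)
              assume "\<not> x \<le> V \<omega>"
              then have "V \<omega> powr (1 / \<nu>) < x powr (1 / \<nu>)"
                using nu V_nonneg[of \<omega>] by (intro powr_less_mono2) auto
              then show False using le by simp
            qed
          qed (use that nu in \<open>auto intro!: powr_mono2\<close>)
          finally show ?thesis .
        qed
        have "s < V \<omega> \<longleftrightarrow> (\<exists>m. \<sigma> m \<le> V \<omega>)"
        proof
          assume "s < V \<omega>"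
          then obtain m where "1 / real (Suc m) < V \<omega> - s" using nat_approx_posE[of "V \<omega> - s"] by auto
          then show "\<exists>m. \<sigma> m \<le> V \<omega>" by (intro exI[of _ m]) (simp add: \<sigma>_def)
        next
          assume "\<exists>m. \<sigma> m \<le> V \<omega>"
          then show "s < V \<omega>" using \<sigma>(2) by (auto intro: order.strict_trans2)
        qed
        then show ?case using *[OF \<sigma>(1)] elim by (simp add: A'_def)
      qed
    qed (use A'_sets in auto)
    moreover have "prob (A m) = prob (A' m)" for m
      unfolding A_def A'_def by (rule prob_D_le_scaling[OF \<sigma>(1)])
    ultimately show ?thesis
      using finite_Lim_measure_incseq[OF A_sets \<open>incseq A\<close>]
        finite_Lim_measure_incseq[OF A'_sets \<open>incseq A'\<close>]
      by (auto intro: LIMSEQ_unique)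
  qed
  have "distr M borel E = distr M borel V"
  proof (rule cdf_unique')
    show "finite_borel_measure (distr M borel E)" "finite_borel_measure (distr M borel V)"
      by (auto intro!: real_distribution.finite_borel_measure_M real_distribution_distr)
    have cdf_eq: "cdf (distr M borel X) s = 1 - prob {\<omega>\<in>space M. s < X \<omega>}"
      if [measurable]: "X \<in> borel_measurable M" for X s
    proof -
      have "cdf (distr M borel X) s = prob {\<omega>\<in>space M. \<not> s < X \<omega>}"
        unfolding cdf_def by (subst measure_distr) (auto simp: not_less intro!: arg_cong[where f = prob])
      then show ?thesis by (subst (asm) prob_neg) auto
    qed
    show "cdf (distr M borel E) = cdf (distr M borel V)"
    proof
      fix s
      show "cdf (distr M borel E) s = cdf (distr M borel V) s"
      proof (cases "s \<ge> 0")
        case False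
        then have "s < E \<omega>" "s < V \<omega>" for \<omega> using E_nonneg[of \<omega>] V_nonneg[of \<omega>] by linarith+
        then show ?thesis by (simp add: cdf_eq)
      qed (simp add: cdf_eq eq)
    qed
  qed
  then show ?thesis by (simp add: E_def[abs_def] V_def[abs_def])
qed

text \<open>For \<open>D 1 > 0\<close>, \<open>Gamma b * D 1 powr (- b)\<close> is the integral of
  \<open>u powr (b - 1) * exp (- u * D 1)\<close> over the half-line. Exchanging integral and
  expectation brings in the Laplace transform, and with \<open>b = \<nu> * a\<close> the result is
  \<open>Gamma a / \<nu>\<close>. The functional equation of \<open>Gamma\<close> gives the stated
  quotient.\<close>

lemma nn_moment_D1:
  assumes a: "a > 0"
  shows "(\<integral>\<^sup>+\<omega>. ennreal (D 1 \<omega> powr (- \<nu> * a)) \<partial>M) = ennreal (Gamma (1 + a) / Gamma (1 + \<nu> * a))"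
proof -
  have [measurable]: "D 1 \<in> borel_measurable M" by (intro D_meas) auto
  define b where "b = \<nu> * a"
  have b: "b > 0" using a nu by (simp add: b_def)
  have G: "Gamma b > 0" using b by (rule Gamma_real_pos)
  have "ennreal (Gamma b) * (\<integral>\<^sup>+\<omega>. ennreal (D 1 \<omega> powr (- b)) \<partial>M) =
      (\<integral>\<^sup>+\<omega>. ennreal (Gamma b) * ennreal (D 1 \<omega> powr (- b)) \<partial>M)"
    by (rule nn_integral_cmult[symmetric]) measurable
  also have "\<dots> = (\<integral>\<^sup>+\<omega>. \<integral>\<^sup>+u. ennreal (indicator {0..} u * (u powr (b - 1) * exp (- D 1 \<omega> * u))) \<partial>lborel \<partial>M)"
  proof (rule nn_integral_cong_AE)
    show "AE \<omega> in M. ennreal (Gamma b) * ennreal (D 1 \<omega> powr (- b)) =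
        (\<integral>\<^sup>+u. ennreal (indicator {0..} u * (u powr (b - 1) * exp (- D 1 \<omega> * u))) \<partial>lborel)"
      using AE_D1_pos
      by eventually_elim (simp only: nn_integral_Gamma_scaled[OF b] ennreal_mult''[OF powr_ge_zero])
  qed
  also have "\<dots> = (\<integral>\<^sup>+u. \<integral>\<^sup>+\<omega>. ennreal (indicator {0..} u * (u powr (b - 1) * exp (- D 1 \<omega> * u))) \<partial>M \<partial>lborel)"
  proof -
    interpret P: pair_sigma_finite M lborel ..
    show ?thesis by (rule P.Fubini'[symmetric]) measurable
  qed
  also have "\<dots> = (\<integral>\<^sup>+u. ennreal (indicator {0<..} u * (u powr (\<nu> * a - 1) * exp (- (u powr \<nu>)))) \<partial>lborel)"
  proof (rule nn_integral_cong)
    fix u :: real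
    show "(\<integral>\<^sup>+\<omega>. ennreal (indicator {0..} u * (u powr (b - 1) * exp (- D 1 \<omega> * u))) \<partial>M) =
        ennreal (indicator {0<..} u * (u powr (\<nu> * a - 1) * exp (- (u powr \<nu>))))"
    proof (cases "u > 0")
      case True
      have "(\<integral>\<^sup>+\<omega>. ennreal (indicator {0..} u * (u powr (b - 1) * exp (- D 1 \<omega> * u))) \<partial>M) =
          (\<integral>\<^sup>+\<omega>. ennreal (u powr (b - 1) * exp (- u * D 1 \<omega>)) \<partial>M)"
        using True by (simp add: mult.commute)
      also have "\<dots> = ennreal (expectation (\<lambda>\<omega>. u powr (b - 1) * exp (- u * D 1 \<omega>)))"
        using True by (intro nn_integral_eq_integral integrable_mult_right integrable_exp_D) auto
      also have "expectation (\<lambda>\<omega>. u powr (b - 1) * exp (- u * D 1 \<omega>)) = u powr (b - 1) * exp (- (u powr \<nu>))"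
        using True laplace[of 1 u] by simp
      finally show ?thesis using True by (simp add: b_def)
    qed (auto simp: indicator_def)
  qed
  also have "\<dots> = ennreal (Gamma a / \<nu>)"
    by (rule nn_integral_has_integral_lebesgue[OF _ has_integral_powr_exp_powr]) (use a nu in auto)
  finally have "ennreal (1 / Gamma b) * (ennreal (Gamma b) * (\<integral>\<^sup>+\<omega>. ennreal (D 1 \<omega> powr (- b)) \<partial>M)) =
      ennreal (1 / Gamma b) * ennreal (Gamma a / \<nu>)" by simp
  moreover have "ennreal (1 / Gamma b) * (ennreal (Gamma b) * x) = x" for x
    using G by (simp add: mult.assoc[symmetric] flip: ennreal_mult)
  ultimately have "(\<integral>\<^sup>+\<omega>. ennreal (D 1 \<omega> powr (- b)) \<partial>M) = ennreal (1 / Gamma b) * ennreal (Gamma a / \<nu>)"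
    by simp
  also have "\<dots> = ennreal (1 / Gamma b * (Gamma a / \<nu>))"
    using G by (intro ennreal_mult'[symmetric]) simp
  also have "1 / Gamma b * (Gamma a / \<nu>) = Gamma (1 + a) / Gamma (1 + b)"
  proof -
    have "a \<notin> \<int>\<^sub>\<le>\<^sub>0" "b \<notin> \<int>\<^sub>\<le>\<^sub>0" using a b by (auto elim!: nonpos_Ints_cases)
    then have "Gamma (1 + a) = a * Gamma a" "Gamma (1 + b) = (\<nu> * a) * Gamma b"
      using Gamma_plus1[of a] Gamma_plus1[of b] by (simp_all add: add.commute b_def)
    then show ?thesis using a nu less_imp_neq[OF G] by (simp add: field_simps)
  qed
  finally show ?thesis by (simp add: b_def)
qed

lemma inverse_moments:
  assumes t: "t > 0"
  shows "integrable M (\<lambda>\<omega>. enn2real (inverse_subordinator D t \<omega>) ^ n)"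
    and "expectation (\<lambda>\<omega>. enn2real (inverse_subordinator D t \<omega>) ^ n) =
      (t powr \<nu>) ^ n * (fact n / Gamma (1 + \<nu> * real n))"
proof -
  have [measurable]: "D 1 \<in> borel_measurable M" by (intro D_meas) auto
  note [measurable] = inverse_measurable
  let ?V = "\<lambda>\<omega>. t powr \<nu> * D 1 \<omega> powr (- \<nu>)"
  have G: "Gamma (1 + \<nu> * real n) > 0" using nu by (intro Gamma_real_pos) (auto simp: add_pos_nonneg)
  have nn: "(\<integral>\<^sup>+\<omega>. ennreal (?V \<omega> ^ n) \<partial>M) = ennreal ((t powr \<nu>) ^ n * (fact n / Gamma (1 + \<nu> * real n)))"
  proof (cases "n = 0")
    case False
    have "(\<integral>\<^sup>+\<omega>. ennreal (?V \<omega> ^ n) \<partial>M) = (\<integral>\<^sup>+\<omega>. ennreal ((t powr \<nu>) ^ n) * ennreal (D 1 \<omega> powr (- \<nu> * real n)) \<partial>M)"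
      using AE_D1_pos
      by (intro nn_integral_cong_AE, eventually_elim)
         (simp add: power_mult_distrib ennreal_mult' powr_realpow[symmetric] powr_powr)
    also have "\<dots> = ennreal ((t powr \<nu>) ^ n) * ennreal (Gamma (1 + real n) / Gamma (1 + \<nu> * real n))"
      using False nn_moment_D1[of "real n"] by (subst nn_integral_cmult) auto
    also have "Gamma (1 + real n) = fact n" by (simp add: Gamma_fact)
    also have "ennreal ((t powr \<nu>) ^ n) * ennreal (fact n / Gamma (1 + \<nu> * real n)) =
        ennreal ((t powr \<nu>) ^ n * (fact n / Gamma (1 + \<nu> * real n)))"
      by (intro ennreal_mult'[symmetric]) simp
    finally show ?thesis .
  qed (simp add: emeasure_space_1)
  have int_V: "integrable M (\<lambda>\<omega>. ?V \<omega> ^ n)"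
    by (rule integrableI_nonneg) (use nn in auto)
  have val_V: "expectation (\<lambda>\<omega>. ?V \<omega> ^ n) = (t powr \<nu>) ^ n * (fact n / Gamma (1 + \<nu> * real n))"
    using nn G by (subst integral_eq_nn_integral) auto
  have "integrable (distr M borel (\<lambda>\<omega>. enn2real (inverse_subordinator D t \<omega>))) (\<lambda>x. x ^ n)"
    unfolding distr_inverse[OF t] using int_V by (subst integrable_distr_eq) auto
  then show "integrable M (\<lambda>\<omega>. enn2real (inverse_subordinator D t \<omega>) ^ n)"
    by (subst (asm) integrable_distr_eq) auto
  have "expectation (\<lambda>\<omega>. enn2real (inverse_subordinator D t \<omega>) ^ n) =
      (\<integral>x. x ^ n \<partial>distr M borel (\<lambda>\<omega>. enn2real (inverse_subordinator D t \<omega>)))"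
    by (subst integral_distr) auto
  also have "\<dots> = expectation (\<lambda>\<omega>. ?V \<omega> ^ n)"
    unfolding distr_inverse[OF t] by (subst integral_distr) auto
  finally show "expectation (\<lambda>\<omega>. enn2real (inverse_subordinator D t \<omega>) ^ n) =
      (t powr \<nu>) ^ n * (fact n / Gamma (1 + \<nu> * real n))"
    using val_V by simp
qed

end

section \<open>Mixed Poisson probabilities as Mittag-Leffler series\<close>

text \<open>Only the part of Euler's integral beyond \<open>R\<close> is kept, where the power is at
  least \<open>R powr y\<close>. As \<open>R\<close> is arbitrary, \<open>Gamma\<close> outgrows
  every geometric sequence.\<close>

lemma Gamma_lower_bound:
  fixes y R :: real
  assumes "y \<ge> 0" "R > 0"
  shows "R powr y * exp (- R) \<le> Gamma (1 + y)"
proof -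
  have "ennreal (R powr y * exp (- R)) = ennreal (R powr y) * ennreal (0 - (- exp (- R)))"
    by (simp add: ennreal_mult)
  also have "ennreal (0 - (- exp (- R))) = (\<integral>\<^sup>+t. ennreal (exp (- t)) * indicator {R..} t \<partial>lborel)"
  proof (rule nn_integral_FTC_atLeast[symmetric])
    show "((\<lambda>t::real. - exp (- t)) \<longlongrightarrow> 0) at_top" by real_asymp
  qed (auto intro!: derivative_eq_intros)
  also have "ennreal (R powr y) * \<dots> = (\<integral>\<^sup>+t. ennreal (R powr y) * (ennreal (exp (- t)) * indicator {R..} t) \<partial>lborel)"
    by (rule nn_integral_cmult[symmetric]) measurable
  also have "\<dots> \<le> (\<integral>\<^sup>+t. ennreal (indicator {0..} t * t powr ((1 + y) - 1) / exp t) \<partial>lborel)"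
    using assms
    by (intro nn_integral_mono)
       (auto simp: indicator_def exp_minus divide_inverse intro!: mult_right_mono powr_mono2 ennreal_leI simp flip: ennreal_mult)
  also have "\<dots> = ennreal (Gamma (1 + y))"
    using assms by (intro Gamma_conv_nn_integral_real[symmetric]) auto
  finally show ?thesis
    using assms by (subst (asm) ennreal_le_iff) (auto intro!: less_imp_le Gamma_real_pos)
qed

lemma summable_mittag_leffler:
  fixes \<nu> x :: real
  assumes "\<nu> > 0"
  shows "summable (\<lambda>n. \<bar>x\<bar> ^ n / Gamma (1 + \<nu> * real n))"
proof -
  \<comment> \<open>Chosen so that \<open>R powr \<nu> = 2 * \<bar>x\<bar> + 1\<close>, which gives
    the geometric ratio \<open>1 / 2\<close>; the \<open>+ 1\<close> keeps \<open>R\<close> positive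
    at \<open>x = 0\<close>.\<close>
  define R where "R = (2 * \<bar>x\<bar> + 1) powr (1 / \<nu>)"
  have R: "R > 0" "R powr \<nu> = 2 * \<bar>x\<bar> + 1" using assms by (auto simp: R_def powr_powr)
  have "\<bar>x\<bar> ^ n / Gamma (1 + \<nu> * real n) \<le> exp R * (1 / 2) ^ n" for n
  proof -
    have G: "Gamma (1 + \<nu> * real n) > 0" using assms by (intro Gamma_real_pos) (auto simp: add_pos_nonneg)
    have "(2 * \<bar>x\<bar>) ^ n * exp (- R) \<le> (R powr \<nu>) ^ n * exp (- R)"
      unfolding R(2) by (intro mult_right_mono power_mono) auto
    also have "(R powr \<nu>) ^ n = R powr (\<nu> * real n)"
      using R(1) by (simp add: powr_powr flip: powr_realpow)
    also have "R powr (\<nu> * real n) * exp (- R) \<le> Gamma (1 + \<nu> * real n)"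
      using assms R by (intro Gamma_lower_bound) auto
    finally have "\<bar>x\<bar> ^ n * 2 ^ n \<le> exp R * Gamma (1 + \<nu> * real n)"
      by (simp add: exp_minus power_mult_distrib field_simps)
    then show ?thesis using G by (simp add: field_simps)
  qed
  moreover have "\<bar>x\<bar> ^ n / Gamma (1 + \<nu> * real n) \<ge> 0" for n
    using assms by (intro divide_nonneg_pos Gamma_real_pos) (auto simp: add_pos_nonneg)
  ultimately have "norm (\<bar>x\<bar> ^ n / Gamma (1 + \<nu> * real n)) \<le> exp R * (1 / 2) ^ n" for n
    by (simp only: real_norm_def abs_of_nonneg)
  then have "\<exists>N. \<forall>n\<ge>N. norm (\<bar>x\<bar> ^ n / Gamma (1 + \<nu> * real n)) \<le> exp R * (1 / 2) ^ n" by blast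
  moreover have "summable (\<lambda>n. exp R * (1 / 2 :: real) ^ n)"
    by (intro summable_mult summable_geometric) simp
  ultimately show ?thesis by (rule summable_comparison_test)
qed

text \<open>The sign exponent \<open>n + k\<close> has the parity of \<open>n - k\<close> without
  truncated subtraction, and the binomial coefficient vanishes for \<open>n < k\<close>, so the
  series can start at 0. For \<open>k = 0\<close> it is the Mittag-Leffler function at
  \<open>- a\<close>.\<close>

definition ml_coeff :: "real \<Rightarrow> nat \<Rightarrow> nat \<Rightarrow> real" where
  "ml_coeff \<nu> k n = (- 1) ^ (n + k) * real (n choose k) / Gamma (1 + \<nu> * real n)"

definition ml_prob :: "real \<Rightarrow> nat \<Rightarrow> real \<Rightarrow> real" where
  "ml_prob \<nu> k a = (\<Sum>n. ml_coeff \<nu> k n * a ^ n)"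

lemma summable_binomial_mittag_leffler:
  fixes \<nu> x :: real
  assumes "\<nu> > 0"
  shows "summable (\<lambda>n. real (n choose k) * \<bar>x\<bar> ^ n / Gamma (1 + \<nu> * real n))"
proof (rule summable_comparison_test')
  show "summable (\<lambda>n. \<bar>2 * x\<bar> ^ n / Gamma (1 + \<nu> * real n))"
    by (rule summable_mittag_leffler[OF assms])
  fix n :: nat
  have G: "Gamma (1 + \<nu> * real n) > 0" using assms by (intro Gamma_real_pos) (auto simp: add_pos_nonneg)
  have "n choose k \<le> 2 ^ n" by (rule binomial_le_pow2)
  then have "real (n choose k) \<le> 2 ^ n" by (metis of_nat_le_iff of_nat_numeral of_nat_power)
  then have "real (n choose k) * \<bar>x\<bar> ^ n \<le> \<bar>2 * x\<bar> ^ n"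
    by (simp add: abs_mult power_mult_distrib mult_right_mono)
  then show "norm (real (n choose k) * \<bar>x\<bar> ^ n / Gamma (1 + \<nu> * real n)) \<le> \<bar>2 * x\<bar> ^ n / Gamma (1 + \<nu> * real n)"
    using G by (simp add: abs_mult divide_right_mono)
qed

lemma abs_ml_coeff_mult:
  assumes "\<nu> > 0"
  shows "\<bar>ml_coeff \<nu> k n * x ^ n\<bar> = real (n choose k) * \<bar>x\<bar> ^ n / Gamma (1 + \<nu> * real n)"
proof -
  have G: "Gamma (1 + \<nu> * real n) > 0" using assms by (intro Gamma_real_pos) (auto simp: add_pos_nonneg)
  then show ?thesis by (simp add: ml_coeff_def abs_mult power_abs)
qed

lemma summable_ml_coeff: "\<nu> > 0 \<Longrightarrow> summable (\<lambda>n. \<bar>ml_coeff \<nu> k n * x ^ n\<bar>)"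
  unfolding abs_ml_coeff_mult by (rule summable_binomial_mittag_leffler)

lemma summable_ml_prob: "\<nu> > 0 \<Longrightarrow> summable (\<lambda>n. ml_coeff \<nu> k n * x ^ n)"
  using summable_ml_coeff by (rule summable_rabs_cancel)

text \<open>Expand \<open>exp (- (r * Y))\<close> and integrate term by term. The factor
  \<open>fact (n + k)\<close> of the moment meets \<open>1 / (fact n * fact k)\<close> and leaves a
  binomial coefficient. The same computation with absolute values gives a convergent series, which
  justifies the exchange.\<close>

lemma (in prob_space) poisson_mixture_eq_ml_prob:
  assumes nu: "\<nu> > 0" and b: "b \<ge> 0" and r: "r \<ge> 0"
    and Y [measurable]: "Y \<in> borel_measurable M" and Y_nonneg: "\<And>\<omega>. \<omega> \<in> space M \<Longrightarrow> 0 \<le> Y \<omega>"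
    and int: "\<And>n. integrable M (\<lambda>\<omega>. Y \<omega> ^ n)"
    and moments: "\<And>n. expectation (\<lambda>\<omega>. Y \<omega> ^ n) = b ^ n * (fact n / Gamma (1 + \<nu> * real n))"
  shows "expectation (\<lambda>\<omega>. exp (- (r * Y \<omega>)) * (r * Y \<omega>) ^ k / fact k) = ml_prob \<nu> k (r * b)"
proof -
  define f where "f n \<omega> = ((- 1) ^ n * r ^ (n + k) / (fact n * fact k)) * Y \<omega> ^ (n + k)" for n \<omega>
  have int_f: "integrable M (f n)" for n
    unfolding f_def by (intro integrable_mult_right int)
  have binom: "real (n + k choose k) = fact (n + k) / (fact n * fact k)" for n
    by (subst binomial_fact) (auto simp: mult.commute)
  have val_f: "expectation (f n) = ml_coeff \<nu> k (n + k) * (r * b) ^ (n + k)" for n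
  proof -
    have "(- 1 :: real) ^ (n + k + k) = (- 1) ^ n" by (simp add: power_add flip: power_mult_distrib)
    then show ?thesis
      unfolding f_def ml_coeff_def binom
      by (simp add: moments power_mult_distrib mult_ac del: power_add)
  qed
  have norm_f: "norm (f n \<omega>) = (r ^ (n + k) / (fact n * fact k)) * Y \<omega> ^ (n + k)" if "\<omega> \<in> space M" for n \<omega>
    using r Y_nonneg[OF that] by (simp add: f_def abs_mult power_abs)
  have val_norm: "expectation (\<lambda>\<omega>. norm (f n \<omega>)) = real (n + k choose k) * \<bar>r * b\<bar> ^ (n + k) / Gamma (1 + \<nu> * real (n + k))" for n
  proof -
    have "expectation (\<lambda>\<omega>. norm (f n \<omega>)) = expectation (\<lambda>\<omega>. (r ^ (n + k) / (fact n * fact k)) * Y \<omega> ^ (n + k))"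
      by (intro Bochner_Integration.integral_cong refl norm_f)
    also have "\<dots> = (r ^ (n + k) / (fact n * fact k)) * (b ^ (n + k) * (fact (n + k) / Gamma (1 + \<nu> * real (n + k))))"
      by (simp only: integral_mult_right_zero moments)
    finally show ?thesis
      unfolding binom using r b by (simp add: power_mult_distrib abs_mult)
  qed
  have pointwise: "(\<lambda>n. f n \<omega>) sums (exp (- (r * Y \<omega>)) * (r * Y \<omega>) ^ k / fact k)"
    and pointwise_abs: "summable (\<lambda>n. norm (f n \<omega>))" for \<omega>
  proof -
    have e: "f n \<omega> = ((- (r * Y \<omega>)) ^ n /\<^sub>R fact n) * ((r * Y \<omega>) ^ k / fact k)" for n
      by (simp add: f_def power_add power_mult_distrib power_minus[of "r * Y \<omega>"] field_simps)
    show "(\<lambda>n. f n \<omega>) sums (exp (- (r * Y \<omega>)) * (r * Y \<omega>) ^ k / fact k)"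
      unfolding e
      using sums_mult2[OF exp_converges[of "- (r * Y \<omega>)"], of "(r * Y \<omega>) ^ k / fact k"] by simp
    show "summable (\<lambda>n. norm (f n \<omega>))"
      unfolding e norm_mult by (intro summable_mult2 summable_norm_exp)
  qed
  have "(\<lambda>n. expectation (f n)) sums expectation (\<lambda>\<omega>. \<Sum>n. f n \<omega>)"
  proof (rule sums_integral[OF int_f])
    show "AE \<omega> in M. summable (\<lambda>n. norm (f n \<omega>))" by (intro AE_I2 pointwise_abs)
    show "summable (\<lambda>n. expectation (\<lambda>\<omega>. norm (f n \<omega>)))"
      unfolding val_norm
      using summable_ignore_initial_segment[OF summable_binomial_mittag_leffler[OF nu, of k "r * b"], of k] .
  qed
  then have "(\<lambda>n. ml_coeff \<nu> k (n + k) * (r * b) ^ (n + k)) sums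
      expectation (\<lambda>\<omega>. exp (- (r * Y \<omega>)) * (r * Y \<omega>) ^ k / fact k)"
    unfolding val_f sums_unique[OF pointwise, symmetric] .
  \<comment> \<open>The expansion starts at power \<open>k\<close>; the sum is shifted back to start
    at 0, where the extra terms vanish.\<close>
  then have "(\<lambda>n. ml_coeff \<nu> k n * (r * b) ^ n) sums
      (expectation (\<lambda>\<omega>. exp (- (r * Y \<omega>)) * (r * Y \<omega>) ^ k / fact k) +
       (\<Sum>n<k. ml_coeff \<nu> k n * (r * b) ^ n))"
    by (subst (asm) sums_iff_shift) 
  moreover have "(\<Sum>n<k. ml_coeff \<nu> k n * (r * b) ^ n) = 0"
    by (intro sum.neutral) (auto simp: ml_coeff_def binomial_eq_0)
  ultimately show ?thesis by (simp add: ml_prob_def sums_iff)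
qed

section \<open>The Caputo derivative of the state probabilities\<close>

text \<open>The images of disjoint intervals under \<open>s \<mapsto> s powr \<nu>\<close> are disjoint.\<close>

lemma powr_increments_disjoint:
  fixes x y :: "nat \<Rightarrow> real"
  assumes nu: "0 < \<nu>" and \<eta>: "\<eta> \<ge> 0" and xy: "\<And>i. i < n \<Longrightarrow> 0 \<le> x i \<and> x i \<le> y i"
    and disj: "disjoint_family_on (\<lambda>i. {x i<..<y i}) {..<n}"
  shows "(\<Sum>i<n. (min (y i) \<eta>) powr \<nu> - (min (x i) \<eta>) powr \<nu>) \<le> \<eta> powr \<nu>"
proof -
  \<comment> \<open>The images of the intervals truncated at \<open>\<eta>\<close>. Being disjoint
    subsets of \<open>[0, \<eta> powr \<nu>]\<close>, they have total length at most
    \<open>\<eta> powr \<nu>\<close>.\<close>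
  define I where "I i = {(min (x i) \<eta>) powr \<nu><..<(min (y i) \<eta>) powr \<nu>}" for i
  have le: "(min (x i) \<eta>) powr \<nu> \<le> (min (y i) \<eta>) powr \<nu>" if "i < n" for i
    using xy[OF that] nu \<eta> by (intro powr_mono2) auto
  have inv: "z powr (1 / \<nu>) \<in> {x i<..<y i}" if "z \<in> I i" "i < n" for z i
  proof -
    have z: "z > 0" "(min (x i) \<eta>) powr \<nu> < z" "z < (min (y i) \<eta>) powr \<nu>"
      using that by (auto simp: I_def intro: order.strict_trans1[OF powr_ge_zero])
    have "((min (x i) \<eta>) powr \<nu>) powr (1 / \<nu>) < z powr (1 / \<nu>)" "z powr (1 / \<nu>) < ((min (y i) \<eta>) powr \<nu>) powr (1 / \<nu>)"
      using z nu by (auto intro!: powr_less_mono2)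
    then have "min (x i) \<eta> < z powr (1 / \<nu>)" "z powr (1 / \<nu>) < min (y i) \<eta>"
      using xy[OF that(2)] \<eta> nu by (simp_all add: powr_powr)
    then show ?thesis by auto
  qed
  have "disjoint_family_on I {..<n}"
  proof (unfold disjoint_family_on_def, intro ballI impI equals0I)
    fix i j z assume ij: "i \<in> {..<n}" "j \<in> {..<n}" "i \<noteq> j" and z: "z \<in> I i \<inter> I j"
    have "z powr (1 / \<nu>) \<in> {x i<..<y i} \<inter> {x j<..<y j}"
      using inv[of z i] inv[of z j] ij z by blast
    then show False using disjoint_family_onD[OF disj ij] by blast
  qed
  then have "(\<Sum>i<n. measure lborel (I i)) = measure lborel (\<Union>i<n. I i)"
  proof (intro measure_finite_Union[symmetric])
    show "I ` {..<n} \<subseteq> sets lborel" by (auto simp: I_def)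
    show "emeasure lborel (I i) \<noteq> \<infinity>" if "i \<in> {..<n}" for i
      using le[of i] that by (simp add: I_def)
  qed auto
  also have "\<dots> \<le> measure lborel {0..\<eta> powr \<nu>}"
  proof (rule measure_mono_fmeasurable)
    show "(\<Union>i<n. I i) \<subseteq> {0..\<eta> powr \<nu>}"
    proof
      fix z assume "z \<in> (\<Union>i<n. I i)"
      then obtain i where i: "i < n" "z \<in> I i" by auto
      have "(min (y i) \<eta>) powr \<nu> \<le> \<eta> powr \<nu>" using xy[OF i(1)] nu \<eta> by (intro powr_mono2) auto
      moreover have z: "(min (x i) \<eta>) powr \<nu> < z" "z < (min (y i) \<eta>) powr \<nu>"
        using i(2) by (auto simp: I_def)
      moreover have "0 \<le> z" by (rule order.trans[OF powr_ge_zero less_imp_le[OF z(1)]])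
      ultimately show "z \<in> {0..\<eta> powr \<nu>}" by simp
    qed
  qed (auto simp: I_def fmeasurable_def emeasure_lborel_Icc_eq)
  finally show ?thesis using le by (simp add: I_def)
qed

text \<open>The power \<open>s powr \<nu>\<close> is not Lipschitz at 0, so each increment is split
  at \<open>\<eta>\<close>: below it, disjoint increments add up to at most
  \<open>\<eta> powr \<nu>\<close>; above it, the slope is at most the slope \<open>K\<close> at
  \<open>\<eta>\<close>. Each part receives half of \<open>e\<close>.\<close>

lemma absolutely_continuous_fun_powr_bound:
  assumes nu: "0 < \<nu>" "\<nu> < 1" and L: "L \<ge> 0"
    and f: "\<And>x y. 0 \<le> x \<Longrightarrow> x \<le> y \<Longrightarrow> y \<le> t \<Longrightarrow> \<bar>f y - f x\<bar> \<le> L * (y powr \<nu> - x powr \<nu>)"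
  shows "absolutely_continuous_fun 0 t f"
  unfolding absolutely_continuous_fun_def
proof (intro allI impI)
  fix \<epsilon> :: real assume "\<epsilon> > 0"
  \<comment> \<open>The denominator \<open>L + 1\<close> covers \<open>L = 0\<close> and makes
    \<open>L * e < \<epsilon>\<close> strict.\<close>
  define e where "e = \<epsilon> / (L + 1)"
  have e: "e > 0" "L * e < \<epsilon>" using L \<open>\<epsilon> > 0\<close> by (auto simp: e_def field_simps)
  define \<eta> where "\<eta> = (e / 2) powr (1 / \<nu>)"
  have \<eta>: "\<eta> > 0" "\<eta> powr \<nu> = e / 2" using e nu by (auto simp: \<eta>_def powr_powr)
  define K where "K = \<nu> * \<eta> powr (\<nu> - 1)"
  have K: "K > 0" using nu \<eta> by (simp add: K_def)
  have lip: "b powr \<nu> - a powr \<nu> \<le> K * (b - a)" if "\<eta> \<le> a" "a \<le> b" for a b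
  proof (cases "a = b")
    case False
    then have "a < b" using that by simp
    have "\<exists>z>a. z < b \<and> b powr \<nu> - a powr \<nu> = (b - a) * (\<nu> * z powr (\<nu> - 1))"
      using that \<eta> by (intro MVT2[OF \<open>a < b\<close>] has_real_derivative_powr) auto
    then obtain z where z: "a < z" "z < b" "b powr \<nu> - a powr \<nu> = (b - a) * (\<nu> * z powr (\<nu> - 1))" by blast
    have "z powr (\<nu> - 1) \<le> \<eta> powr (\<nu> - 1)"
      using z that \<eta> nu by (intro powr_mono2') auto
    then have "(b - a) * (\<nu> * z powr (\<nu> - 1)) \<le> (b - a) * K"
      unfolding K_def using nu that by (intro mult_left_mono) auto
    then show ?thesis using z(3) by (simp add: mult.commute)
  qed simp
  show "\<exists>\<delta>>0. \<forall>(n::nat) x y. (\<forall>i<n. 0 \<le> x i \<and> x i \<le> y i \<and> y i \<le> t) \<and>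
      disjoint_family_on (\<lambda>i. {x i<..<y i}) {..<n} \<and> (\<Sum>i<n. y i - x i) < \<delta> \<longrightarrow>
      (\<Sum>i<n. \<bar>f (y i) - f (x i)\<bar>) < \<epsilon>"
  proof (intro exI[of _ "e / (2 * K)"] conjI allI impI)
    show "e / (2 * K) > 0" using e K by simp
    fix n :: nat and x y :: "nat \<Rightarrow> real"
    assume H: "(\<forall>i<n. 0 \<le> x i \<and> x i \<le> y i \<and> y i \<le> t) \<and>
      disjoint_family_on (\<lambda>i. {x i<..<y i}) {..<n} \<and> (\<Sum>i<n. y i - x i) < e / (2 * K)"
    have split: "y i powr \<nu> - x i powr \<nu> \<le> ((min (y i) \<eta>) powr \<nu> - (min (x i) \<eta>) powr \<nu>) + K * (y i - x i)"
      if "i < n" for i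
    proof -
      have "y i powr \<nu> - x i powr \<nu> = ((min (y i) \<eta>) powr \<nu> - (min (x i) \<eta>) powr \<nu>) +
          ((max (y i) \<eta>) powr \<nu> - (max (x i) \<eta>) powr \<nu>)"
        by (auto simp: min_def max_def)
      also have "(max (y i) \<eta>) powr \<nu> - (max (x i) \<eta>) powr \<nu> \<le> K * (max (y i) \<eta> - max (x i) \<eta>)"
        using H that by (intro lip) (auto simp: max_def)
      also have "\<dots> \<le> K * (y i - x i)"
        using H that K by (intro mult_left_mono) (auto simp: max_def)
      finally show ?thesis by simp
    qed
    have "(\<Sum>i<n. \<bar>f (y i) - f (x i)\<bar>) \<le> (\<Sum>i<n. L * (y i powr \<nu> - x i powr \<nu>))"
      using H by (intro sum_mono f) auto
    also have "\<dots> = L * (\<Sum>i<n. y i powr \<nu> - x i powr \<nu>)" by (simp add: sum_distrib_left)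
    also have "\<dots> \<le> L * e"
    proof (intro mult_left_mono L)
      have "(\<Sum>i<n. y i powr \<nu> - x i powr \<nu>) \<le>
          (\<Sum>i<n. ((min (y i) \<eta>) powr \<nu> - (min (x i) \<eta>) powr \<nu>) + K * (y i - x i))"
        by (intro sum_mono split) auto
      also have "\<dots> = (\<Sum>i<n. (min (y i) \<eta>) powr \<nu> - (min (x i) \<eta>) powr \<nu>) + K * (\<Sum>i<n. y i - x i)"
        by (simp only: sum.distrib sum_distrib_left)
      also have "\<dots> \<le> e / 2 + K * (e / (2 * K))"
      proof (intro add_mono mult_left_mono)
        show "(\<Sum>i<n. (min (y i) \<eta>) powr \<nu> - (min (x i) \<eta>) powr \<nu>) \<le> e / 2"
          using powr_increments_disjoint[of \<nu> \<eta> n x y] H nu \<eta> by auto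
      qed (use H K in auto)
      also have "\<dots> = e" using K by simp
      finally show "(\<Sum>i<n. y i powr \<nu> - x i powr \<nu>) \<le> e" .
    qed
    also have "\<dots> < \<epsilon>" by (rule e)
    finally show "(\<Sum>i<n. \<bar>f (y i) - f (x i)\<bar>) < \<epsilon>" .
  qed
qed

section \<open>Beta integrals and termwise calculus for the probability series\<close>

lemma has_integral_Beta_scaled:
  fixes a b t :: real
  assumes "a > 0" "b > 0" "t > 0"
  shows "((\<lambda>s. s powr (a - 1) * (t - s) powr (b - 1)) has_integral t powr (a + b - 1) * Beta a b) {0<..<t}"
proof -
  have "((\<lambda>u. u powr (a - 1) * (1 - u) powr (b - 1)) has_integral Beta a b) (cbox 0 1)"
    using has_integral_Beta_real[OF assms(1,2)] by simp
  from has_integral_affinity[OF this, of "1 / t" 0] assms(3)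
  have "((\<lambda>s. (s / t) powr (a - 1) * (1 - s / t) powr (b - 1)) has_integral t * Beta a b) ((\<lambda>x. t * x) ` {0..1})"
    by (simp add: divide_inverse mult.commute)
  also have "(\<lambda>x. t * x) ` {0..1} = {0..t}"
    using assms(3) by (subst image_mult_atLeastAtMost) auto
  finally have "((\<lambda>s. t powr (a + b - 2) * ((s / t) powr (a - 1) * (1 - s / t) powr (b - 1))) has_integral
      t powr (a + b - 2) * (t * Beta a b)) {0..t}"
    by (intro has_integral_mult_right)
  then have "((\<lambda>s. t powr (a + b - 2) * ((s / t) powr (a - 1) * (1 - s / t) powr (b - 1))) has_integral
      t powr (a + b - 2) * (t * Beta a b)) {0<..<t}"
    by (simp add: has_integral_Icc_iff_Ioo)
  moreover have "t powr (a + b - 2) * ((s / t) powr (a - 1) * (1 - s / t) powr (b - 1)) =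
      s powr (a - 1) * (t - s) powr (b - 1)" if "s \<in> {0<..<t}" for s
  proof -
    have "1 - s / t = (t - s) / t" using assms by (simp add: field_simps)
    then have "(s / t) powr (a - 1) * (1 - s / t) powr (b - 1) =
        s powr (a - 1) * (t - s) powr (b - 1) / (t powr (a - 1) * t powr (b - 1))"
      using that assms by (simp add: powr_divide)
    also have "t powr (a - 1) * t powr (b - 1) = t powr (a + b - 2)"
      by (simp flip: powr_add)
    finally show ?thesis using assms by simp
  qed
  ultimately have "((\<lambda>s. s powr (a - 1) * (t - s) powr (b - 1)) has_integral t powr (a + b - 2) * (t * Beta a b)) {0<..<t}"
    by (rule has_integral_eq[rotated])
  moreover have "t powr (a + b - 2) * t = t powr (a + b - 1)"
  proof -
    have "t powr (a + b - 1) = t powr ((a + b - 2) + 1)" by simp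
    also have "\<dots> = t powr (a + b - 2) * t" using assms by (subst powr_add) simp
    finally show ?thesis by simp
  qed
  ultimately show ?thesis by (simp add: mult.assoc[symmetric])
qed

lemma absolutely_integrable_Beta_scaled:
  fixes a b t :: real
  assumes "a > 0" "b > 0" "t > 0"
  shows "(\<lambda>s. s powr (a - 1) * (t - s) powr (b - 1)) absolutely_integrable_on {0<..<t}"
  by (rule nonnegative_absolutely_integrable_1)
     (use has_integral_Beta_scaled[OF assms] in \<open>auto simp: integrable_on_def\<close>)

lemma ml_prob_has_derivative:
  assumes "\<nu> > 0"
  shows "(ml_prob \<nu> k has_real_derivative (\<Sum>n. diffs (ml_coeff \<nu> k) n * a ^ n)) (at a)"
  unfolding ml_prob_def[abs_def]
  by (rule termdiffs_strong_converges_everywhere) (rule summable_ml_prob[OF assms])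

text \<open>The derivative is an everywhere convergent power series, hence bounded on compact
  intervals. Composed with \<open>lam * t powr \<nu>\<close>, this supplies the increment bound for
  absolute continuity.\<close>

lemma ml_prob_lipschitz:
  assumes "\<nu> > 0"
  obtains L where "L \<ge> 0"
    "\<And>a b. 0 \<le> a \<Longrightarrow> a \<le> b \<Longrightarrow> b \<le> X \<Longrightarrow> \<bar>ml_prob \<nu> k b - ml_prob \<nu> k a\<bar> \<le> L * (b - a)"
proof -
  let ?g = "\<lambda>a. \<Sum>n. diffs (ml_coeff \<nu> k) n * a ^ n"
  have "summable (\<lambda>n. diffs (ml_coeff \<nu> k) n * x ^ n)" for x
    by (rule termdiff_converges_all) (rule summable_ml_prob[OF assms])
  then have "continuous_on {0..X} ?g"
    by (intro continuous_at_imp_continuous_on ballI DERIV_isCont[OF termdiffs_strong_converges_everywhere])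
  then have "bounded (?g ` {0..X})"
    by (intro compact_imp_bounded compact_continuous_image) auto
  then obtain L where L: "L > 0" "\<And>x. x \<in> {0..X} \<Longrightarrow> norm (?g x) \<le> L"
    by (auto simp: bounded_pos)
  show ?thesis
  proof (rule that[of L])
    fix a b assume ab: "0 \<le> a" "a \<le> b" "b \<le> X"
    have "norm (ml_prob \<nu> k b - ml_prob \<nu> k a) \<le> L * norm (b - a)"
    proof (rule field_differentiable_bound[where S = "{0..X}"])
      show "(ml_prob \<nu> k has_real_derivative ?g x) (at x within {0..X})" for x
        by (rule has_field_derivative_at_within[OF ml_prob_has_derivative[OF assms]])
    qed (use L ab in auto)
    then show "\<bar>ml_prob \<nu> k b - ml_prob \<nu> k a\<bar> \<le> L * (b - a)" using ab by simp
  qed (use L in auto)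
qed

context
  fixes \<nu> lam :: real and k :: nat and f :: "real \<Rightarrow> real"
  assumes nu: "0 < \<nu>" "\<nu> < 1" and lam: "lam > 0"
    and f: "\<And>t. t \<ge> 0 \<Longrightarrow> f t = ml_prob \<nu> k (lam * t powr \<nu>)"
begin

lemma absolutely_continuous_ml_prob: "absolutely_continuous_fun 0 t f"
proof -
  obtain L where L: "L \<ge> 0"
    "\<And>a b. 0 \<le> a \<Longrightarrow> a \<le> b \<Longrightarrow> b \<le> lam * t powr \<nu> \<Longrightarrow> \<bar>ml_prob \<nu> k b - ml_prob \<nu> k a\<bar> \<le> L * (b - a)"
    by (rule ml_prob_lipschitz[OF nu(1), of "lam * t powr \<nu>" k]) blast
  show ?thesis
  proof (rule absolutely_continuous_fun_powr_bound[OF nu, of "L * lam"])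
    fix x y assume xy: "0 \<le> x" "x \<le> y" "y \<le> t"
    have "\<bar>f y - f x\<bar> \<le> L * (lam * y powr \<nu> - lam * x powr \<nu>)"
      unfolding f[OF xy(1)] f[OF order.trans[OF xy(1,2)]]
      using xy nu lam by (intro L mult_left_mono powr_mono2) auto
    then show "\<bar>f y - f x\<bar> \<le> L * lam * (y powr \<nu> - x powr \<nu>)" by (simp add: algebra_simps)
  qed (use L lam in auto)
qed

lemma deriv_ml_prob:
  assumes "s > 0"
  shows "deriv f s = (\<Sum>n. diffs (ml_coeff \<nu> k) n * (lam * s powr \<nu>) ^ n) * (lam * (\<nu> * s powr (\<nu> - 1)))"
proof (rule DERIV_imp_deriv)
  have "((\<lambda>t. ml_prob \<nu> k (lam * t powr \<nu>)) has_real_derivative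
      (\<Sum>n. diffs (ml_coeff \<nu> k) n * (lam * s powr \<nu>) ^ n) * (lam * (\<nu> * s powr (\<nu> - 1)))) (at s)"
    using assms
    by (intro DERIV_chain2[OF ml_prob_has_derivative[OF nu(1)]] DERIV_cmult has_real_derivative_powr)
  \<comment> \<open>The formula for \<open>f\<close> is available only at nonnegative times, but the
    open half-line is a neighbourhood of \<open>s\<close>.\<close>
  then show "(f has_real_derivative
      (\<Sum>n. diffs (ml_coeff \<nu> k) n * (lam * s powr \<nu>) ^ n) * (lam * (\<nu> * s powr (\<nu> - 1)))) (at s)"
    by (rule has_field_derivative_transform_within_open[of _ _ _ "{0<..}"]) (use assms f in auto)
qed

text \<open>Each term of the derivative is a multiple of
  \<open>s powr (\<nu> * (n + 1) - 1)\<close>, and its Beta integral against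
  \<open>(t - s) powr (- \<nu>)\<close> replaces the denominator
  \<open>Gamma (1 + \<nu> * (n + 1))\<close> by \<open>Gamma (1 + \<nu> * n)\<close>. Summability of
  the integrated norms justifies the exchange of sum and integral.\<close>

lemma caputo_ml_prob:
  assumes t: "t > 0"
  shows "set_integrable lebesgue {0<..<t} (\<lambda>s. (t - s) powr (- \<nu>) * deriv f s)" (is ?int)
    and "caputo_derivative \<nu> f t =
      (\<Sum>n. (- 1) ^ (Suc n + k) * real (Suc n choose k) * lam ^ Suc n / Gamma (1 + \<nu> * real n) * (t powr \<nu>) ^ n)" (is ?val)
proof -
  define e where "e n = (- 1) ^ (Suc n + k) * real (Suc n choose k) * lam ^ Suc n / Gamma (1 + \<nu> * real n) * (t powr \<nu>) ^ n" for n
  define d where "d n = diffs (ml_coeff \<nu> k) n * lam ^ Suc n * \<nu>" for n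
  define B where "B n s = s powr (\<nu> * real (Suc n) - 1) * (t - s) powr ((1 - \<nu>) - 1)" for n s
  define g where "g n s = indicator {0<..<t} s * (d n * B n s)" for n s
  have G: "Gamma (1 + \<nu> * real n) > 0" for n using nu by (intro Gamma_real_pos) (auto simp: add_pos_nonneg)
  have G': "Gamma (1 - \<nu>) > 0" using nu by (intro Gamma_real_pos) auto
  have B_int: "(B n has_integral t powr (\<nu> * real n) * Beta (\<nu> * real (Suc n)) (1 - \<nu>)) {0<..<t}"
    and B_abs: "B n absolutely_integrable_on {0<..<t}" for n
  proof -
    have pos: "\<nu> * real (Suc n) > 0" "1 - \<nu> > 0" using nu by auto
    have "\<nu> * real (Suc n) + (1 - \<nu>) - 1 = \<nu> * real n" by (simp add: algebra_simps)
    then show "(B n has_integral t powr (\<nu> * real n) * Beta (\<nu> * real (Suc n)) (1 - \<nu>)) {0<..<t}"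
      using has_integral_Beta_scaled[OF pos t] unfolding B_def[abs_def] by simp
    show "B n absolutely_integrable_on {0<..<t}"
      using absolutely_integrable_Beta_scaled[OF pos t] unfolding B_def[abs_def] .
  qed
  \<comment> \<open>Differentiation contributes the factor \<open>m = \<nu> * (n + 1)\<close>;
    together with \<open>Gamma m\<close> from the Beta function it cancels
    \<open>Gamma (1 + m)\<close> in the coefficient.\<close>
  have d_e: "d n * (t powr (\<nu> * real n) * Beta (\<nu> * real (Suc n)) (1 - \<nu>)) = Gamma (1 - \<nu>) * e n" for n
  proof -
    define m where "m = \<nu> * real (Suc n)"
    have m: "m > 0" using nu by (simp add: m_def)
    then have "m \<notin> \<int>\<^sub>\<le>\<^sub>0" by (auto elim!: nonpos_Ints_cases)
    then have Gm: "Gamma (1 + m) = m * Gamma m" using Gamma_plus1[of m] by (simp add: add.commute)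
    have "m + (1 - \<nu>) = 1 + \<nu> * real n" by (simp add: m_def algebra_simps)
    then have "Beta m (1 - \<nu>) = Gamma m * Gamma (1 - \<nu>) / Gamma (1 + \<nu> * real n)"
      by (simp only: Beta_def)
    moreover have "d n = (- 1) ^ (Suc n + k) * real (Suc n choose k) * lam ^ Suc n * m / Gamma (1 + m)"
      by (simp add: d_def diffs_def ml_coeff_def m_def)
    moreover have "0 \<noteq> Gamma m" using m by (intro less_imp_neq Gamma_real_pos)
    moreover have "t powr (\<nu> * real n) = (t powr \<nu>) ^ n"
      using t by (simp add: powr_powr flip: powr_realpow)
    ultimately show ?thesis
      unfolding e_def m_def[symmetric] using m by (simp add: Gm)
  qed
  have g_int: "integrable lebesgue (g n)" for n
    using B_abs[of n] unfolding g_def[abs_def] set_integrable_def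
    by (simp add: mult.left_commute)
  have B_val: "(\<integral>s. indicator {0<..<t} s * B n s \<partial>lebesgue) = t powr (\<nu> * real n) * Beta (\<nu> * real (Suc n)) (1 - \<nu>)" for n
    using set_lebesgue_integral_eq_integral(2)[OF B_abs[of n]] integral_unique[OF B_int[of n]]
    by (simp add: set_lebesgue_integral_def)
  have g_val: "(\<integral>s. g n s \<partial>lebesgue) = Gamma (1 - \<nu>) * e n" for n
  proof -
    have "(\<integral>s. g n s \<partial>lebesgue) = (\<integral>s. d n * (indicator {0<..<t} s * B n s) \<partial>lebesgue)"
      by (simp add: g_def mult.left_commute)
    then show ?thesis by (simp only: integral_mult_right_zero B_val d_e)
  qed
  have B_nonneg: "B n s \<ge> 0" for n s by (simp add: B_def)
  have g_norm_val: "(\<integral>s. norm (g n s) \<partial>lebesgue) = Gamma (1 - \<nu>) * \<bar>e n\<bar>" for n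
  proof -
    have "(\<integral>s. norm (g n s) \<partial>lebesgue) = (\<integral>s. \<bar>d n\<bar> * (indicator {0<..<t} s * B n s) \<partial>lebesgue)"
      using B_nonneg by (intro Bochner_Integration.integral_cong) (auto simp: g_def abs_mult)
    also have "\<dots> = \<bar>d n\<bar> * (t powr (\<nu> * real n) * Beta (\<nu> * real (Suc n)) (1 - \<nu>))"
      by (simp only: integral_mult_right_zero B_val)
    also have "\<dots> = \<bar>d n * (t powr (\<nu> * real n) * Beta (\<nu> * real (Suc n)) (1 - \<nu>))\<bar>"
    proof -
      have "0 \<le> t powr (\<nu> * real n) * Beta (\<nu> * real (Suc n)) (1 - \<nu>)"
        unfolding B_val[symmetric] by (intro integral_nonneg_AE AE_I2) (use B_nonneg in auto)
      then show ?thesis by (simp only: abs_mult[of "d n"] abs_of_nonneg)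
    qed
    also have "\<dots> = Gamma (1 - \<nu>) * \<bar>e n\<bar>" unfolding d_e using G' by (simp add: abs_mult)
    finally show ?thesis .
  qed
  have e_summable: "summable (\<lambda>n. \<bar>e n\<bar>)"
  proof -
    \<comment> \<open>The factor 2 absorbs the bound \<open>2 ^ Suc n\<close> for the binomial
      coefficient.\<close>
    define x where "x = 2 * lam * t powr \<nu>"
    have "\<bar>e n\<bar> \<le> 2 * lam * (\<bar>x\<bar> ^ n / Gamma (1 + \<nu> * real n))" for n
    proof -
      have "Suc n choose k \<le> 2 ^ Suc n" by (rule binomial_le_pow2)
      then have "real (Suc n choose k) \<le> 2 ^ Suc n" by (metis of_nat_le_iff of_nat_numeral of_nat_power)
      then have "real (Suc n choose k) * (lam ^ Suc n * (t powr \<nu>) ^ n) \<le> 2 ^ Suc n * (lam ^ Suc n * (t powr \<nu>) ^ n)"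
        using lam by (intro mult_right_mono) auto
      also have "\<dots> = 2 * lam * \<bar>x\<bar> ^ n" using lam by (simp add: x_def power_mult_distrib)
      finally have le: "real (Suc n choose k) * (lam ^ Suc n * (t powr \<nu>) ^ n) \<le> 2 * lam * \<bar>x\<bar> ^ n" .
      have "\<bar>e n\<bar> = real (Suc n choose k) * (lam ^ Suc n * (t powr \<nu>) ^ n) / Gamma (1 + \<nu> * real n)"
        using lam less_imp_le[OF G[of n]] unfolding e_def abs_mult abs_divide power_abs by simp
      also have "\<dots> \<le> 2 * lam * \<bar>x\<bar> ^ n / Gamma (1 + \<nu> * real n)"
        using le G[of n] by (intro divide_right_mono) auto
      finally show ?thesis by simp
    qed
    then have "\<exists>N. \<forall>n\<ge>N. norm \<bar>e n\<bar> \<le> 2 * lam * (\<bar>x\<bar> ^ n / Gamma (1 + \<nu> * real n))" by simp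
    moreover have "summable (\<lambda>n. 2 * lam * (\<bar>x\<bar> ^ n / Gamma (1 + \<nu> * real n)))"
      by (intro summable_mult summable_mittag_leffler nu)
    ultimately show ?thesis by (rule summable_comparison_test)
  qed
  have norm_summable: "summable (\<lambda>n. \<integral>s. norm (g n s) \<partial>lebesgue)"
    unfolding g_norm_val by (intro summable_mult e_summable)
  have g_sums: "(\<lambda>n. g n s) sums (indicator {0<..<t} s * ((t - s) powr (- \<nu>) * deriv f s))"
    and g_abs_summable: "summable (\<lambda>n. norm (g n s))" for s
  proof -
    have "(\<lambda>n. g n s) sums (indicator {0<..<t} s * ((t - s) powr (- \<nu>) * deriv f s)) \<and> summable (\<lambda>n. norm (g n s))"
    proof (cases "s \<in> {0<..<t}")
      case True
      let ?x = "lam * s powr \<nu>" and ?c = "lam * (\<nu> * s powr (\<nu> - 1)) * (t - s) powr (- \<nu>)"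
      have g_eq: "g n s = (diffs (ml_coeff \<nu> k) n * ?x ^ n) * ?c" for n
      proof -
        have "s powr (\<nu> * real (Suc n) - 1) = s powr (\<nu> * real n + (\<nu> - 1))" by (simp add: algebra_simps)
        also have "\<dots> = (s powr \<nu>) ^ n * s powr (\<nu> - 1)"
          using True by (subst powr_add) (simp add: powr_powr flip: powr_realpow)
        finally show ?thesis using True by (simp add: g_def B_def d_def power_mult_distrib)
      qed
      have all: "summable (\<lambda>n. diffs (ml_coeff \<nu> k) n * x ^ n)" for x
        by (rule termdiff_converges_all) (rule summable_ml_prob[OF nu(1)])
      have "(\<lambda>n. g n s) sums ((\<Sum>n. diffs (ml_coeff \<nu> k) n * ?x ^ n) * ?c)"
        unfolding g_eq by (intro sums_mult2 summable_sums all)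
      moreover have "summable (\<lambda>n. norm (diffs (ml_coeff \<nu> k) n * ?x ^ n))"
        by (rule powser_insidea[OF all[of "\<bar>?x\<bar> + 1"]]) simp
      then have "summable (\<lambda>n. norm (g n s))"
        unfolding g_eq norm_mult by (intro summable_mult2)
      ultimately show ?thesis using True by (simp add: deriv_ml_prob mult_ac)
    qed (simp add: g_def)
    then show "(\<lambda>n. g n s) sums (indicator {0<..<t} s * ((t - s) powr (- \<nu>) * deriv f s))"
      "summable (\<lambda>n. norm (g n s))" by auto
  qed
  have suminf_g: "(\<Sum>n. g n s) = indicator {0<..<t} s * ((t - s) powr (- \<nu>) * deriv f s)" for s
    using g_sums by (rule sums_unique[symmetric])
  have "integrable lebesgue (\<lambda>s. \<Sum>n. g n s)"
    by (rule integrable_suminf[OF g_int _ norm_summable]) (intro AE_I2 g_abs_summable)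
  then show ?int unfolding suminf_g by (simp add: set_integrable_def)
  have "(\<lambda>n. \<integral>s. g n s \<partial>lebesgue) sums (\<integral>s. (\<Sum>n. g n s) \<partial>lebesgue)"
    by (rule sums_integral[OF g_int _ norm_summable]) (intro AE_I2 g_abs_summable)
  then have "(\<lambda>n. Gamma (1 - \<nu>) * e n) sums (\<integral>s. indicator {0<..<t} s * ((t - s) powr (- \<nu>) * deriv f s) \<partial>lebesgue)"
    unfolding g_val suminf_g .
  then have "(\<lambda>n. 1 / Gamma (1 - \<nu>) * (Gamma (1 - \<nu>) * e n)) sums caputo_derivative \<nu> f t"
    unfolding caputo_derivative_def set_lebesgue_integral_def real_scaleR_def by (rule sums_mult)
  then have "e sums caputo_derivative \<nu> f t" using less_imp_neq[OF G'] by simp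
  then show ?val unfolding e_def[abs_def] by (rule sums_unique)
qed

text \<open>Pascal's rule splits \<open>Suc n choose k\<close> into the coefficients belonging to
  \<open>k\<close> and to \<open>k - 1\<close>. The raised exponent of \<open>- 1\<close> gives the
  first part the sign of \<open>- lam\<close>; lowering \<open>k\<close> flips the sign of the
  second part back.\<close>

lemma caputo_ml_prob_eq:
  assumes t: "t > 0"
  shows "caputo_derivative \<nu> f t = - lam * ml_prob \<nu> k (lam * t powr \<nu>) +
    lam * (case k of 0 \<Rightarrow> 0 | Suc j \<Rightarrow> ml_prob \<nu> j (lam * t powr \<nu>))"
proof -
  let ?x = "lam * t powr \<nu>"
  let ?e = "\<lambda>n. (- 1) ^ (Suc n + k) * real (Suc n choose k) * lam ^ Suc n / Gamma (1 + \<nu> * real n) * (t powr \<nu>) ^ n"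
  have s: "(\<lambda>n. ml_coeff \<nu> i n * ?x ^ n) sums ml_prob \<nu> i ?x" for i
    unfolding ml_prob_def by (rule summable_sums[OF summable_ml_prob[OF nu(1)]])
  have "?e sums (- lam * ml_prob \<nu> k ?x + lam * (case k of 0 \<Rightarrow> 0 | Suc j \<Rightarrow> ml_prob \<nu> j ?x))"
  proof (cases k)
    case 0
    have "?e n = - lam * (ml_coeff \<nu> k n * ?x ^ n)" for n
      using 0 by (simp add: ml_coeff_def power_mult_distrib)
    then show ?thesis using sums_mult[OF s[of k], of "- lam"] 0 by simp
  next
    case (Suc j)
    have "?e n = - lam * (ml_coeff \<nu> k n * ?x ^ n) + lam * (ml_coeff \<nu> j n * ?x ^ n)" for n
      using Suc by (simp add: ml_coeff_def power_mult_distrib add_divide_distrib diff_divide_distrib algebra_simps)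
    then show ?thesis
      using sums_add[OF sums_mult[OF s[of k], of "- lam"] sums_mult[OF s[of j], of lam]] Suc by simp
  qed
  then show ?thesis unfolding caputo_ml_prob(2)[OF t] by (simp only: sums_iff)
qed

end

section \<open>The marginal laws\<close>

lemma time_fractional_poisson_marginal:
  assumes nu: "0 < \<nu>" "\<nu> < 1" and lam: "lam > 0" and Q: "prob_space Q"
    and X: "time_fractional_poisson_process Q lam \<nu> X" and t: "t > 0"
  shows "measure Q {\<omega> \<in> space Q. X t \<omega> = k} = ml_prob \<nu> k (lam * t powr \<nu>)"
proof -
  from X obtain N D where N: "poisson_process Q lam N" and D: "stable_subordinator Q \<nu> D"
    and indep: "indep_random_vars Q (PiM {0..} (\<lambda>_. count_space UNIV)) (path_var N)
          (PiM {0..} (\<lambda>_. borel)) (path_var D)"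
    and X_eq: "\<And>t \<omega>. t \<ge> 0 \<Longrightarrow> \<omega> \<in> space Q \<Longrightarrow> X t \<omega> = N (enn2real (inverse_subordinator D t \<omega>)) \<omega>"
    unfolding time_fractional_poisson_process_def by blast
  interpret prob_space Q by fact
  interpret stable_subordinator_on Q \<nu> D
    using nu D by unfold_locales
  let ?E = "\<lambda>\<omega>. enn2real (inverse_subordinator D t \<omega>)"
  have "measure Q {\<omega> \<in> space Q. X t \<omega> = k} = measure Q {\<omega> \<in> space Q. N (?E \<omega>) \<omega> = k}"
    using X_eq t by (intro arg_cong[where f = "measure Q"]) auto
  \<comment> \<open>The independent object is the entire path of \<open>D\<close>; the random time
    is its measurable functional \<open>first_passage t\<close>.\<close>
  also have "\<dots> = expectation (\<lambda>\<omega>. exp (- (lam * ?E \<omega>)) * (lam * ?E \<omega>) ^ k / fact k)"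
    by (rule poisson_random_time_indep[OF Q N lam disjI2[OF indep] first_passage_measurable])
       (simp_all add: first_passage_path_var[OF D_mono])
  also have "\<dots> = ml_prob \<nu> k (lam * t powr \<nu>)"
    using nu lam inverse_moments[OF t] inverse_measurable
    by (intro poisson_mixture_eq_ml_prob) auto
  finally show ?thesis .
qed

theorem mainTheorem1:
  fixes lam \<nu> :: real
    and P :: "'a measure" and Q :: "'b measure"
    and N :: "real \<Rightarrow> 'a \<Rightarrow> nat" and W :: "'a \<Rightarrow> real"
    and q :: "real \<Rightarrow> real" and M :: "real \<Rightarrow> 'a \<Rightarrow> nat"
    and X :: "real \<Rightarrow> 'b \<Rightarrow> nat"
    and p :: "nat \<Rightarrow> real \<Rightarrow> real"
  assumes lam: "lam > 0" and nu: "0 < \<nu>" "\<nu> < 1"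
    and P: "prob_space P"
    and N: "poisson_process P 1 N"
    and W_nonneg: "\<forall>\<omega>\<in>space P. 0 \<le> W \<omega>"
    and W_density:
      "distributed P lborel W (\<lambda>w. ennreal (indicator {0..} w * wright_density \<nu> w))"
    and W_indep: "indep_random_vars P borel W
      (PiM {0..} (\<lambda>_. count_space UNIV)) (path_var N)"
    and q: "\<And>t. t \<ge> 0 \<Longrightarrow> q t = lam * t powr \<nu> / Gamma (1 + \<nu>)"
    and M: "\<And>t \<omega>. t \<ge> 0 \<Longrightarrow> \<omega> \<in> space P \<Longrightarrow> M t \<omega> = N (W \<omega> * q t) \<omega>"
    and Q: "prob_space Q"
    and X: "time_fractional_poisson_process Q lam \<nu> X"
    and p: "\<And>k t. t \<ge> 0 \<Longrightarrow> p k t = measure P {\<omega> \<in> space P. M t \<omega> = k}"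
  shows "(\<forall>t>0. \<forall>k. measure P {\<omega> \<in> space P. M t \<omega> = k}
                   = measure Q {\<omega> \<in> space Q. X t \<omega> = k})
       \<and> (\<forall>t>0. \<forall>k. caputo_differentiable \<nu> (p k) t \<and>
            caputo_derivative \<nu> (p k) t
              = - lam * p k t + lam * (case k of 0 \<Rightarrow> 0 | Suc j \<Rightarrow> p j t))"
proof -
  interpret P: prob_space P by (rule P)
  have g: "Gamma (1 + \<nu>) > 0" using nu by (auto intro!: Gamma_real_pos)
  have W_meas: "W \<in> borel_measurable P" using W_indep by (simp add: indep_random_vars_def)
  \<comment> \<open>Time 0 is included because absolute continuity on \<open>[0, t]\<close> involves
    the value of \<open>p k\<close> there.\<close>
  have M_prob: "measure P {\<omega> \<in> space P. M t \<omega> = k} = ml_prob \<nu> k (lam * t powr \<nu>)" if t: "t \<ge> 0" for t k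
  proof -
    have q_nonneg: "q t \<ge> 0" using q[OF t] lam g by simp
    have "measure P {\<omega> \<in> space P. M t \<omega> = k} = measure P {\<omega> \<in> space P. N (W \<omega> * q t) \<omega> = k}"
      using M[OF t] by (intro arg_cong[where f = "measure P"]) auto
    also have "\<dots> = P.expectation (\<lambda>\<omega>. exp (- (1 * (W \<omega> * q t))) * (1 * (W \<omega> * q t)) ^ k / fact k)"
      by (rule poisson_random_time_indep[OF P N _ disjI1[OF W_indep], where h = "\<lambda>w. w * q t"])
         (use W_nonneg q_nonneg in auto)
    also have "\<dots> = P.expectation (\<lambda>\<omega>. exp (- (q t * W \<omega>)) * (q t * W \<omega>) ^ k / fact k)"
      by (simp add: mult.commute)
    \<comment> \<open>Here the rate is \<open>q t\<close> and the moments of \<open>W\<close> carry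
      the scale \<open>Gamma (1 + \<nu>)\<close>; for the fractional process the rate is
      \<open>lam\<close> and the scale \<open>t powr \<nu>\<close>. Both products equal
      \<open>lam * t powr \<nu>\<close>, the only quantity that enters the series.\<close>
    also have "\<dots> = ml_prob \<nu> k (q t * Gamma (1 + \<nu>))"
      using nu g q_nonneg W_meas W_nonneg wright_variable_integrable_power[OF nu P W_density]
        wright_variable_moment[OF nu P W_density]
      by (intro P.poisson_mixture_eq_ml_prob) auto
    also have "q t * Gamma (1 + \<nu>) = lam * t powr \<nu>" using q[OF t] less_imp_neq[OF g] by simp
    finally show ?thesis .
  qed
  have p_eq: "p k t = ml_prob \<nu> k (lam * t powr \<nu>)" if "t \<ge> 0" for k t
    using p[OF that] M_prob[OF that] by simp
  show ?thesis
  proof (intro conjI allI impI)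
    fix t :: real and k :: nat assume t: "t > 0"
    show "measure P {\<omega> \<in> space P. M t \<omega> = k} = measure Q {\<omega> \<in> space Q. X t \<omega> = k}"
      using t by (simp add: M_prob time_fractional_poisson_marginal[OF nu lam Q X])
    show "caputo_differentiable \<nu> (p k) t"
      unfolding caputo_differentiable_def
      using absolutely_continuous_ml_prob[OF nu lam p_eq] caputo_ml_prob(1)[OF nu lam p_eq t] by blast
    show "caputo_derivative \<nu> (p k) t = - lam * p k t + lam * (case k of 0 \<Rightarrow> 0 | Suc j \<Rightarrow> p j t)"
      using caputo_ml_prob_eq[OF nu lam p_eq t, of k] t by (simp add: p_eq split: nat.split)
  qed
qed

end
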